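(* Let $A\subset\mathbb{Z}^n$ be a circuit. Then for generic coefficients $c=(c_\alpha)_{\alpha\in A}\in(\mathbb{C}^* )^A$, the Laurent polynomial $f(z)=\sum_{\alpha\in A}c_\alpha z^\alpha$ is such that the complement of the closed lopsided coamoeba $\overline{\mathcal{LA}'}(f)$ in $\mathbf{T}^n$, and hence also the complement of the closed coamoeba $\overline{\mathcal{A}'}(f)$ in $\mathbf{T}^n$, has exactly $n!\operatorname{Vol}(\Delta_f)$ connected components.
   Context: $A=\{\alpha_0,\dots,\alpha_{n+1}\}\subset\mathbb{Z}^n$ is called a circuit here if it has $n+2$ elements and all maximal, i.e. $(n+1)\times(n+1)$, minors of the $(n+1)\times(n+2)$ matrix with columns $(1,\alpha_k)^t$ are nonzero. $\Delta_f=\operatorname{Conv}(A)$ is the Newton polytope and $\operatorname{Vol}$ is Euclidean volume in $\mathbb{R}^n$. "For generic coefficients" means: for all $c$ in some open dense subset of $(\mathbb{C}^* )^A$. $\mathbf{T}^n=(\mathbb{R}/2\pi\mathbb{Z})^n$. The coamoeba $\mathcal{A}'(f)\subset\mathbf{T}^n$ is the image of the zero locus $V(f)\subset(\mathbb{C}^* )^n$ under $\operatorname{Arg}(z)=(\arg z_1,\dots,\arg z_n)$. A half-space is a set $H_\phi=\{z\in\mathbb{C}\mid \Re(e^{i\phi}z)>0\}$, $\phi\in\mathbb{R}$. For $\theta\in\mathbf{T}^n$ put $f\langle\theta\rangle=\{e^{i(\arg(c_{\alpha})+\langle\alpha,\theta\rangle)}\mid\alpha\in A\}$. It is lopsided if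 there is a half-space $H$ with $f\langle\theta\rangle\subset\overline{H}$ but $f\langle\theta\rangle\not\subset\partial H$. The lopsided coamoeba $\mathcal{LA}'(f)$ is the set of $\theta\in\mathbf{T}^n$ such that $f\langle\theta\rangle$ is not lopsided. Overlines denote closures in $\mathbf{T}^n$. *)

theory Defs
  imports "HOL-Analysis.Analysis" "HOL-Library.Real_Mod"
begin

section \<open>The torus\<close>

quotient_type angle = real / "\<lambda>x y. [x = y] (rmod 2 * pi)"
  by (intro equivpI reflpI sympI transpI) (auto intro: rcong_sym rcong_trans)

text \<open>
  The type \<open>angle\<close> is \<open>\<real> / 2\<pi>\<int>\<close> with its quotient group structure and
  quotient topology. The torus \<open>\<^bold>T\<^sup>n\<close> is \<open>angle ^ 'n\<close>; the library gives
  this vector type the product topology.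
\<close>

instantiation angle :: ab_group_add
begin

lift_definition zero_angle :: angle is "0 :: real" .

lift_definition plus_angle :: "angle \<Rightarrow> angle \<Rightarrow> angle" is "(+)"
  by (rule rcong_add)

lift_definition minus_angle :: "angle \<Rightarrow> angle \<Rightarrow> angle" is "(-)"
  by (rule rcong_diff)

lift_definition uminus_angle :: "angle \<Rightarrow> angle" is uminus
  by (rule rcong_uminus)

instance
  by standard (transfer; simp add: algebra_simps)+

end

instantiation angle :: topological_space
begin

definition open_angle :: "angle set \<Rightarrow> bool" where
  "open_angle U \<longleftrightarrow> open (abs_angle -` U)"

instance
  by standard (auto simp: open_angle_def vimage_Union)

end

lift_definition scale_angle :: "int \<Rightarrow> angle \<Rightarrow> angle" is "\<lambda>m x. of_int m * x"
proof -
  fix m :: int and x y :: real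
  assume "[x = y] (rmod 2 * pi)"
  then obtain k :: int where "y = x + of_int k * (2 * pi)"
    by (auto simp: rcong_altdef)
  hence "of_int m * y = of_int m * x + of_int (m * k) * (2 * pi)"
    by (simp add: algebra_simps)
  thus "[of_int m * x = of_int m * y] (rmod 2 * pi)"
    unfolding rcong_altdef by blast
qed

lift_definition cis_angle :: "angle \<Rightarrow> complex" is cis
  by (rule cis_cong)

lift_definition arg_angle :: "complex \<Rightarrow> angle" is Arg .

definition pairing :: "int ^ 'n \<Rightarrow> angle ^ 'n \<Rightarrow> angle" where
  "pairing \<alpha> \<theta> = (\<Sum>k\<in>UNIV. scale_angle (\<alpha> $ k) (\<theta> $ k))"

section \<open>Circuits and Newton polytopes\<close>

text \<open>
  Rows and columns of a maximal minor are both indexed by \<open>'n option\<close>, a type with \<open>n + 1\<close>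
  elements; \<open>None\<close> is the row of ones. Every ordered choice \<open>a\<close> of \<open>n + 1\<close> distinct columns
  is considered, so each minor occurs once for every order of its columns.
\<close>

definition column_matrix :: "('n option \<Rightarrow> int ^ 'n) \<Rightarrow> int ^ ('n::finite) option ^ 'n option" where
  "column_matrix a = (\<chi> r j. case r of None \<Rightarrow> 1 | Some k \<Rightarrow> a j $ k)"

definition circuit :: "(int ^ 'n::finite) set \<Rightarrow> bool" where
  "circuit A \<longleftrightarrow> card A = CARD('n) + 2 \<and>
     (\<forall>a :: 'n option \<Rightarrow> int ^ 'n. inj a \<and> range a \<subseteq> A \<longrightarrow> det (column_matrix a) \<noteq> 0)"

definition newton_polytope :: "(int ^ 'n) set \<Rightarrow> (real ^ 'n) set" where
  "newton_polytope A = convex hull ((\<lambda>\<alpha>. \<chi> k. real_of_int (\<alpha> $ k)) ` A)"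

section \<open>Laurent polynomials and coamoebas\<close>

definition laurent :: "(int ^ 'n) set \<Rightarrow> (int ^ 'n \<Rightarrow> complex) \<Rightarrow> complex ^ 'n \<Rightarrow> complex" where
  "laurent A c z = (\<Sum>\<alpha>\<in>A. c \<alpha> * (\<Prod>k\<in>UNIV. z $ k powi \<alpha> $ k))"

definition zero_locus :: "(int ^ 'n) set \<Rightarrow> (int ^ 'n \<Rightarrow> complex) \<Rightarrow> (complex ^ 'n) set" where
  "zero_locus A c = {z. (\<forall>k. z $ k \<noteq> 0) \<and> laurent A c z = 0}"

definition coamoeba :: "(int ^ 'n) set \<Rightarrow> (int ^ 'n \<Rightarrow> complex) \<Rightarrow> (angle ^ 'n) set" where
  "coamoeba A c = (\<lambda>z. \<chi> k. arg_angle (z $ k)) ` zero_locus A c"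

definition half_space :: "real \<Rightarrow> complex set" where
  "half_space \<phi> = {z. Re (cis \<phi> * z) > 0}"

definition monomial_directions ::
    "(int ^ 'n) set \<Rightarrow> (int ^ 'n \<Rightarrow> complex) \<Rightarrow> angle ^ 'n \<Rightarrow> complex set" where
  "monomial_directions A c \<theta> = {cis_angle (arg_angle (c \<alpha>) + pairing \<alpha> \<theta>) | \<alpha>. \<alpha> \<in> A}"

definition lopsided :: "complex set \<Rightarrow> bool" where
  "lopsided S \<longleftrightarrow>
     (\<exists>\<phi>. S \<subseteq> closure (half_space \<phi>) \<and> \<not> S \<subseteq> frontier (half_space \<phi>))"

definition lopsided_coamoeba ::
    "(int ^ 'n) set \<Rightarrow> (int ^ 'n \<Rightarrow> complex) \<Rightarrow> (angle ^ 'n) set" where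
  "lopsided_coamoeba A c = {\<theta>. \<not> lopsided (monomial_directions A c \<theta>)}"

section \<open>Generic coefficients\<close>

text \<open>
  \<open>(\<complex>\<^sup>*)\<^sup>A\<close> consists of the functions on \<open>A\<close> with nonzero values, extended by
  \<^const>\<open>undefined\<close> outside \<open>A\<close>.
\<close>

definition coefficient_space :: "'a set \<Rightarrow> ('a \<Rightarrow> complex) topology" where
  "coefficient_space A = product_topology (\<lambda>\<alpha>. top_of_set (- {0})) A"

definition for_generic_coefficients :: "'a set \<Rightarrow> (('a \<Rightarrow> complex) \<Rightarrow> bool) \<Rightarrow> bool" where
  "for_generic_coefficients A P \<longleftrightarrow>
     (\<exists>U. openin (coefficient_space A) U \<and>
          coefficient_space A closure_of U = topspace (coefficient_space A) \<and>
          (\<forall>c\<in>U. P c))"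

definition has_components :: "'a::topological_space set \<Rightarrow> real \<Rightarrow> bool" where
  "has_components S r \<longleftrightarrow> finite (components S) \<and> real (card (components S)) = r"

end

theory Submission
  imports Defs
begin

text \<open>
  On the universal cover \<open>\<real>\<^sup>n\<close> put \<open>u x \<alpha> = Arg (c \<alpha>) + \<langle>\<alpha>, x\<rangle>\<close>, and let \<open>l\<close> be an integer affine
  relation between the points of \<open>A\<close> with \<open>\<bar>l \<alpha>\<bar>\<close> the lattice volume of the simplex on \<open>A - {\<alpha>}\<close>;
  coefficients are generic when \<open>\<Prod> c \<alpha> ^ l \<alpha>\<close> is not real. A point lies outside the closed lopsided
  coamoeba iff all directions \<open>cis (u x \<alpha>)\<close> lie in an open half-plane, that is, iff suitable lifts
  \<open>u x \<alpha> + 2 \<pi> m \<alpha>\<close> differ by less than \<open>\<pi>\<close>; each \<open>m\<close> gives a convex open set \<open>P m\<close>. Averaging the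
  lifts with weights \<open>l\<close> shows that \<open>P m\<close> is nonempty iff the integer \<open>\<Sum> l \<alpha> * m \<alpha>\<close> lies in a window
  of length \<open>\<Sum> l \<alpha>\<close>, the sum over positive \<open>l \<alpha>\<close>, which is \<open>n!\<close> times the volume of the polytope.
  Modulo deck transformations and constants there are as many such \<open>m\<close> as the window is long.

  The coamoeba consists of the \<open>x\<close> for which some positive weights \<open>t\<close> with \<open>\<Sum> t \<alpha> * cis (u x \<alpha>) = 0\<close>
  satisfy one further equation \<open>\<Sum> l \<alpha> * ln (t \<alpha>) = \<gamma>\<close>. A complement point at which all these sums
  stay below \<open>\<gamma>\<close> is joined to some \<open>P m\<close> by a segment along which this remains true, by concavity of
  \<open>ln \<circ> cos\<close>; the case above \<open>\<gamma>\<close> follows by changing the sign of \<open>l\<close>. Finally distinct \<open>P m\<close> stay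
  separated in the complement of the closed coamoeba, because two phases can pass through antipodal
  positions only at a limit of coamoeba points.
\<close>

text \<open>In the lopsided complement the cells are disjoint open convex sets and nothing can go
  wrong; the obstacle is that the complement of the closed coamoeba is larger. Two facts control the
  excess. First, \<open>Sol x\<close> is convex, so outside the closed coamoeba
  \<open>h - \<gamma>\<close> has one sign on it. Below \<open>\<gamma>\<close>, no nonzero
  vanishing combination with nonnegative weights can omit an index with \<open>l\<close> negative: a
  small weight at this index would drive \<open>h\<close> to infinity. Hence all directions except
  any one such index lie in a half-plane, and this provides the lifts for the segments. With one
  negative index the positive ones are contracted; with several it suffices to move two of them.
  Second, a vanishing combination whose zeros include indices of both signs always belongs to the
  closed coamoeba, because small weights at two such indices can be balanced against each other to
  reach the value \<open>\<gamma>\<close>. Genericity keeps the directions at a point from being all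
  collinear, and keeps the ends of the window off the integers, so that the count is exact.\<close>

definition vreal :: "int ^ 'm \<Rightarrow> real ^ 'm" where
  "vreal y = (\<chi> i. real_of_int (y $ i))"

section \<open>A contraction inequality for positive combinations of directions\<close>

lemma concave_ln_cos: "concave_on {-pi/2<..<pi/2} (\<lambda>x. ln (cos x))"
proof -
  have "convex_on {-pi/2<..<pi/2} (\<lambda>x. - ln (cos x))"
  proof (rule f''_ge0_imp_convex)
    fix x :: real assume x: "x \<in> {-pi/2<..<pi/2}"
    then have c: "cos x > 0" by (simp add: cos_gt_zero_pi)
    show "((\<lambda>x. - ln (cos x)) has_real_derivative tan x) (at x)"
      using c by (auto intro!: derivative_eq_intros simp: tan_def field_simps)
    show "(tan has_real_derivative inverse ((cos x)\<^sup>2)) (at x)"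
      using c by (intro DERIV_tan) auto
  qed auto
  then show ?thesis by (simp add: concave_on_def)
qed

text \<open>The value of \<open>\<beta>\<close> is a stationary point of the dual of maximising
  \<open>\<Sum> l x * ln (t x)\<close> subject to \<open>\<Sum> t x * cis (w x) = 1\<close>.\<close>

lemma ex_dual_angle:
  fixes l w :: "'a \<Rightarrow> real"
  assumes fin: "finite B" and l: "\<And>x. x \<in> B \<Longrightarrow> l x > 0"
    and w: "\<And>x y. x \<in> B \<Longrightarrow> y \<in> B \<Longrightarrow> \<bar>w x - w y\<bar> < pi"
    and neg: "p \<in> B" "w p < 0" and pos: "q \<in> B" "w q > 0"
  obtains \<beta> where "\<bar>\<beta>\<bar> < pi/2" "\<And>x. x \<in> B \<Longrightarrow> \<bar>w x - \<beta>\<bar> < pi/2"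
    "(\<Sum>x\<in>B. l x * sin (w x) / cos (w x - \<beta>)) = 0"
proof -
  have ne: "B \<noteq> {}" using neg by auto
  define M where "M = Max (w ` B)"
  define m where "m = Min (w ` B)"
  have M: "w x \<le> M" and m: "m \<le> w x" if "x \<in> B" for x
    using that fin by (auto simp: M_def m_def)
  obtain xM where xM: "xM \<in> B" "w xM = M"
    using fin ne by (metis (no_types, opaque_lifting) M_def Max_in finite_imageI image_iff image_is_empty)
  obtain xm where xm: "xm \<in> B" "w xm = m"
    using fin ne by (metis (no_types, opaque_lifting) m_def Min_in finite_imageI image_iff image_is_empty)
  have M0: "M > 0" using M pos by force
  have m0: "m < 0" using m neg by force
  have Mm: "M - m < pi" using w[OF xM(1) xm(1)] xM xm by auto
  \<comment> \<open>All cosines are positive for \<open>\<beta>\<close> between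
    \<open>M - pi/2\<close> and \<open>m + pi/2\<close>. At the left end the term of
    \<open>xM\<close> tends to infinity, at the right end that of \<open>xm\<close> tends to minus
    infinity, so there is a zero in between.\<close>
  define \<phi> where "\<phi> \<beta> = (\<Sum>x\<in>B. l x * sin (w x) / cos (w x - \<beta>))" for \<beta>
  have cp: "cos (w x - \<beta>) > 0" if "x \<in> B" "M - pi/2 < \<beta>" "\<beta> < m + pi/2" for x \<beta>
    using M[OF that(1)] m[OF that(1)] that by (intro cos_gt_zero_pi) auto
  have cont: "continuous_on {M - pi/2<..<m + pi/2} \<phi>"
    unfolding \<phi>_def using cp by (intro continuous_intros) force+
  define \<psi> where "\<psi> x \<beta> = l x * sin (w x) / cos (w x - \<beta>)" for x \<beta>
  \<comment> \<open>Several indices may attain \<open>M\<close>, so the remaining terms need not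
    converge. Only those with \<open>w x\<close> negative are kept: they are continuous at the end
    point, and the discarded terms are nonnegative.\<close>
  have top: "filterlim (\<lambda>\<beta>. (\<Sum>x\<in>B-{xM}. if w x < 0 then \<psi> x \<beta> else 0) + \<psi> xM \<beta>) at_top (at_right (M - pi/2))"
  proof (rule filterlim_tendsto_add_at_top)
    show "((\<lambda>\<beta>. \<Sum>x\<in>B - {xM}. if w x < 0 then \<psi> x \<beta> else 0) \<longlongrightarrow>
        (\<Sum>x\<in>B - {xM}. if w x < 0 then \<psi> x (M - pi/2) else 0)) (at_right (M - pi/2))"
    proof (intro tendsto_sum)
      fix x assume x: "x \<in> B - {xM}"
      show "((\<lambda>\<beta>. if w x < 0 then \<psi> x \<beta> else 0) \<longlongrightarrow> (if w x < 0 then \<psi> x (M - pi/2) else 0)) (at_right (M - pi/2))"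
      proof (cases "w x < 0")
        case True
        have "cos (w x - (M - pi/2)) > 0"
          using True x M[of x] m[of x] M0 Mm by (intro cos_gt_zero_pi) auto
        then show ?thesis using True unfolding \<psi>_def by (auto intro!: tendsto_eq_intros)
      qed auto
    qed
    have "sin M > 0" using M0 Mm m0 by (intro sin_gt_zero) auto
    have "filterlim (\<lambda>\<beta>. (l xM * sin M) / cos (M - \<beta>)) at_top (at_right (M - pi/2))"
    proof (rule LIM_at_top_divide)
      show "((\<lambda>\<beta>. l xM * sin M) \<longlongrightarrow> l xM * sin M) (at_right (M - pi/2))" by simp
      show "0 < l xM * sin M" using l xM \<open>sin M > 0\<close> by auto
      show "((\<lambda>\<beta>. cos (M - \<beta>)) \<longlongrightarrow> 0) (at_right (M - pi / 2))"
        by (auto intro!: tendsto_eq_intros)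
      show "\<forall>\<^sub>F \<beta> in at_right (M - pi / 2). 0 < cos (M - \<beta>)"
        unfolding eventually_at_right_field
        by (rule exI[of _ M]) (auto intro!: cos_gt_zero_pi)
    qed
    then show "filterlim (\<lambda>\<beta>. \<psi> xM \<beta>) at_top (at_right (M - pi / 2))"
      unfolding \<psi>_def xM(2) .
  qed
  have bot: "filterlim (\<lambda>\<beta>. (\<Sum>x\<in>B-{xm}. if w x > 0 then \<psi> x \<beta> else 0) + \<psi> xm \<beta>) at_bot (at_left (m + pi/2))"
    unfolding filterlim_uminus_at_bot minus_add_distrib sum_negf[symmetric]
  proof (rule filterlim_tendsto_add_at_top)
    show "((\<lambda>\<beta>. \<Sum>x\<in>B - {xm}. - (if w x > 0 then \<psi> x \<beta> else 0)) \<longlongrightarrow>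
        (\<Sum>x\<in>B - {xm}. - (if w x > 0 then \<psi> x (m + pi/2) else 0))) (at_left (m + pi/2))"
    proof (intro tendsto_sum)
      fix x assume x: "x \<in> B - {xm}"
      show "((\<lambda>\<beta>. - (if w x > 0 then \<psi> x \<beta> else 0)) \<longlongrightarrow> - (if w x > 0 then \<psi> x (m + pi/2) else 0)) (at_left (m + pi/2))"
      proof (cases "w x > 0")
        case True
        have "cos (w x - (m + pi/2)) > 0"
          using True x M[of x] m[of x] m0 Mm by (intro cos_gt_zero_pi) auto
        then show ?thesis using True unfolding \<psi>_def by (auto intro!: tendsto_eq_intros)
      qed auto
    qed
    have "sin (-m) > 0" using M0 Mm m0 by (intro sin_gt_zero) auto
    have "filterlim (\<lambda>\<beta>. (l xm * sin (-m)) / cos (m - \<beta>)) at_top (at_left (m + pi/2))"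
    proof (rule LIM_at_top_divide)
      show "((\<lambda>\<beta>. l xm * sin (-m)) \<longlongrightarrow> l xm * sin (-m)) (at_left (m + pi/2))" by simp
      show "0 < l xm * sin (-m)" using l xm \<open>sin (-m) > 0\<close> by (intro mult_pos_pos) auto
      show "((\<lambda>\<beta>. cos (m - \<beta>)) \<longlongrightarrow> 0) (at_left (m + pi / 2))"
        by (auto intro!: tendsto_eq_intros)
      show "\<forall>\<^sub>F \<beta> in at_left (m + pi / 2). 0 < cos (m - \<beta>)"
        unfolding eventually_at_left_field
        by (rule exI[of _ m]) (auto intro!: cos_gt_zero_pi)
    qed
    then show "filterlim (\<lambda>\<beta>. - \<psi> xm \<beta>) at_top (at_left (m + pi / 2))"
      unfolding \<psi>_def xm(2) by simp
  qed
  have lo_hi: "M - pi/2 < m + pi/2" using Mm by auto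
  have sgn_pos: "sin (w x) \<ge> 0" if "x \<in> B" "w x \<ge> 0" for x
    using that M[of x] Mm m0 by (intro sin_ge_zero) auto
  have sgn_neg: "sin (w x) \<le> 0" if "x \<in> B" "w x \<le> 0" for x
    using that m[of x] Mm M0 sin_ge_zero[of "- w x"] by auto
  have "\<forall>\<^sub>F \<beta> in at_right (M - pi/2). \<phi> \<beta> > 0"
  proof -
    have "\<forall>\<^sub>F \<beta> in at_right (M - pi/2). \<psi> xM \<beta> + (\<Sum>x\<in>B-{xM}. if w x < 0 then \<psi> x \<beta> else 0) > 0"
      using top by (simp add: filterlim_at_top_dense add.commute)
    moreover have "\<forall>\<^sub>F \<beta> in at_right (M - pi/2). \<beta> \<in> {M - pi/2<..<m + pi/2}"
      using lo_hi by (rule eventually_at_right_real)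
    ultimately show ?thesis
    proof eventually_elim
      case (elim \<beta>)
      have "\<psi> xM \<beta> + (\<Sum>x\<in>B-{xM}. if w x < 0 then \<psi> x \<beta> else 0) \<le> \<psi> xM \<beta> + (\<Sum>x\<in>B-{xM}. \<psi> x \<beta>)"
        using elim(2) cp sgn_pos l by (intro add_left_mono sum_mono) (auto simp: \<psi>_def less_imp_le)
      also have "\<dots> = \<phi> \<beta>" using xM(1) fin by (simp add: \<phi>_def \<psi>_def sum.remove)
      finally show ?case using elim(1) by simp
    qed
  qed
  then have "\<forall>\<^sub>F \<beta> in at_right (M - pi/2). \<phi> \<beta> > 0 \<and> \<beta> \<in> {M - pi/2<..<m + pi/2}"
    using eventually_at_right_real[OF lo_hi] by (rule eventually_conj)
  then obtain b1 where b1: "\<phi> b1 > 0" "M - pi/2 < b1" "b1 < m + pi/2"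
    using eventually_happens'[OF trivial_limit_at_right_real] by fastforce
  have "\<forall>\<^sub>F \<beta> in at_left (m + pi/2). \<phi> \<beta> < 0"
  proof -
    have "\<forall>\<^sub>F \<beta> in at_left (m + pi/2). \<psi> xm \<beta> + (\<Sum>x\<in>B-{xm}. if w x > 0 then \<psi> x \<beta> else 0) < 0"
      using bot by (simp add: filterlim_at_bot_dense add.commute)
    moreover have "\<forall>\<^sub>F \<beta> in at_left (m + pi/2). \<beta> \<in> {M - pi/2<..<m + pi/2}"
      using lo_hi by (rule eventually_at_left_real)
    ultimately show ?thesis
    proof eventually_elim
      case (elim \<beta>)
      have "\<phi> \<beta> = \<psi> xm \<beta> + (\<Sum>x\<in>B-{xm}. \<psi> x \<beta>)"
        using xm(1) fin by (simp add: \<phi>_def \<psi>_def sum.remove)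
      also have "\<dots> \<le> \<psi> xm \<beta> + (\<Sum>x\<in>B-{xm}. if w x > 0 then \<psi> x \<beta> else 0)"
        using elim(2) cp sgn_neg l
        by (intro add_left_mono sum_mono) (auto simp: \<psi>_def less_imp_le mult_nonneg_nonpos divide_nonpos_nonneg not_less)
      finally show ?case using elim(1) by simp
    qed
  qed
  then have "\<forall>\<^sub>F \<beta> in at_left (m + pi/2). \<phi> \<beta> < 0 \<and> \<beta> \<in> {M - pi/2<..<m + pi/2}"
    using eventually_at_left_real[OF lo_hi] by (rule eventually_conj)
  then obtain b2 where b2: "\<phi> b2 < 0" "M - pi/2 < b2" "b2 < m + pi/2"
    using eventually_happens'[OF trivial_limit_at_left_real] by fastforce
  have con: "connected (\<phi> ` {M - pi/2<..<m + pi/2})"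
    by (intro connected_continuous_image cont connected_Ioo)
  have im: "\<phi> b1 \<in> \<phi> ` {M - pi/2<..<m + pi/2}" "\<phi> b2 \<in> \<phi> ` {M - pi/2<..<m + pi/2}"
    by (rule imageI, use b1 b2 in simp)+
  have "0 \<in> \<phi> ` {M - pi/2<..<m + pi/2}"
    by (rule connectedD_interval[OF con im(2) im(1) less_imp_le[OF b2(1)] less_imp_le[OF b1(1)]])
  then obtain \<beta> where b0: "0 = \<phi> \<beta>" and bI: "\<beta> \<in> {M - pi/2<..<m + pi/2}" by (rule imageE)
  have \<beta>: "\<phi> \<beta> = 0" "M - pi/2 < \<beta>" "\<beta> < m + pi/2" using b0 bI by simp_all
  show thesis
  proof
    show "\<bar>\<beta>\<bar> < pi/2" using \<beta> M0 m0 by auto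
    show "\<bar>w x - \<beta>\<bar> < pi/2" if "x \<in> B" for x
      using \<beta> M[OF that] m[OF that] unfolding abs_less_iff by linarith
    show "(\<Sum>x\<in>B. l x * sin (w x) / cos (w x - \<beta>)) = 0" using \<beta>(1) by (simp add: \<phi>_def)
  qed
qed

text \<open>Weak duality with the direction \<open>\<beta>\<close>. By
  \<open>ln y \<le> y - 1\<close>, every admissible \<open>t\<close> at the contracted angles obeys
  a bound containing minus the weighted sum of \<open>ln (cos (wc x - \<beta>))\<close>. By
  concavity of \<open>ln \<circ> cos\<close> this term is at most the one at the original angles,
  where the bound is attained by \<open>t'\<close>.\<close>

lemma contraction_aux:
  fixes l w t :: "'a \<Rightarrow> real" and \<rho> :: real
  assumes fin: "finite B" and l: "\<And>x. x \<in> B \<Longrightarrow> l x > 0"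
    and w: "\<And>x y. x \<in> B \<Longrightarrow> y \<in> B \<Longrightarrow> \<bar>w x - w y\<bar> < pi"
    and neg: "p \<in> B" "w p < 0" and pos: "q \<in> B" "w q > 0"
    and s: "0 \<le> s" "s \<le> 1" and \<mu>: "\<mu> = (\<Sum>x\<in>B. l x * w x) / (\<Sum>x\<in>B. l x)"
    and t: "\<And>x. x \<in> B \<Longrightarrow> t x > 0" and \<rho>: "\<rho> > 0"
    and sum: "(\<Sum>x\<in>B. t x * cis (\<mu> + (1 - s) * (w x - \<mu>))) = \<rho>"
  obtains t' where "\<And>x. x \<in> B \<Longrightarrow> t' x > 0" "(\<Sum>x\<in>B. t' x * cis (w x)) = \<rho>"
    "(\<Sum>x\<in>B. l x * ln (t x)) \<le> (\<Sum>x\<in>B. l x * ln (t' x))"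
proof -
  obtain \<beta> where \<beta>: "\<bar>\<beta>\<bar> < pi/2" "\<And>x. x \<in> B \<Longrightarrow> \<bar>w x - \<beta>\<bar> < pi/2"
    and crit: "(\<Sum>x\<in>B. l x * sin (w x) / cos (w x - \<beta>)) = 0"
    by (rule ex_dual_angle[OF fin l w neg pos]) blast+
  define \<sigma> where "\<sigma> = (\<Sum>x\<in>B. l x)"
  have \<sigma>: "\<sigma> > 0" unfolding \<sigma>_def using fin l neg by (intro sum_pos) auto
  define wc where "wc x = \<mu> + (1 - s) * (w x - \<mu>)" for x
  have c\<beta>: "cos \<beta> > 0" using \<beta>(1) unfolding abs_less_iff by (intro cos_gt_zero_pi) linarith+
  have cw: "cos (w x - \<beta>) > 0" if "x \<in> B" for x using \<beta>(2)[OF that] unfolding abs_less_iff by (intro cos_gt_zero_pi) linarith+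
  \<comment> \<open>Forced by taking components along \<open>cis \<beta>\<close>: the cosines in
    \<open>t'\<close> cancel, and \<open>K * \<sigma>\<close> has to equal
    \<open>\<rho> * cos \<beta>\<close>.\<close>
  define K where "K = \<rho> * cos \<beta> / \<sigma>"
  have K: "K > 0" using c\<beta> \<rho> \<sigma> by (simp add: K_def)
  define t' where "t' x = K * l x / cos (w x - \<beta>)" for x
  have t'pos: "t' x > 0" if "x \<in> B" for x using K l cw that by (simp add: t'_def)
  have sin0: "(\<Sum>x\<in>B. t' x * sin (w x)) = 0"
    using crit by (simp add: t'_def mult.assoc flip: sum_distrib_left times_divide_eq_right)
  have "(\<Sum>x\<in>B. t' x * cos (w x)) * cos \<beta> = (\<Sum>x\<in>B. t' x * cos (w x - \<beta>))"
    using sin0 by (simp add: cos_diff distrib_left sum.distrib sum_distrib_right mult.assoc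
        flip: sum_distrib_right mult.assoc)
  also have "\<dots> = (\<Sum>x\<in>B. K * l x)"
    using cw by (intro sum.cong refl) (simp add: t'_def less_imp_neq[symmetric])
  also have "\<dots> = \<rho> * cos \<beta>" using \<sigma> unfolding sum_distrib_left[symmetric] \<sigma>_def[symmetric] by (simp add: K_def)
  finally have cos\<rho>: "(\<Sum>x\<in>B. t' x * cos (w x)) = \<rho>" using c\<beta> by simp
  have sum': "(\<Sum>x\<in>B. t' x * cis (w x)) = \<rho>"
    using sin0 cos\<rho> by (simp add: complex_eq_iff)
  have mean: "(\<Sum>x\<in>B. l x * w x) = \<sigma> * \<mu>" using \<sigma> by (simp add: \<mu> \<sigma>_def)
  have I: "w x - \<beta> \<in> {-pi/2<..<pi/2}" if "x \<in> B" for x using \<beta>(2)[OF that] unfolding abs_less_iff greaterThanLessThan_iff by linarith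
  have conv: "convex {-pi/2<..<pi/2::real}" by simp
  have mean': "(\<Sum>x\<in>B. (l x / \<sigma>) *\<^sub>R (w x - \<beta>)) = \<mu> - \<beta>"
  proof -
    have "(\<Sum>x\<in>B. (l x / \<sigma>) *\<^sub>R (w x - \<beta>)) = ((\<Sum>x\<in>B. l x * w x) - (\<Sum>x\<in>B. l x) * \<beta>) / \<sigma>"
      unfolding sum_distrib_right sum_subtractf[symmetric] sum_divide_distrib
      by (intro sum.cong refl) (simp add: right_diff_distrib diff_divide_distrib)
    also have "\<dots> = \<mu> - \<beta>" unfolding mean \<sigma>_def[symmetric] using \<sigma> by (simp add: field_simps)
    finally show ?thesis .
  qed
  have sum1: "(\<Sum>x\<in>B. l x / \<sigma>) = 1" using \<sigma> by (simp add: \<sigma>_def flip: sum_divide_distrib)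
  have I\<mu>: "\<mu> - \<beta> \<in> {-pi/2<..<pi/2}"
    unfolding mean'[symmetric] using fin l \<sigma> I sum1
    by (intro convex_sum conv) (auto simp: less_imp_le)
  have jensen: "(\<Sum>x\<in>B. (l x / \<sigma>) * ln (cos (w x - \<beta>))) \<le> ln (cos (\<mu> - \<beta>))"
  proof -
    have cv: "convex_on {-pi/2<..<pi/2} (\<lambda>x. - ln (cos x))"
      using concave_ln_cos by (simp add: concave_on_def)
    have "- ln (cos (\<Sum>x\<in>B. (l x / \<sigma>) *\<^sub>R (w x - \<beta>))) \<le> (\<Sum>x\<in>B. (l x / \<sigma>) * - ln (cos (w x - \<beta>)))"
      using fin l \<sigma> I sum1 neg cv by (intro convex_on_sum) (auto simp: less_imp_le)
    then show ?thesis unfolding mean' by (simp add: sum_negf)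
  qed
  have wcI: "wc x - \<beta> \<in> {-pi/2<..<pi/2}"
    and wcconc: "ln (cos (wc x - \<beta>)) \<ge> (1 - s) * ln (cos (w x - \<beta>)) + s * ln (cos (\<mu> - \<beta>))" if "x \<in> B" for x
  proof -
    have e: "wc x - \<beta> = (1 - s) *\<^sub>R (w x - \<beta>) + s *\<^sub>R (\<mu> - \<beta>)" by (simp add: wc_def algebra_simps)
    show "wc x - \<beta> \<in> {-pi/2<..<pi/2}" unfolding e using I[OF that] I\<mu> s by (intro convexD conv) auto
    show "ln (cos (wc x - \<beta>)) \<ge> (1 - s) * ln (cos (w x - \<beta>)) + s * ln (cos (\<mu> - \<beta>))"
      unfolding e using I[OF that] I\<mu> s concave_ln_cos by (intro concave_onD) auto
  qed
  have cwc: "cos (wc x - \<beta>) > 0" if "x \<in> B" for x using wcI[OF that] by (intro cos_gt_zero_pi) auto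
  \<comment> \<open>Jensen bounds the weighted mean of \<open>ln (cos (w x - \<beta>))\<close> by
    its value at \<open>\<mu>\<close>, and the contracted angles interpolate between
    \<open>w x\<close> and \<open>\<mu>\<close>.\<close>
  have step1: "(\<Sum>x\<in>B. l x * ln (cos (w x - \<beta>))) \<le> (\<Sum>x\<in>B. l x * ln (cos (wc x - \<beta>)))"
  proof -
    let ?S = "\<Sum>x\<in>B. l x * ln (cos (w x - \<beta>))"
    have j: "?S \<le> \<sigma> * ln (cos (\<mu> - \<beta>))"
    proof -
      have "?S = \<sigma> * (\<Sum>x\<in>B. (l x / \<sigma>) * ln (cos (w x - \<beta>)))"
        using \<sigma> by (simp add: sum_distrib_left)
      then show ?thesis using jensen \<sigma> by simp
    qed
    have "?S = (1 - s) * ?S + s * ?S" by (simp add: algebra_simps)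
    also have "\<dots> \<le> (1 - s) * ?S + s * (\<sigma> * ln (cos (\<mu> - \<beta>)))"
      using j s by (intro add_left_mono mult_left_mono) auto
    also have "\<dots> = (\<Sum>x\<in>B. l x * ((1 - s) * ln (cos (w x - \<beta>)) + s * ln (cos (\<mu> - \<beta>))))"
      by (simp add: \<sigma>_def sum_distrib_left sum_distrib_right sum.distrib distrib_left mult_ac)
    also have "\<dots> \<le> (\<Sum>x\<in>B. l x * ln (cos (wc x - \<beta>)))"
      using wcconc l by (intro sum_mono mult_left_mono) (auto simp: less_imp_le)
    finally show ?thesis .
  qed
  have "(\<Sum>x\<in>B. t x * cos (wc x - \<beta>)) = \<rho> * cos \<beta>"
  proof -
    have "(\<Sum>x\<in>B. t x * cos (wc x)) = \<rho>" "(\<Sum>x\<in>B. t x * sin (wc x)) = 0"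
      using sum by (simp_all add: complex_eq_iff wc_def)
    then show ?thesis
      by (simp add: cos_diff distrib_left sum.distrib flip: sum_distrib_right mult.assoc)
  qed
  \<comment> \<open>The numbers to which \<open>ln y \<le> y - 1\<close> is applied have
    \<open>l\<close>-weighted mean 1, so the upper bounds add up to 0.\<close>
  then have ysum: "(\<Sum>x\<in>B. l x * (t x * cos (wc x - \<beta>) / (l x * K))) = \<sigma>"
  proof -
    have "(\<Sum>x\<in>B. l x * (t x * cos (wc x - \<beta>) / (l x * K))) = (\<Sum>x\<in>B. t x * cos (wc x - \<beta>) / K)"
      using l by (intro sum.cong refl) (force simp: field_simps)
    also have "\<dots> = \<rho> * cos \<beta> / K"
      using \<open>(\<Sum>x\<in>B. t x * cos (wc x - \<beta>)) = \<rho> * cos \<beta>\<close> by (simp flip: sum_divide_distrib)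
    finally show ?thesis using c\<beta> \<rho> \<sigma> by (simp add: K_def)
  qed
  have "(\<Sum>x\<in>B. l x * ln (t x)) - (\<Sum>x\<in>B. l x * ln (t' x))
      = (\<Sum>x\<in>B. l x * ln (t x * cos (wc x - \<beta>) / (l x * K)))
        - (\<Sum>x\<in>B. l x * ln (cos (wc x - \<beta>))) + (\<Sum>x\<in>B. l x * ln (cos (w x - \<beta>)))"
    unfolding sum_subtractf[symmetric] sum.distrib[symmetric]
  proof (intro sum.cong refl)
    fix x assume x: "x \<in> B"
    show "l x * ln (t x) - l x * ln (t' x) = l x * ln (t x * cos (wc x - \<beta>) / (l x * K))
        - l x * ln (cos (wc x - \<beta>)) + l x * ln (cos (w x - \<beta>))"
      using l[OF x] t[OF x] cw[OF x] cwc[OF x] K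
      by (simp add: t'_def ln_mult ln_div algebra_simps)
  qed
  also have "(\<Sum>x\<in>B. l x * ln (t x * cos (wc x - \<beta>) / (l x * K)))
      \<le> (\<Sum>x\<in>B. l x * (t x * cos (wc x - \<beta>) / (l x * K) - 1))"
    using l t cwc K by (intro sum_mono mult_left_mono ln_le_minus_one) (auto simp: less_imp_le)
  also have "\<dots> = 0" using ysum by (simp add: right_diff_distrib sum_subtractf \<sigma>_def)
  finally have "(\<Sum>x\<in>B. l x * ln (t x)) \<le> (\<Sum>x\<in>B. l x * ln (t' x))" using step1 by simp
  with t'pos sum' show thesis by (rule that)
qed

text \<open>Reduces to a positive real right-hand side by rotating through the argument
  \<open>z\<close> of the prescribed sum. Then the imaginary parts cancel, so the rotated angles
  take both signs unless they are all 0, in which case the contraction changes nothing.\<close>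

lemma contraction:
  fixes l w t \<tau> :: "'a \<Rightarrow> real"
  assumes fin: "finite B" and l: "\<And>x. x \<in> B \<Longrightarrow> l x > 0"
    and w: "\<And>x y. x \<in> B \<Longrightarrow> y \<in> B \<Longrightarrow> \<bar>w x - w y\<bar> < pi"
    and s: "0 \<le> s" "s \<le> 1" and \<mu>: "\<mu> = (\<Sum>x\<in>B. l x * w x) / (\<Sum>x\<in>B. l x)"
    and t: "\<And>x. x \<in> B \<Longrightarrow> t x > 0" and \<tau>: "\<And>x. x \<in> B \<Longrightarrow> \<tau> x > 0"
    and sum: "(\<Sum>x\<in>B. t x * cis (\<mu> + (1 - s) * (w x - \<mu>))) = (\<Sum>x\<in>B. \<tau> x * cis (w x))"
  obtains t' where "\<And>x. x \<in> B \<Longrightarrow> t' x > 0" "(\<Sum>x\<in>B. t' x * cis (w x)) = (\<Sum>x\<in>B. \<tau> x * cis (w x))"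
    "(\<Sum>x\<in>B. l x * ln (t x)) \<le> (\<Sum>x\<in>B. l x * ln (t' x))"
proof (cases "B = {}")
  case True
  then show ?thesis using that by auto
next
  case False
  define M where "M = Max (w ` B)"
  define m where "m = Min (w ` B)"
  have M: "w x \<le> M" and m: "m \<le> w x" if "x \<in> B" for x
    using that fin by (auto simp: M_def m_def)
  have "M \<in> w ` B" "m \<in> w ` B" using fin False by (auto simp: M_def m_def)
  then have Mm: "M - m < pi" using w by fastforce
  define c where "c = (M + m) / 2"
  have wc: "\<bar>w x - c\<bar> < pi/2" if "x \<in> B" for x
    using M[OF that] m[OF that] Mm by (auto simp: c_def field_simps)
  \<comment> \<open>A first rotation by the midpoint \<open>c\<close> puts all directions into the
    right half-plane. This selects the branch of the argument that keeps every
    \<open>w x - z\<close> between \<open>-pi\<close> and \<open>pi\<close>.\<close>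
  define Y where "Y = (\<Sum>x\<in>B. \<tau> x * cis (w x - c))"
  have "\<tau> x * cos (w x - c) > 0" if "x \<in> B" for x
    using \<tau>[OF that] wc[OF that] unfolding abs_less_iff by (intro mult_pos_pos cos_gt_zero_pi) linarith+
  then have "Re Y > 0" unfolding Y_def Re_sum using fin False
    by (intro sum_pos) auto
  then have Y0: "Y \<noteq> 0" and arg: "\<bar>Arg Y\<bar> < pi/2"
    using Arg_Re_pos[of Y] by auto
  define z where "z = c + Arg Y"
  have Yz: "(\<Sum>x\<in>B. \<tau> x * cis (w x - z)) = cmod Y"
  proof -
    have "(\<Sum>x\<in>B. \<tau> x * cis (w x - z)) = Y * cis (- Arg Y)"
      unfolding Y_def z_def sum_distrib_right by (intro sum.cong refl) (simp add: cis_mult algebra_simps)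
    also have "\<dots> = cmod Y * (cis (Arg Y) * cis (- Arg Y))"
      by (subst (1) rcis_cmod_Arg[of Y, symmetric]) (simp add: rcis_def)
    finally show ?thesis by (simp add: cis_mult)
  qed
  have rot: "(\<Sum>x\<in>B. f x * cis (g x - z)) = cis (-z) * (\<Sum>x\<in>B. of_real (f x) * cis (g x))" for f g :: "'a \<Rightarrow> real"
    unfolding sum_distrib_left by (intro sum.cong refl) (simp add: cis_mult algebra_simps)
  have wz: "\<bar>w x - z\<bar> < pi" if "x \<in> B" for x
    using wc[OF that] arg unfolding z_def abs_less_iff by linarith
  define v where "v x = w x - z" for x
  have \<sigma>: "sum l B > 0" using fin False l by (intro sum_pos) auto
  have \<mu>v: "\<mu> - z = (\<Sum>x\<in>B. l x * v x) / (\<Sum>x\<in>B. l x)"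
    using \<sigma> by (simp add: \<mu> v_def right_diff_distrib sum_subtractf diff_divide_distrib flip: sum_distrib_right)
  have tz: "(\<Sum>x\<in>B. t x * cis ((\<mu> - z) + (1 - s) * (v x - (\<mu> - z)))) = cmod Y"
  proof -
    have "(\<Sum>x\<in>B. t x * cis ((\<mu> - z) + (1 - s) * (v x - (\<mu> - z)))) =
        (\<Sum>x\<in>B. t x * cis ((\<mu> + (1 - s) * (w x - \<mu>)) - z))"
      by (intro sum.cong refl) (simp add: v_def algebra_simps)
    also have "\<dots> = (\<Sum>x\<in>B. \<tau> x * cis (w x - z))" unfolding rot sum ..
    finally show ?thesis using Yz by simp
  qed
  show ?thesis
  proof (cases "\<forall>x\<in>B. v x = 0")
    case True
    then have "\<mu> = z" using \<mu>v by simp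
    then have "(\<Sum>x\<in>B. t x * cis (w x)) = (\<Sum>x\<in>B. \<tau> x * cis (w x))"
      unfolding sum[symmetric] using True by (intro sum.cong refl) (simp add: v_def)
    with t show ?thesis by (intro that[of t]) auto
  next
    case False
    have zero: "(\<Sum>x\<in>B. \<tau> x * sin (v x)) = 0"
      using Yz by (simp add: complex_eq_iff v_def)
    have "\<exists>p\<in>B. v p < 0"
    proof (rule ccontr)
      assume "\<not> (\<exists>p\<in>B. v p < 0)"
      then have "\<tau> x * sin (v x) \<ge> 0" if "x \<in> B" for x
        using wz[OF that] \<tau>[OF that] that by (intro mult_nonneg_nonneg sin_ge_zero) (auto simp: v_def not_less)
      then have "\<forall>x\<in>B. \<tau> x * sin (v x) = 0" using zero fin by (simp add: sum_nonneg_eq_0_iff)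
      then have "sin (v x) = 0" if "x \<in> B" for x using \<tau>[OF that] that by auto
      then have "v x = 0" if "x \<in> B" for x using wz[OF that] that sin_eq_0_pi[of "v x"] by (auto simp: v_def)
      then show False using False by auto
    qed
    then obtain p where p: "p \<in> B" "v p < 0" by auto
    have "\<exists>q\<in>B. v q > 0"
    proof (rule ccontr)
      assume "\<not> (\<exists>q\<in>B. v q > 0)"
      then have "\<tau> x * sin (- v x) \<ge> 0" if "x \<in> B" for x
        using wz[OF that] \<tau>[OF that] that by (intro mult_nonneg_nonneg sin_ge_zero) (auto simp: v_def not_less)
      moreover have "(\<Sum>x\<in>B. \<tau> x * sin (- v x)) = 0" using zero by (simp add: sum_negf)
      ultimately have "\<forall>x\<in>B. \<tau> x * sin (- v x) = 0" using fin by (subst (asm) sum_nonneg_eq_0_iff) auto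
      then have "sin (v x) = 0" if "x \<in> B" for x using \<tau>[OF that] that by auto
      then have "v x = 0" if "x \<in> B" for x using wz[OF that] that sin_eq_0_pi[of "v x"] by (auto simp: v_def)
      then show False using False by auto
    qed
    then obtain q where q: "q \<in> B" "v q > 0" by auto
    have wv: "\<bar>v x - v y\<bar> < pi" if "x \<in> B" "y \<in> B" for x y using w[OF that] by (simp add: v_def)
    obtain t' where t': "\<And>x. x \<in> B \<Longrightarrow> t' x > 0" "(\<Sum>x\<in>B. t' x * cis (v x)) = cmod Y"
      "(\<Sum>x\<in>B. l x * ln (t x)) \<le> (\<Sum>x\<in>B. l x * ln (t' x))"
      using contraction_aux[OF fin l wv p q s \<mu>v t _ tz] Y0 by auto
    have "cis (-z) * (\<Sum>x\<in>B. t' x * cis (w x)) = cis (-z) * (\<Sum>x\<in>B. \<tau> x * cis (w x))"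
      using t'(2) Yz unfolding v_def rot by simp
    then have "(\<Sum>x\<in>B. t' x * cis (w x)) = (\<Sum>x\<in>B. \<tau> x * cis (w x))" by simp
    with t' show ?thesis by (intro that[of t']) auto
  qed
qed

section \<open>Phases on the universal cover\<close>

text \<open>Take the lift of \<open>\<phi> + w x\<close> nearest to 0; its positive cosine puts it
  within \<open>pi / 2\<close> of 0.\<close>

lemma lifts_of_half_plane:
  fixes w :: "'a \<Rightarrow> real"
  assumes "\<And>x. x \<in> B \<Longrightarrow> cos (\<phi> + w x) > 0"
  obtains m :: "'a \<Rightarrow> int" where
    "\<And>x y. x \<in> B \<Longrightarrow> y \<in> B \<Longrightarrow> \<bar>w x + 2 * pi * m x - (w y + 2 * pi * m y)\<bar> < pi"
proof -
  define m where "m x = - round ((\<phi> + w x) / (2 * pi))" for x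
  have *: "\<bar>\<phi> + w x + 2 * pi * m x\<bar> < pi / 2" if "x \<in> B" for x
  proof (rule ccontr)
    assume "\<not> ?thesis"
    moreover define y where "y = \<phi> + w x + 2 * pi * m x"
    moreover have "\<bar>y\<bar> \<le> pi"
    proof -
      have "\<bar>of_int (round ((\<phi> + w x) / (2 * pi))) - (\<phi> + w x) / (2 * pi)\<bar> \<le> 1/2"
        by (rule of_int_round_abs_le)
      then have "\<bar>of_int (round ((\<phi> + w x) / (2 * pi))) - (\<phi> + w x) / (2 * pi)\<bar> * (2 * pi) \<le> 1/2 * (2 * pi)"
        by (intro mult_right_mono) auto
      then have "\<bar>(of_int (round ((\<phi> + w x) / (2 * pi))) - (\<phi> + w x) / (2 * pi)) * (2 * pi)\<bar> \<le> pi"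
        by (simp add: abs_mult)
      moreover have "(of_int (round ((\<phi> + w x) / (2 * pi))) - (\<phi> + w x) / (2 * pi)) * (2 * pi) = - y"
        by (simp add: y_def m_def left_diff_distrib)
      ultimately show ?thesis by simp
    qed
    ultimately have "cos \<bar>y\<bar> \<le> cos (pi/2)" by (intro cos_monotone_0_pi_le) auto
    moreover have "cos y = cos (\<phi> + w x)"
      using cos.periodic_simps(3)[of "\<phi> + w x"] unfolding y_def
      by (simp add: cos_add sin_add mult.commute[of "2*pi"] flip: mult.assoc)
    ultimately show False using assms[OF that] by simp
  qed
  show thesis
  proof
    fix x y assume "x \<in> B" "y \<in> B"
    with *[of x] *[of y] show "\<bar>w x + 2 * pi * m x - (w y + 2 * pi * m y)\<bar> < pi" by linarith
  qed
qed

text \<open>Either 0 is a convex combination of the directions, or a vector strictly separating 0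
  from their convex hull gives the half-plane.\<close>

lemma half_plane_or_positive_combination:
  fixes w :: "'a \<Rightarrow> real"
  assumes "finite B"
  obtains \<phi> where "\<And>x. x \<in> B \<Longrightarrow> cos (\<phi> + w x) > 0"
  | t where "\<And>x. x \<in> B \<Longrightarrow> t x \<ge> (0::real)" "\<exists>x\<in>B. t x > 0" "(\<Sum>x\<in>B. t x * cis (w x)) = 0"
proof (cases "0 \<in> convex hull (\<Union>x\<in>B. {cis (w x)})")
  case True
  have "convex hull (\<Union>x\<in>B. {cis (w x)}) =
      {\<Sum>i\<in>B. c i *\<^sub>R s i | c s. (\<forall>i\<in>B. c i \<ge> 0) \<and> sum c B = 1 \<and> (\<forall>i\<in>B. s i \<in> {cis (w i)})}"
    using assms by (intro convex_hull_finite_union) auto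
  then obtain c s where c: "\<forall>i\<in>B. c i \<ge> 0" "sum c B = 1" "\<forall>i\<in>B. s i = cis (w i)" "(\<Sum>i\<in>B. c i *\<^sub>R s i) = 0"
    using True by auto
  have "\<exists>x\<in>B. c x > 0"
  proof (rule ccontr)
    assume "\<not> ?thesis"
    then have "sum c B = 0" using c(1) by (intro sum.neutral) force
    then show False using c(2) by simp
  qed
  moreover have "(\<Sum>x\<in>B. c x * cis (w x)) = (\<Sum>i\<in>B. c i *\<^sub>R s i)"
    using c(3) by (intro sum.cong refl) (simp add: scaleR_conv_of_real)
  ultimately show ?thesis using c by (intro that(2)[of c]) auto
next
  case False
  have "compact (convex hull (\<Union>x\<in>B. {cis (w x)}))"
    using assms by (intro finite_imp_compact_convex_hull) auto
  then obtain p d where pd: "p \<noteq> 0" "0 < d" "\<forall>x\<in>convex hull (\<Union>x\<in>B. {cis (w x)}). inner p x > d"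
    using separating_hyperplane_closed_0[of "convex hull (\<Union>x\<in>B. {cis (w x)})"] False
    by (auto simp: compact_imp_closed)
  show ?thesis
  proof (rule that(1)[of "- Arg p"])
    fix x assume "x \<in> B"
    then have "cis (w x) \<in> convex hull (\<Union>x\<in>B. {cis (w x)})" by (intro hull_inc) auto
    then have "inner p (cis (w x)) > 0" using pd by fastforce
    moreover have "inner p (cis (w x)) = cmod p * cos (- Arg p + w x)"
      by (subst (1) rcis_cmod_Arg[of p, symmetric])
         (simp add: inner_complex_def rcis_def cos_diff algebra_simps)
    ultimately show "cos (- Arg p + w x) > 0" using pd(1) by (simp add: zero_less_mult_iff)
  qed
qed

lemma half_plane_no_combination:
  fixes w t :: "'a \<Rightarrow> real"
  assumes "finite B" "\<And>x. x \<in> B \<Longrightarrow> cos (\<phi> + w x) > 0" "\<And>x. x \<in> B \<Longrightarrow> t x \<ge> 0"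
    "k \<in> B" "t k > 0"
  shows "(\<Sum>x\<in>B. t x * cis (w x)) \<noteq> 0"
proof
  assume 0: "(\<Sum>x\<in>B. t x * cis (w x)) = 0"
  have "(\<Sum>x\<in>B. t x * cos (\<phi> + w x)) = Re (cis \<phi> * (\<Sum>x\<in>B. t x * cis (w x)))"
    unfolding sum_distrib_left Re_sum
    by (intro sum.cong refl) (simp add: cos_add algebra_simps)
  also have "\<dots> = 0" using 0 by simp
  finally have "(\<Sum>x\<in>B. t x * cos (\<phi> + w x)) = 0" .
  moreover have "(\<Sum>x\<in>B. t x * cos (\<phi> + w x)) > 0"
    using assms by (intro sum_pos2[of _ k]) (auto intro!: mult_nonneg_nonneg mult_pos_pos less_imp_le[OF assms(2)])
  ultimately show False by simp
qed

lemma cis_shift_int [simp]: "cis (x + 2 * pi * of_int k) = cis x"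
  by (simp add: complex_eq_iff cos_add sin_add)

text \<open>\<open>a\<close> and \<open>\<gamma>\<close> stand for the arguments of the coefficients
  and for the \<open>l\<close>-weighted sum of the logarithms of their moduli. By
  \<open>dual\<close>, data on \<open>A\<close> annihilated by \<open>l\<close> are the values of an
  affine function whose slope depends linearly on the data through \<open>b\<close>; this linearity
  bounds the displacement in \<open>perturb_zeros\<close>.\<close>

locale phased_circuit =
  fixes A :: "(int ^ 'n::finite) set" and l :: "int ^ 'n \<Rightarrow> int" and b :: "int ^ 'n \<Rightarrow> real ^ 'n"
    and a :: "int ^ 'n \<Rightarrow> real" and \<gamma> :: real
  assumes fin: "finite A" and card_A: "card A = CARD('n) + 2"
    and l_nonzero: "\<And>\<alpha>. \<alpha> \<in> A \<Longrightarrow> l \<alpha> \<noteq> 0"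
    and sum_l: "(\<Sum>\<alpha>\<in>A. l \<alpha>) = 0"
    and sum_l_coord: "\<And>k. (\<Sum>\<alpha>\<in>A. l \<alpha> * \<alpha> $ k) = 0"
    and dual: "\<And>\<delta> :: int ^ 'n \<Rightarrow> real. (\<Sum>\<alpha>\<in>A. l \<alpha> * \<delta> \<alpha>) = 0 \<Longrightarrow>
      \<exists>s. \<forall>\<alpha>\<in>A. \<delta> \<alpha> = vreal \<alpha> \<bullet> (\<Sum>\<beta>\<in>A. \<delta> \<beta> *\<^sub>R b \<beta>) + s"
    and generic: "sin (\<Sum>\<alpha>\<in>A. l \<alpha> * a \<alpha>) \<noteq> 0"
begin

definition u :: "real ^ 'n \<Rightarrow> int ^ 'n \<Rightarrow> real" where
  "u x \<alpha> = a \<alpha> + vreal \<alpha> \<bullet> x"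

definition Sol :: "real ^ 'n \<Rightarrow> (int ^ 'n \<Rightarrow> real) set" where
  "Sol x = {t. (\<forall>\<alpha>\<in>A. t \<alpha> > 0) \<and> (\<Sum>\<alpha>\<in>A. t \<alpha> * cis (u x \<alpha>)) = 0}"

text \<open>Positive weights are, up to a common factor, the moduli of the terms of the polynomial
  at some point iff their logarithms minus those of the coefficient moduli form an affine function
  on \<open>A\<close>. As \<open>l\<close> spans the affine relations, this is the single equation
  \<open>h t = \<gamma>\<close>.\<close>

definition h :: "(int ^ 'n \<Rightarrow> real) \<Rightarrow> real" where
  "h t = (\<Sum>\<alpha>\<in>A. l \<alpha> * ln (t \<alpha>))"

definition Coam :: "(real ^ 'n) set" where
  "Coam = {x. \<exists>t\<in>Sol x. h t = \<gamma>}"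

text \<open>\<open>Th\<close> and \<open>Om\<close> will be the preimages in \<open>\<real>\<^sup>n\<close> of the complements of the closed lopsided
  coamoeba and of the closed coamoeba.\<close>

definition P :: "(int ^ 'n \<Rightarrow> int) \<Rightarrow> (real ^ 'n) set" where
  "P m = {x. \<forall>\<alpha>\<in>A. \<forall>\<beta>\<in>A. \<bar>u x \<alpha> + 2 * pi * m \<alpha> - (u x \<beta> + 2 * pi * m \<beta>)\<bar> < pi}"

definition Th :: "(real ^ 'n) set" where
  "Th = (\<Union>m. P m)"

definition Om :: "(real ^ 'n) set" where
  "Om = - closure Coam"

lemma sum_l_inner: "(\<Sum>\<alpha>\<in>A. l \<alpha> * (vreal \<alpha> \<bullet> x)) = 0"
proof -
  have "(\<Sum>\<alpha>\<in>A. l \<alpha> * (vreal \<alpha> \<bullet> x)) = (\<Sum>\<alpha>\<in>A. \<Sum>k\<in>UNIV. real_of_int (l \<alpha> * \<alpha> $ k) * x $ k)"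
    by (simp add: inner_vec_def vreal_def sum_distrib_left mult.assoc)
  also have "\<dots> = (\<Sum>k\<in>UNIV. real_of_int (\<Sum>\<alpha>\<in>A. l \<alpha> * \<alpha> $ k) * x $ k)"
    by (subst sum.swap) (simp add: sum_distrib_right)
  finally show ?thesis by (simp add: sum_l_coord)
qed

lemma sum_l_real: "(\<Sum>\<alpha>\<in>A. real_of_int (l \<alpha>)) = 0"
  using sum_l by (simp flip: of_int_sum)

lemma sum_l_u: "(\<Sum>\<alpha>\<in>A. l \<alpha> * u x \<alpha>) = (\<Sum>\<alpha>\<in>A. l \<alpha> * a \<alpha>)"
  by (simp add: u_def distrib_left sum.distrib sum_l_inner)

lemma continuous_u [continuous_intros]: "continuous_on S (\<lambda>x. u x \<alpha>)"
  unfolding u_def by (intro continuous_intros)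

text \<open>The weights outside \<open>k\<close> and \<open>m\<close> are prescribed by
  \<open>s\<close>, and up to a common rotation only the phases of \<open>k\<close> and
  \<open>m\<close> move. If \<open>z\<close> is the term of index \<open>m\<close>, vanishing of the
  sum determines the term of index \<open>k\<close>, hence its modulus and its rotation
  \<open>\<delta>\<close>; these in turn determine the term of index \<open>m\<close> through
  \<open>R\<close> and the relation \<open>l\<close>. Brouwer's theorem closes the loop.\<close>

lemma perturb_zeros:
  fixes t0 :: "int ^ 'n \<Rightarrow> real"
  assumes t0: "\<And>\<alpha>. \<alpha> \<in> A \<Longrightarrow> t0 \<alpha> \<ge> 0" "(\<Sum>\<alpha>\<in>A. t0 \<alpha> * cis (u x \<alpha>)) = 0"
    and k: "k \<in> A" "t0 k > 0" and m: "m \<in> A" "t0 m = 0" and e: "e > 0"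
  obtains \<rho> where "\<rho> > 0"
    "\<And>(s :: int ^ 'n \<Rightarrow> real) R. (\<And>\<alpha>. \<alpha> \<in> A - {k, m} \<Longrightarrow> s \<alpha> > 0) \<Longrightarrow>
      cmod (\<Sum>\<alpha>\<in>A - {k, m}. (s \<alpha> - t0 \<alpha>) * cis (u x \<alpha>)) \<le> \<rho> \<Longrightarrow>
      continuous_on {t0 k / 2..2 * t0 k} R \<Longrightarrow>
      (\<And>r. r \<in> {t0 k / 2..2 * t0 k} \<Longrightarrow> 0 < R r \<and> R r \<le> \<rho>) \<Longrightarrow>
      \<exists>x' t. dist x' x < e \<and> t \<in> Sol x' \<and> (\<forall>\<alpha>\<in>A - {k, m}. t \<alpha> = s \<alpha>) \<and>
        t k \<in> {t0 k / 2..2 * t0 k} \<and> t m = R (t k)"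
proof -
  have km: "k \<noteq> m" using k m by auto
  define p where "p = t0 k"
  have p: "p > 0" using k by (simp add: p_def)
  \<comment> \<open>Rotating \<open>k\<close> by \<open>\<delta>\<close> forces a rotation of
    \<open>m\<close> by \<open>- q * \<delta>\<close> to stay in the kernel of \<open>l\<close>; the
    corresponding displacement of \<open>x\<close> is \<open>\<delta> *\<^sub>R V\<close>.\<close>
  define q where "q = real_of_int (l k) / real_of_int (l m)"
  have lq: "l k = q * l m" using l_nonzero[OF m(1)] by (simp add: q_def)
  define V where "V = b k - q *\<^sub>R b m"
  have "continuous (at (complex_of_real p)) Arg"
    using p by (intro continuous_at_Arg) (auto simp: complex_nonpos_Reals_iff)
  moreover have "e / (norm V + 1) > 0" using e by (intro divide_pos_pos) (auto intro: add_nonneg_pos)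
  ultimately obtain \<eta> where \<eta>: "\<eta> > 0"
    "\<And>z. dist z (complex_of_real p) < \<eta> \<Longrightarrow> dist (Arg z) (Arg (complex_of_real p)) < e / (norm V + 1)"
    unfolding continuous_at_eps_delta by blast
  \<comment> \<open>Two errors of size at most \<open>\<rho>\<close> occur, so
    \<open>\<zeta> z\<close> stays within \<open>2 * \<rho>\<close> of \<open>p\<close>: off the cut
    of \<open>Arg\<close>, of modulus between \<open>p / 2\<close> and \<open>2 * p\<close>, and of
    small argument.\<close>
  define \<rho> where "\<rho> = min (\<eta> / 4) (p / 4)"
  have \<rho>: "\<rho> > 0" "\<rho> \<le> p / 4" "\<rho> \<le> \<eta> / 4" using \<eta> p by (auto simp: \<rho>_def)
  show thesis
  proof (rule that[OF \<rho>(1)])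
    fix s :: "int ^ 'n \<Rightarrow> real" and R :: "real \<Rightarrow> real"
    assume s: "\<And>\<alpha>. \<alpha> \<in> A - {k, m} \<Longrightarrow> s \<alpha> > 0"
      and E: "cmod (\<Sum>\<alpha>\<in>A - {k, m}. (s \<alpha> - t0 \<alpha>) * cis (u x \<alpha>)) \<le> \<rho>"
      and R: "continuous_on {t0 k / 2..2 * t0 k} R"
      and R\<rho>: "\<And>r. r \<in> {t0 k / 2..2 * t0 k} \<Longrightarrow> 0 < R r \<and> R r \<le> \<rho>"
    define E0 where "E0 = (\<Sum>\<alpha>\<in>A - {k, m}. (s \<alpha> - t0 \<alpha>) * cis (u x \<alpha>))"
    have E0: "cmod E0 \<le> \<rho>" using E by (simp add: E0_def)
    \<comment> \<open>The \<open>k\<close>-th term that makes the sum vanish, divided by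
      \<open>cis (u x k)\<close>; without perturbation it is \<open>p\<close>.\<close>
    define \<zeta> where "\<zeta> z = p - (E0 + z) * cis (- u x k)" for z
    define F where "F z = R (cmod (\<zeta> z)) * cis (u x m - q * Arg (\<zeta> z))" for z
    have \<zeta>p: "cmod (\<zeta> z - p) \<le> 2 * \<rho>" if "z \<in> cball 0 \<rho>" for z
      using norm_triangle_ineq[of E0 z] E0 that by (simp add: \<zeta>_def norm_mult)
    have \<zeta>r: "cmod (\<zeta> z) \<in> {p / 2..2 * p}" if "z \<in> cball 0 \<rho>" for z
      using \<zeta>p[OF that] norm_triangle_ineq2[of "complex_of_real p" "\<zeta> z"]
        norm_triangle_ineq2[of "\<zeta> z" "complex_of_real p"] p \<rho>
      by (simp add: norm_minus_commute)
    have \<zeta>R: "\<zeta> z \<notin> \<real>\<^sub>\<le>\<^sub>0" if "z \<in> cball 0 \<rho>" for z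
    proof -
      have "\<bar>Re (\<zeta> z - p)\<bar> \<le> 2 * \<rho>" using \<zeta>p[OF that] abs_Re_le_cmod order_trans by blast
      then have "Re (\<zeta> z) > 0" using p \<rho> by auto
      then show ?thesis by (auto simp: complex_nonpos_Reals_iff)
    qed
    have cont\<zeta>: "continuous_on (cball 0 \<rho>) \<zeta>" unfolding \<zeta>_def by (intro continuous_intros)
    have "continuous_on (cball 0 \<rho>) (\<lambda>z. R (cmod (\<zeta> z)))"
      by (rule continuous_on_compose2[OF R])
         (use \<zeta>r in \<open>auto intro!: continuous_intros cont\<zeta> simp: p_def\<close>)
    then have "continuous_on (cball 0 \<rho>) F"
      unfolding F_def using \<zeta>R by (intro continuous_intros cont\<zeta>) auto
    moreover have "F \<in> cball 0 \<rho> \<rightarrow> cball 0 \<rho>"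
    proof
      fix z :: complex assume "z \<in> cball 0 \<rho>"
      then show "F z \<in> cball 0 \<rho>" using R\<rho>[of "cmod (\<zeta> z)"] \<zeta>r[of z] by (simp add: F_def norm_mult p_def)
    qed
    ultimately obtain z where z: "z \<in> cball 0 \<rho>" "F z = z"
      using brouwer[of "cball 0 \<rho>" F] \<rho> by auto
    define \<delta> where "\<delta> = Arg (\<zeta> z)"
    define r where "r = cmod (\<zeta> z)"
    have r: "r \<in> {p / 2..2 * p}" using \<zeta>r[OF z(1)] by (simp add: r_def)
    define t where "t \<alpha> = (if \<alpha> = k then r else if \<alpha> = m then R r else s \<alpha>)" for \<alpha>
    define D where "D \<alpha> = (if \<alpha> = k then \<delta> else if \<alpha> = m then - q * \<delta> else 0)" for \<alpha>
    have sumD: "(\<Sum>\<alpha>\<in>A. f \<alpha> (D \<alpha>)) = f k \<delta> + f m (- q * \<delta>)"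
      if "\<And>\<alpha>. f \<alpha> 0 = 0" for f :: "int ^ 'n \<Rightarrow> real \<Rightarrow> 'z::comm_monoid_add"
    proof -
      have "(\<Sum>\<alpha>\<in>A. f \<alpha> (D \<alpha>)) = (\<Sum>\<alpha>\<in>{k, m}. f \<alpha> (D \<alpha>))"
        using fin k m that by (intro sum.mono_neutral_right) (auto simp: D_def)
      then show ?thesis using km by (simp add: D_def)
    qed
    have "(\<Sum>\<alpha>\<in>A. l \<alpha> * D \<alpha>) = 0"
      by (subst sumD[of "\<lambda>\<alpha> d. l \<alpha> * d"]) (simp_all add: lq)
    from dual[OF this] obtain s0 where s0: "\<forall>\<alpha>\<in>A. D \<alpha> = vreal \<alpha> \<bullet> (\<Sum>\<beta>\<in>A. D \<beta> *\<^sub>R b \<beta>) + s0" by auto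
    have "(\<Sum>\<beta>\<in>A. D \<beta> *\<^sub>R b \<beta>) = \<delta> *\<^sub>R V"
      by (subst sumD[of "\<lambda>\<beta> d. d *\<^sub>R b \<beta>"]) (simp_all add: V_def algebra_simps)
    then have D: "D \<alpha> = vreal \<alpha> \<bullet> (\<delta> *\<^sub>R V) + s0" if "\<alpha> \<in> A" for \<alpha> using s0 that by simp
    define x' where "x' = x + \<delta> *\<^sub>R V"
    have ux': "u x' \<alpha> = u x \<alpha> + D \<alpha> - s0" if "\<alpha> \<in> A" for \<alpha>
      using D[OF that] by (simp add: u_def x'_def inner_add_right)
    have \<delta>e: "\<bar>\<delta>\<bar> < e / (norm V + 1)"
    proof -
      have "dist (\<zeta> z) (complex_of_real p) < \<eta>" using \<zeta>p[OF z(1)] \<rho> \<eta>(1) by (simp add: dist_norm)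
      from \<eta>(2)[OF this] show ?thesis using p by (simp add: \<delta>_def dist_real_def)
    qed
    have "dist x' x < e"
    proof -
      have "dist x' x = \<bar>\<delta>\<bar> * norm V" by (simp add: x'_def dist_norm)
      also have "\<dots> \<le> \<bar>\<delta>\<bar> * (norm V + 1)" by (intro mult_left_mono) auto
      also have "\<dots> < e" using \<delta>e by (subst (asm) pos_less_divide_eq) (auto intro: add_nonneg_pos)
      finally show ?thesis .
    qed
    moreover have "t \<in> Sol x'"
      unfolding Sol_def
    proof (intro CollectI conjI ballI)
      fix \<alpha> assume "\<alpha> \<in> A"
      then show "t \<alpha> > 0" using s r p R\<rho>[of r] by (auto simp: t_def p_def)
    next
      have "(\<Sum>\<alpha>\<in>A. t \<alpha> * cis (u x' \<alpha>)) = cis (- s0) * (\<Sum>\<alpha>\<in>A. t \<alpha> * cis (u x \<alpha> + D \<alpha>))"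
        unfolding sum_distrib_left by (intro sum.cong refl) (simp add: ux' cis_mult algebra_simps)
      also have "(\<Sum>\<alpha>\<in>A. t \<alpha> * cis (u x \<alpha> + D \<alpha>)) =
          r * cis (u x k + \<delta>) + R r * cis (u x m - q * \<delta>) + (\<Sum>\<alpha>\<in>A - {k, m}. s \<alpha> * cis (u x \<alpha>))"
      proof -
        have "A = insert k (insert m (A - {k, m}))" using k m by auto
        then have "(\<Sum>\<alpha>\<in>A. t \<alpha> * cis (u x \<alpha> + D \<alpha>)) =
            (\<Sum>\<alpha>\<in>insert k (insert m (A - {k, m})). t \<alpha> * cis (u x \<alpha> + D \<alpha>))" by simp
        also have "\<dots> = t k * cis (u x k + D k) + (t m * cis (u x m + D m) +
            (\<Sum>\<alpha>\<in>A - {k, m}. t \<alpha> * cis (u x \<alpha> + D \<alpha>)))"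
          using fin km by (subst sum.insert, simp, simp, subst sum.insert) auto
        also have "(\<Sum>\<alpha>\<in>A - {k, m}. t \<alpha> * cis (u x \<alpha> + D \<alpha>)) = (\<Sum>\<alpha>\<in>A - {k, m}. s \<alpha> * cis (u x \<alpha>))"
          by (intro sum.cong refl) (auto simp: t_def D_def)
        finally show ?thesis using km by (simp add: t_def D_def add.assoc)
      qed
      also have "r * cis (u x k + \<delta>) = p * cis (u x k) - E0 - z"
      proof -
        have "r * cis \<delta> = \<zeta> z" using rcis_cmod_Arg[of "\<zeta> z"] by (simp add: r_def \<delta>_def rcis_def)
        then have "r * cis (u x k + \<delta>) = \<zeta> z * cis (u x k)"
          by (simp add: cis_mult[symmetric] mult.assoc mult.commute)
        also have "\<dots> = p * cis (u x k) - (E0 + z) * (cis (- u x k) * cis (u x k))"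
          by (simp add: \<zeta>_def algebra_simps)
        finally show ?thesis by (simp add: cis_mult algebra_simps)
      qed
      also have "R r * cis (u x m - q * \<delta>) = z" using z(2) by (simp add: F_def r_def \<delta>_def)
      also have "(\<Sum>\<alpha>\<in>A - {k, m}. s \<alpha> * cis (u x \<alpha>)) = E0 + (\<Sum>\<alpha>\<in>A - {k, m}. t0 \<alpha> * cis (u x \<alpha>))"
        by (simp add: E0_def left_diff_distrib sum_subtractf)
      also have "(\<Sum>\<alpha>\<in>A - {k, m}. t0 \<alpha> * cis (u x \<alpha>)) = - (p * cis (u x k))"
      proof -
        have "(\<Sum>\<alpha>\<in>A. t0 \<alpha> * cis (u x \<alpha>)) = t0 k * cis (u x k) + (\<Sum>\<alpha>\<in>A - {k}. t0 \<alpha> * cis (u x \<alpha>))"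
          using fin k by (intro sum.remove)
        also have "(\<Sum>\<alpha>\<in>A - {k}. t0 \<alpha> * cis (u x \<alpha>)) = t0 m * cis (u x m) + (\<Sum>\<alpha>\<in>A - {k} - {m}. t0 \<alpha> * cis (u x \<alpha>))"
          using fin m km by (intro sum.remove) auto
        also have "A - {k} - {m} = A - {k, m}" by auto
        finally show ?thesis using t0(2) m(2) by (simp add: p_def add_eq_0_iff)
      qed
      finally show "(\<Sum>\<alpha>\<in>A. t \<alpha> * cis (u x' \<alpha>)) = 0" by simp
    qed
    ultimately show "\<exists>x' t. dist x' x < e \<and> t \<in> Sol x' \<and> (\<forall>\<alpha>\<in>A - {k, m}. t \<alpha> = s \<alpha>) \<and>
        t k \<in> {t0 k / 2..2 * t0 k} \<and> t m = R (t k)"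
      using r km by (intro exI[of _ x'] exI[of _ t]) (auto simp: t_def p_def)
  qed
qed


text \<open>Solve \<open>h t = \<gamma>\<close> for the weight at \<open>q\<close> as a function of
  the weight at \<open>k\<close>, and use this function as \<open>R\<close> in
  \<open>perturb_zeros\<close>. Since \<open>l p\<close> and \<open>l q\<close> have opposite signs,
  a tiny weight at \<open>p\<close> makes the weight at \<open>q\<close> tiny too, as the
  perturbation requires.\<close>

lemma mixed_zeros_in_closure_Coam:
  fixes t0 :: "int ^ 'n \<Rightarrow> real"
  assumes t0: "\<And>\<alpha>. \<alpha> \<in> A \<Longrightarrow> t0 \<alpha> \<ge> 0" "(\<Sum>\<alpha>\<in>A. t0 \<alpha> * cis (u x \<alpha>)) = 0"
    and k: "k \<in> A" "t0 k > 0"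
    and p: "p \<in> A" "t0 p = 0" "l p > 0" and q: "q \<in> A" "t0 q = 0" "l q < 0"
  shows "x \<in> closure Coam"
  unfolding closure_approachable
proof (intro allI impI)
  fix e :: real assume e: "e > 0"
  obtain \<rho> where \<rho>: "\<rho> > 0"
    and pert: "\<And>(s :: int ^ 'n \<Rightarrow> real) R. (\<And>\<alpha>. \<alpha> \<in> A - {k, q} \<Longrightarrow> s \<alpha> > 0) \<Longrightarrow>
      cmod (\<Sum>\<alpha>\<in>A - {k, q}. (s \<alpha> - t0 \<alpha>) * cis (u x \<alpha>)) \<le> \<rho> \<Longrightarrow>
      continuous_on {t0 k / 2..2 * t0 k} R \<Longrightarrow>
      (\<And>r. r \<in> {t0 k / 2..2 * t0 k} \<Longrightarrow> 0 < R r \<and> R r \<le> \<rho>) \<Longrightarrow>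
      \<exists>x' t. dist x' x < e \<and> t \<in> Sol x' \<and> (\<forall>\<alpha>\<in>A - {k, q}. t \<alpha> = s \<alpha>) \<and>
        t k \<in> {t0 k / 2..2 * t0 k} \<and> t q = R (t k)"
    using perturb_zeros[OF t0 k q(1,2) e] by blast
  define B where "B = A - {k, q}"
  have kq: "k \<noteq> q" and kp: "k \<noteq> p" and pq: "p \<noteq> q" using k p q by auto
  have pB: "p \<in> B" and finB: "finite B" using p q kp pq fin by (auto simp: B_def)
  define c where "c = \<rho> / card A"
  have cA: "card A > 0" using card_A by simp
  have c: "c > 0" using \<rho> cA by (simp add: c_def)
  define s0 where "s0 \<alpha> = (if t0 \<alpha> = 0 then c else t0 \<alpha>)" for \<alpha>
  define K where "K = (\<Sum>\<alpha>\<in>B - {p}. l \<alpha> * ln (s0 \<alpha>))"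
  define M where "M = \<bar>ln (t0 k / 2)\<bar> + \<bar>ln (2 * t0 k)\<bar>"
  \<comment> \<open>\<open>K\<close> collects the other fixed weights and \<open>M\<close> bounds
    \<open>\<bar>ln r\<bar>\<close>. If \<open>ln \<sigma>\<close> is at most \<open>bd\<close>,
    then \<open>H r \<le> ln \<rho>\<close> on the whole interval.\<close>
  define bd where "bd = (- l q * ln \<rho> - K - \<bar>real_of_int (l k)\<bar> * M + \<gamma>) / l p"
  define \<sigma> where "\<sigma> = min c (exp bd)"
  have \<sigma>: "\<sigma> > 0" "\<sigma> \<le> c" "ln \<sigma> \<le> bd"
  proof -
    show "\<sigma> > 0" "\<sigma> \<le> c" using c by (auto simp: \<sigma>_def)
    have "ln \<sigma> \<le> ln (exp bd)" using \<open>\<sigma> > 0\<close> by (subst ln_le_cancel_iff) (auto simp: \<sigma>_def)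
    then show "ln \<sigma> \<le> bd" by simp
  qed
  define s where "s = s0 (p := \<sigma>)"
  have spos: "s \<alpha> > 0" if "\<alpha> \<in> A - {k, q}" for \<alpha>
    using t0(1)[of \<alpha>] that c \<sigma> by (auto simp: s_def s0_def)
  define H where "H r = ((\<Sum>\<alpha>\<in>B. l \<alpha> * ln (s \<alpha>)) + l k * ln r - \<gamma>) / (- l q)" for r
  have sumB: "(\<Sum>\<alpha>\<in>B. l \<alpha> * ln (s \<alpha>)) = l p * ln \<sigma> + K"
    unfolding K_def using finB pB by (subst sum.remove[of _ p]) (auto simp: s_def intro!: sum.cong)
  have t0k: "t0 k / 2 > 0" using k by simp
  have "\<exists>x' t. dist x' x < e \<and> t \<in> Sol x' \<and> (\<forall>\<alpha>\<in>A - {k, q}. t \<alpha> = s \<alpha>) \<and>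
        t k \<in> {t0 k / 2..2 * t0 k} \<and> t q = exp (H (t k))"
  proof (rule pert[OF spos])
    have "cmod (\<Sum>\<alpha>\<in>A - {k, q}. (s \<alpha> - t0 \<alpha>) * cis (u x \<alpha>)) \<le> (\<Sum>\<alpha>\<in>A - {k, q}. c)"
    proof (rule order_trans[OF norm_sum sum_mono])
      fix \<alpha> assume "\<alpha> \<in> A - {k, q}"
      then show "cmod ((s \<alpha> - t0 \<alpha>) * cis (u x \<alpha>)) \<le> c"
        using c \<sigma> p(2) by (auto simp: s_def s0_def norm_mult simp flip: of_real_diff)
    qed
    also have "\<dots> = real (card (A - {k, q})) * c" by simp
    also have "\<dots> \<le> card A * c" using c fin by (intro mult_right_mono) (auto intro: card_mono)
    also have "\<dots> = \<rho>" using cA by (simp add: c_def)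
    finally show "cmod (\<Sum>\<alpha>\<in>A - {k, q}. (s \<alpha> - t0 \<alpha>) * cis (u x \<alpha>)) \<le> \<rho>" .
    show "continuous_on {t0 k / 2..2 * t0 k} (\<lambda>r. exp (H r))"
      unfolding H_def using t0k q(3) by (intro continuous_intros) auto
    fix r assume r: "r \<in> {t0 k / 2..2 * t0 k}"
    have "ln (t0 k / 2) \<le> ln r" "ln r \<le> ln (2 * t0 k)" using r t0k by auto
    then have "\<bar>ln r\<bar> \<le> M" unfolding M_def by linarith
    then have "\<bar>real_of_int (l k)\<bar> * \<bar>ln r\<bar> \<le> \<bar>real_of_int (l k)\<bar> * M" by (intro mult_left_mono) auto
    then have "l k * ln r \<le> \<bar>real_of_int (l k)\<bar> * M"
      unfolding abs_mult[symmetric] by linarith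
    moreover have "l p * ln \<sigma> \<le> l p * bd" using \<sigma>(3) p(3) by (intro mult_left_mono) auto
    moreover have "l p * bd = - l q * ln \<rho> - K - \<bar>real_of_int (l k)\<bar> * M + \<gamma>"
      using p(3) by (simp add: bd_def)
    ultimately have "(\<Sum>\<alpha>\<in>B. l \<alpha> * ln (s \<alpha>)) + l k * ln r - \<gamma> \<le> ln \<rho> * (- l q)"
      unfolding sumB by (simp add: mult.commute)
    then have "H r \<le> ln \<rho>" unfolding H_def using q(3) by (subst pos_divide_le_eq) auto
    then have "exp (H r) \<le> \<rho>" using \<rho> by (metis exp_le_cancel_iff exp_ln)
    then show "0 < exp (H r) \<and> exp (H r) \<le> \<rho>" by simp
  qed
  then obtain x' t where t: "dist x' x < e" "t \<in> Sol x'" "\<And>\<alpha>. \<alpha> \<in> A - {k, q} \<Longrightarrow> t \<alpha> = s \<alpha>"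
    "t k \<in> {t0 k / 2..2 * t0 k}" "t q = exp (H (t k))" by blast
  have "h t = l k * ln (t k) + (l q * ln (t q) + (\<Sum>\<alpha>\<in>B. l \<alpha> * ln (t \<alpha>)))"
  proof -
    have AB: "A = insert k (insert q B)" using k q by (auto simp: B_def)
    have nb: "k \<notin> insert q B" "q \<notin> B" using kq by (auto simp: B_def)
    show ?thesis unfolding h_def by (subst AB, subst sum.insert) (use finB nb in auto)
  qed
  also have "(\<Sum>\<alpha>\<in>B. l \<alpha> * ln (t \<alpha>)) = (\<Sum>\<alpha>\<in>B. l \<alpha> * ln (s \<alpha>))"
    using t(3) by (intro sum.cong refl) (simp add: B_def)
  also have "l q * ln (t q) = - ((\<Sum>\<alpha>\<in>B. l \<alpha> * ln (s \<alpha>)) + l k * ln (t k) - \<gamma>)"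
    using q(3) by (simp add: t(5) H_def field_simps)
  finally have "h t = \<gamma>" by simp
  then have "x' \<in> Coam" using t(2) by (auto simp: Coam_def)
  then show "\<exists>y\<in>Coam. dist y x < e" using t(1) by blast
qed

text \<open>With no condition on \<open>h\<close> to satisfy, the constant \<open>\<rho>\<close>
  serves as the weight at a zero \<open>m\<close> in \<open>perturb_zeros\<close>.\<close>

lemma zeros_in_closure_Sol:
  fixes t0 :: "int ^ 'n \<Rightarrow> real"
  assumes t0: "\<And>\<alpha>. \<alpha> \<in> A \<Longrightarrow> t0 \<alpha> \<ge> 0" "(\<Sum>\<alpha>\<in>A. t0 \<alpha> * cis (u x \<alpha>)) = 0"
    and k: "k \<in> A" "t0 k > 0"
  shows "x \<in> closure {x. Sol x \<noteq> {}}"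
proof (cases "\<exists>m\<in>A. t0 m = 0")
  case False
  then have "t0 \<alpha> > 0" if "\<alpha> \<in> A" for \<alpha> using t0(1)[OF that] that by (metis order_le_less)
  then have "t0 \<in> Sol x" using t0(2) by (simp add: Sol_def)
  then have "x \<in> {x. Sol x \<noteq> {}}" by blast
  then show ?thesis using closure_subset by (rule rev_subsetD)
next
  case True
  then obtain m where m: "m \<in> A" "t0 m = 0" by blast
  show ?thesis unfolding closure_approachable
  proof (intro allI impI)
    fix e :: real assume e: "e > 0"
    obtain \<rho> where \<rho>: "\<rho> > 0"
      and pert: "\<And>(s :: int ^ 'n \<Rightarrow> real) R. (\<And>\<alpha>. \<alpha> \<in> A - {k, m} \<Longrightarrow> s \<alpha> > 0) \<Longrightarrow>
        cmod (\<Sum>\<alpha>\<in>A - {k, m}. (s \<alpha> - t0 \<alpha>) * cis (u x \<alpha>)) \<le> \<rho> \<Longrightarrow>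
        continuous_on {t0 k / 2..2 * t0 k} R \<Longrightarrow>
        (\<And>r. r \<in> {t0 k / 2..2 * t0 k} \<Longrightarrow> 0 < R r \<and> R r \<le> \<rho>) \<Longrightarrow>
        \<exists>x' t. dist x' x < e \<and> t \<in> Sol x' \<and> (\<forall>\<alpha>\<in>A - {k, m}. t \<alpha> = s \<alpha>) \<and>
          t k \<in> {t0 k / 2..2 * t0 k} \<and> t m = R (t k)"
      using perturb_zeros[OF t0 k m e] by blast
    define c where "c = \<rho> / card A"
    have cA: "card A > 0" using card_A by simp
    have c: "c > 0" using \<rho> cA by (simp add: c_def)
    define s where "s \<alpha> = (if t0 \<alpha> = 0 then c else t0 \<alpha>)" for \<alpha>
    have spos: "s \<alpha> > 0" if "\<alpha> \<in> A - {k, m}" for \<alpha>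
      using t0(1)[of \<alpha>] that c by (auto simp: s_def)
    have "cmod (\<Sum>\<alpha>\<in>A - {k, m}. (s \<alpha> - t0 \<alpha>) * cis (u x \<alpha>)) \<le> (\<Sum>\<alpha>\<in>A - {k, m}. c)"
    proof (rule order_trans[OF norm_sum sum_mono])
      fix \<alpha> assume "\<alpha> \<in> A - {k, m}"
      then show "cmod ((s \<alpha> - t0 \<alpha>) * cis (u x \<alpha>)) \<le> c"
        using c by (auto simp: s_def norm_mult simp flip: of_real_diff)
    qed
    also have "\<dots> = real (card (A - {k, m})) * c" by simp
    also have "\<dots> \<le> card A * c" using c fin by (intro mult_right_mono) (auto intro: card_mono)
    also have "\<dots> = \<rho>" using cA by (simp add: c_def)
    finally have E: "cmod (\<Sum>\<alpha>\<in>A - {k, m}. (s \<alpha> - t0 \<alpha>) * cis (u x \<alpha>)) \<le> \<rho>" .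
    have "\<exists>x' t. dist x' x < e \<and> t \<in> Sol x' \<and> (\<forall>\<alpha>\<in>A - {k, m}. t \<alpha> = s \<alpha>) \<and>
          t k \<in> {t0 k / 2..2 * t0 k} \<and> t m = \<rho>"
      by (rule pert[OF spos E]) (use \<rho> in auto)
    then show "\<exists>y\<in>{x. Sol x \<noteq> {}}. dist y x < e" by blast
  qed
qed

section \<open>Cells of lifts and their union\<close>

lemma P_shift: "P (\<lambda>\<alpha>. m \<alpha> + c) = P m"
  by (simp add: P_def algebra_simps)

lemma P_cong: "(\<And>\<alpha>. \<alpha> \<in> A \<Longrightarrow> m \<alpha> = m' \<alpha>) \<Longrightarrow> P m = P m'"
  by (simp add: P_def)

lemma open_P: "open (P m)"
proof -
  have "P m = (\<Inter>\<alpha>\<in>A. \<Inter>\<beta>\<in>A. {x. \<bar>u x \<alpha> + 2 * pi * m \<alpha> - (u x \<beta> + 2 * pi * m \<beta>)\<bar> < pi})"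
    by (auto simp: P_def)
  also have "open \<dots>"
    by (intro open_INT ballI fin open_Collect_less continuous_intros)
  finally show ?thesis .
qed

lemma open_Th: "open Th"
  unfolding Th_def by (intro open_UN ballI open_P)

lemma open_Om: "open Om"
  unfolding Om_def by (intro open_Compl closed_closure)

lemma convex_P: "convex (P m)"
proof (rule convexI)
  fix x y :: "real ^ 'n" and s t :: real
  assume *: "x \<in> P m" "y \<in> P m" "0 \<le> s" "0 \<le> t" "s + t = 1"
  show "s *\<^sub>R x + t *\<^sub>R y \<in> P m"
    unfolding P_def
  proof (intro CollectI ballI)
    fix \<alpha> \<beta> assume ab: "\<alpha> \<in> A" "\<beta> \<in> A"
    define X where "X = u x \<alpha> + 2 * pi * m \<alpha> - (u x \<beta> + 2 * pi * m \<beta>)"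
    define Y where "Y = u y \<alpha> + 2 * pi * m \<alpha> - (u y \<beta> + 2 * pi * m \<beta>)"
    have "\<bar>X\<bar> < pi" "\<bar>Y\<bar> < pi" using * ab unfolding P_def X_def Y_def by blast+
    then have XY: "X \<in> {-pi<..<pi}" "Y \<in> {-pi<..<pi}" unfolding greaterThanLessThan_iff by linarith+
    have t: "t = 1 - s" using * by simp
    have "s *\<^sub>R X + t *\<^sub>R Y \<in> {-pi<..<pi}" using XY * by (intro convexD) auto
    moreover have "u (s *\<^sub>R x + t *\<^sub>R y) \<alpha> + 2 * pi * m \<alpha> - (u (s *\<^sub>R x + t *\<^sub>R y) \<beta> + 2 * pi * m \<beta>) = s *\<^sub>R X + t *\<^sub>R Y"
      by (simp add: X_def Y_def u_def t inner_add_right algebra_simps)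
    ultimately show "\<bar>u (s *\<^sub>R x + t *\<^sub>R y) \<alpha> + 2 * pi * m \<alpha> - (u (s *\<^sub>R x + t *\<^sub>R y) \<beta> + 2 * pi * m \<beta>)\<bar> < pi"
      unfolding greaterThanLessThan_iff by linarith
  qed
qed

lemma A_nonempty: "A \<noteq> {}"
  using card_A by auto

text \<open>The axis of the half-plane is the midpoint of the smallest and the largest lift.\<close>

lemma P_half_plane:
  assumes "x \<in> P m"
  obtains \<phi> where "\<And>\<alpha>. \<alpha> \<in> A \<Longrightarrow> cos (\<phi> + u x \<alpha>) > 0"
proof -
  define w where "w \<alpha> = u x \<alpha> + 2 * pi * m \<alpha>" for \<alpha>
  define hi where "hi = Max (w ` A)"
  define lo where "lo = Min (w ` A)"
  have hl: "lo \<le> w \<alpha>" "w \<alpha> \<le> hi" if "\<alpha> \<in> A" for \<alpha> using that fin by (auto simp: hi_def lo_def)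
  have "hi \<in> w ` A" "lo \<in> w ` A" using fin A_nonempty by (auto simp: hi_def lo_def)
  then have hl': "hi - lo < pi" using assms by (fastforce simp: P_def w_def)
  show thesis
  proof (rule that[of "- (hi + lo) / 2"])
    fix \<alpha> assume "\<alpha> \<in> A"
    then have "cos (- (hi + lo) / 2 + w \<alpha>) > 0"
      using hl[of \<alpha>] hl' by (intro cos_gt_zero_pi) (auto simp: field_simps)
    also have "cos (- (hi + lo) / 2 + w \<alpha>) = Re (cis (- (hi + lo) / 2 + u x \<alpha> + 2 * pi * m \<alpha>))"
      unfolding w_def by (simp add: add.assoc)
    also have "\<dots> = cos (- (hi + lo) / 2 + u x \<alpha>)" by (subst cis_shift_int) simp
    finally show "cos (- (hi + lo) / 2 + u x \<alpha>) > 0" .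
  qed
qed

lemma Th_iff_half_plane: "x \<in> Th \<longleftrightarrow> (\<exists>\<phi>. \<forall>\<alpha>\<in>A. cos (\<phi> + u x \<alpha>) > 0)"
proof
  assume "x \<in> Th"
  then show "\<exists>\<phi>. \<forall>\<alpha>\<in>A. cos (\<phi> + u x \<alpha>) > 0" unfolding Th_def using P_half_plane by (metis UN_E)
next
  assume "\<exists>\<phi>. \<forall>\<alpha>\<in>A. cos (\<phi> + u x \<alpha>) > 0"
  then obtain \<phi> where \<phi>: "\<And>\<alpha>. \<alpha> \<in> A \<Longrightarrow> cos (\<phi> + u x \<alpha>) > 0" by blast
  obtain m :: "int ^ 'n \<Rightarrow> int" where
    "\<And>\<alpha> \<beta>. \<alpha> \<in> A \<Longrightarrow> \<beta> \<in> A \<Longrightarrow> \<bar>u x \<alpha> + 2 * pi * m \<alpha> - (u x \<beta> + 2 * pi * m \<beta>)\<bar> < pi"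
    using lifts_of_half_plane[of A \<phi> "u x"] \<phi> by blast
  then show "x \<in> Th" by (auto simp: Th_def P_def)
qed

lemma Sol_Th: "x \<in> Th \<Longrightarrow> Sol x = {}"
proof (rule ccontr)
  assume "x \<in> Th" "Sol x \<noteq> {}"
  then obtain \<phi> t where *: "\<And>\<alpha>. \<alpha> \<in> A \<Longrightarrow> cos (\<phi> + u x \<alpha>) > 0" "t \<in> Sol x"
    unfolding Th_iff_half_plane by blast
  obtain k where "k \<in> A" using A_nonempty by blast
  then show False
    using half_plane_no_combination[OF fin *(1), where t = t and k = k] *(2) by (auto simp: Sol_def less_imp_le)
qed

lemma Th_subset_Om: "Th \<subseteq> Om"
proof -
  have "Th \<inter> Coam = {}" using Sol_Th by (auto simp: Coam_def)
  then have "Th \<inter> closure Coam = {}" using open_Th by (simp add: open_Int_closure_eq_empty)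
  then show ?thesis by (auto simp: Om_def)
qed

lemma not_Th_in_closure_Sol: "x \<notin> Th \<Longrightarrow> x \<in> closure {x. Sol x \<noteq> {}}"
  using half_plane_or_positive_combination[OF fin, of "u x"] zeros_in_closure_Sol[of _ x]
  unfolding Th_iff_half_plane by metis

text \<open>The lopsided coamoeba will turn out to lie between \<open>{x. Sol x \<noteq> {}}\<close>
  and \<open>- Th\<close>, so this determines its closure without a description of the set
  itself.\<close>

lemma closure_Sol: "closure {x. Sol x \<noteq> {}} = - Th"
proof -
  have "Th \<inter> {x. Sol x \<noteq> {}} = {}" using Sol_Th by auto
  then have "Th \<inter> closure {x. Sol x \<noteq> {}} = {}" using open_Th by (simp add: open_Int_closure_eq_empty)
  then show ?thesis using not_Th_in_closure_Sol by auto
qed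

end

text \<open>Cramer's rule for \<open>Y\<close> in the basis \<open>cis p\<close>,
  \<open>cis q\<close>.\<close>

lemma cis_combination_eq:
  fixes Y :: complex
  assumes "sin (p - q) \<noteq> 0"
  shows "(Im (Y * cis (- q)) / sin (p - q)) * cis p + (Im (Y * cis (- p)) / sin (q - p)) * cis q = Y"
proof -
  have s: "sin (q - p) = - sin (p - q)" by (metis minus_diff_eq sin_minus)
  have e: "(Im (Y * cis (- q)) / sin (p - q)) * cis p + (Im (Y * cis (- p)) / sin (q - p)) * cis q =
      of_real (1 / sin (p - q)) * (Im (Y * cis (- q)) * cis p - Im (Y * cis (- p)) * cis q)"
    unfolding s by (simp add: right_diff_distrib)
  have "Im (Y * cis (- q)) * cis p - Im (Y * cis (- p)) * cis q = sin (p - q) * Y"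
    by (simp add: complex_eq_iff sin_diff algebra_simps)
  then show ?thesis unfolding e using assms by simp
qed

lemma cis_combination_unique:
  fixes s t :: real
  assumes "sin (p - q) \<noteq> 0" "s * cis p + t * cis q = s' * cis p + t' * cis q"
  shows "s = s' \<and> t = (t' :: real)"
proof -
  have *: "Im ((s * cis p + t * cis q) * cis (- q)) = s * sin (p - q)"
    "Im ((s * cis p + t * cis q) * cis (- p)) = t * sin (q - p)" for s t :: real
    by (simp_all add: sin_diff algebra_simps)
  have "sin (q - p) \<noteq> 0" using assms(1) by (metis minus_diff_eq neg_equal_0_iff_equal sin_minus)
  then show ?thesis using *[of s t] *[of s' t'] assms by simp
qed

section \<open>The part of \<open>Om\<close> below \<open>\<gamma>\<close> and its
  half-planes\<close>

context phased_circuit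
begin

text \<open>Phases that agree modulo \<open>pi\<close> would make the sum of
  \<open>l \<alpha> * a \<alpha>\<close> an integer multiple of \<open>pi\<close>, because
  \<open>l\<close> annihilates constants and linear functions.\<close>

lemma not_collinear: "\<exists>\<alpha>\<in>A. \<exists>\<beta>\<in>A. sin (u x \<alpha> - u x \<beta>) \<noteq> 0"
proof (rule ccontr)
  assume *: "\<not> ?thesis"
  obtain \<beta> where \<beta>: "\<beta> \<in> A" using A_nonempty by blast
  have "\<forall>\<alpha>\<in>A. \<exists>k::int. u x \<alpha> - u x \<beta> = of_int k * pi"
    using * \<beta> by (simp add: sin_zero_iff_int2)
  then obtain k :: "int ^ 'n \<Rightarrow> int" where k: "\<And>\<alpha>. \<alpha> \<in> A \<Longrightarrow> u x \<alpha> - u x \<beta> = of_int (k \<alpha>) * pi" by metis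
  have "(\<Sum>\<alpha>\<in>A. l \<alpha> * a \<alpha>) = (\<Sum>\<alpha>\<in>A. l \<alpha> * u x \<alpha>)" by (simp add: sum_l_u)
  also have "\<dots> = (\<Sum>\<alpha>\<in>A. l \<alpha> * (u x \<alpha> - u x \<beta>))"
    using sum_l_real by (simp add: right_diff_distrib sum_subtractf flip: sum_distrib_right)
  also have "\<dots> = (\<Sum>\<alpha>\<in>A. real_of_int (l \<alpha> * k \<alpha>) * pi)"
    by (intro sum.cong refl) (simp add: k)
  also have "\<dots> = of_int (\<Sum>\<alpha>\<in>A. l \<alpha> * k \<alpha>) * pi"
    by (simp add: sum_distrib_right)
  finally have "sin (\<Sum>\<alpha>\<in>A. l \<alpha> * a \<alpha>) = 0" unfolding sin_zero_iff_int2 by blast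
  then show False using generic by simp
qed

text \<open>Asking for one solution below \<open>\<gamma>\<close> makes openness easy to prove; by
  \<open>W_all\<close> every solution then lies below.\<close>

definition W :: "(real ^ 'n) set" where
  "W = {x \<in> Om. \<exists>t\<in>Sol x. h t < \<gamma>}"

lemma not_in_Coam: "x \<in> Om \<Longrightarrow> t \<in> Sol x \<Longrightarrow> h t \<noteq> \<gamma>"
  using closure_subset[of Coam] by (auto simp: Om_def Coam_def)

lemma Sol_convex:
  assumes "t \<in> Sol x" "t' \<in> Sol x" "0 \<le> s" "s \<le> 1"
  shows "(\<lambda>\<alpha>. (1 - s) * t \<alpha> + s * t' \<alpha>) \<in> Sol x"
proof -
  have "(\<Sum>\<alpha>\<in>A. ((1 - s) * t \<alpha> + s * t' \<alpha>) * cis (u x \<alpha>)) =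
      (1 - s) * (\<Sum>\<alpha>\<in>A. t \<alpha> * cis (u x \<alpha>)) + s * (\<Sum>\<alpha>\<in>A. t' \<alpha> * cis (u x \<alpha>))"
    by (simp add: sum_distrib_left sum.distrib[symmetric] algebra_simps)
  moreover have "(1 - s) * t \<alpha> + s * t' \<alpha> > 0" if "\<alpha> \<in> A" for \<alpha>
  proof (cases "s = 0")
    case True
    then show ?thesis using assms that by (simp add: Sol_def)
  next
    case False
    then show ?thesis using assms that
      by (intro add_nonneg_pos mult_nonneg_nonneg mult_pos_pos) (auto simp: Sol_def less_imp_le)
  qed
  ultimately show ?thesis using assms by (simp add: Sol_def)
qed

text \<open>Along the segment between two solutions \<open>h\<close> is continuous, and it cannot
  take the value \<open>\<gamma>\<close> because \<open>x\<close> lies outside the coamoeba.\<close>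

lemma h_less_if_connected:
  assumes "x \<in> Om" "t1 \<in> Sol x" "h t1 < \<gamma>" "t \<in> Sol x"
  shows "h t < \<gamma>"
proof (rule ccontr)
  assume "\<not> h t < \<gamma>"
  define f where "f s = h (\<lambda>\<alpha>. (1 - s) * t1 \<alpha> + s * t \<alpha>)" for s
  have S: "(\<lambda>\<alpha>. (1 - s) * t1 \<alpha> + s * t \<alpha>) \<in> Sol x" if "s \<in> {0..1}" for s
    using Sol_convex[OF assms(2,4)] that by auto
  have "continuous_on {0..1} f"
    unfolding f_def h_def using S by (intro continuous_intros) (force simp: Sol_def)
  moreover have "f 0 \<le> \<gamma>" "\<gamma> \<le> f 1" using assms \<open>\<not> h t < \<gamma>\<close> by (simp_all add: f_def)
  ultimately obtain s where "0 \<le> s" "s \<le> 1" "f s = \<gamma>"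
    using IVT'[of f 0 \<gamma> 1] by auto
  then show False using not_in_Coam[OF assms(1) S[of s]] by (auto simp: f_def)
qed

lemma W_all: "x \<in> W \<Longrightarrow> t \<in> Sol x \<Longrightarrow> h t < \<gamma>"
  unfolding W_def using h_less_if_connected by blast

text \<open>Two directions that are not collinear form a basis. Keeping the other weights and
  solving for these two gives weights depending continuously on the point, so positivity and
  \<open>h < \<gamma>\<close> persist nearby.\<close>

lemma open_W: "open W"
proof (subst open_subopen, intro ballI)
  fix x assume x: "x \<in> W"
  then obtain t where t: "t \<in> Sol x" "h t < \<gamma>" and "x \<in> Om" by (auto simp: W_def)
  obtain p q where pq: "p \<in> A" "q \<in> A" "sin (u x p - u x q) \<noteq> 0" using not_collinear by blast
  have pq': "p \<noteq> q" using pq by auto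
  define B where "B = A - {p, q}"
  have AB: "A = insert p (insert q B)" "p \<notin> insert q B" "q \<notin> B" and finB: "finite B"
    using pq pq' fin by (auto simp: B_def)
  have sumA: "(\<Sum>\<alpha>\<in>A. f \<alpha>) = f p + (f q + (\<Sum>\<alpha>\<in>B. f \<alpha>))" for f :: "_ \<Rightarrow> complex"
    by (subst AB(1), subst sum.insert) (use AB finB in auto)
  define Y where "Y y = - (\<Sum>\<alpha>\<in>B. t \<alpha> * cis (u y \<alpha>))" for y
  define T where "T y \<alpha> = (if \<alpha> = p then Im (Y y * cis (- u y q)) / sin (u y p - u y q)
      else if \<alpha> = q then Im (Y y * cis (- u y p)) / sin (u y q - u y p) else t \<alpha>)" for y \<alpha>
  have sol: "(\<Sum>\<alpha>\<in>A. T y \<alpha> * cis (u y \<alpha>)) = 0" if "sin (u y p - u y q) \<noteq> 0" for y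
  proof -
    have "(\<Sum>\<alpha>\<in>B. T y \<alpha> * cis (u y \<alpha>)) = - Y y"
      unfolding Y_def minus_minus by (intro sum.cong refl) (auto simp: T_def B_def)
    moreover have "T y p * cis (u y p) + T y q * cis (u y q) = Y y"
      using cis_combination_eq[OF that, of "Y y"] pq' pq'[symmetric] unfolding T_def by (simp only: if_True if_False refl)
    ultimately show ?thesis unfolding sumA by (metis add.assoc add.right_inverse)
  qed
  have Tx: "T x \<alpha> = t \<alpha>" if "\<alpha> \<in> A" for \<alpha>
  proof -
    have "(\<Sum>\<alpha>\<in>B. T x \<alpha> * cis (u x \<alpha>)) = (\<Sum>\<alpha>\<in>B. t \<alpha> * cis (u x \<alpha>))"
      by (intro sum.cong refl) (auto simp: T_def B_def)
    moreover have "(\<Sum>\<alpha>\<in>A. T x \<alpha> * cis (u x \<alpha>)) = (\<Sum>\<alpha>\<in>A. t \<alpha> * cis (u x \<alpha>))"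
      using sol[OF pq(3)] t(1) by (simp add: Sol_def)
    ultimately have "T x p * cis (u x p) + T x q * cis (u x q) = t p * cis (u x p) + t q * cis (u x q)"
      unfolding sumA by (simp add: algebra_simps)
    from cis_combination_unique[OF pq(3) this] show ?thesis by (auto simp: T_def)
  qed
  have uc: "((\<lambda>y. u y \<alpha>) \<longlongrightarrow> u x \<alpha>) (nhds x)" for \<alpha>
    unfolding u_def by (intro tendsto_intros filterlim_ident)
  have sq: "sin (u x q - u x p) \<noteq> 0" using pq(3) by (metis minus_diff_eq neg_equal_0_iff_equal sin_minus)
  have Tc: "((\<lambda>y. T y \<alpha>) \<longlongrightarrow> t \<alpha>) (nhds x)" if "\<alpha> \<in> A" for \<alpha>
  proof -
    have "((\<lambda>y. T y \<alpha>) \<longlongrightarrow> T x \<alpha>) (nhds x)"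
      unfolding T_def Y_def using pq(3) sq by (auto intro!: tendsto_intros uc)
    then show ?thesis using Tx that by simp
  qed
  have tpos: "t \<alpha> > 0" if "\<alpha> \<in> A" for \<alpha> using t that by (simp add: Sol_def)
  have "((\<lambda>y. h (T y)) \<longlongrightarrow> h t) (nhds x)"
    unfolding h_def using tpos by (intro tendsto_intros Tc) (auto simp: less_imp_neq[symmetric])
  then have "\<forall>\<^sub>F y in nhds x. h (T y) < \<gamma>" using t(2) by (rule order_tendstoD(2))
  moreover have "\<forall>\<^sub>F y in nhds x. \<forall>\<alpha>\<in>A. T y \<alpha> > 0"
    using fin tpos Tc by (intro eventually_ball_finite ballI order_tendstoD(1))
  moreover have "\<forall>\<^sub>F y in nhds x. sin (u y p - u y q) \<noteq> 0"
    using pq(3) by (intro tendsto_imp_eventually_ne[of _ "sin (u x p - u x q)"] tendsto_intros uc)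
  moreover have "\<forall>\<^sub>F y in nhds x. y \<in> Om"
    using open_Om \<open>x \<in> Om\<close> by (rule eventually_nhds_in_open)
  ultimately have "\<forall>\<^sub>F y in nhds x. y \<in> W"
  proof eventually_elim
    case (elim y)
    then have "T y \<in> Sol y" using sol by (simp add: Sol_def)
    then show ?case using elim by (auto simp: W_def)
  qed
  then show "\<exists>S. open S \<and> x \<in> S \<and> S \<subseteq> W" unfolding eventually_nhds by blast
qed

text \<open>If \<open>t0\<close> vanished at \<open>i\<close>, all its zeros would have
  \<open>l\<close> negative, since zeros of both signs are excluded in \<open>Om\<close>. The
  solutions \<open>t0 + \<epsilon> * t\<close> would then have \<open>h\<close> tending to infinity
  as \<open>\<epsilon>\<close> tends to 0, against \<open>h < \<gamma>\<close>.\<close>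

lemma W_negative_support:
  fixes t0 :: "int ^ 'n \<Rightarrow> real"
  assumes x: "x \<in> W" and t0: "\<And>\<alpha>. \<alpha> \<in> A \<Longrightarrow> t0 \<alpha> \<ge> 0" "(\<Sum>\<alpha>\<in>A. t0 \<alpha> * cis (u x \<alpha>)) = 0"
    and k: "k \<in> A" "t0 k > 0" and i: "i \<in> A" "l i < 0"
  shows "t0 i > 0"
proof (rule ccontr)
  assume "\<not> t0 i > 0"
  then have i0: "t0 i = 0" using t0(1)[OF i(1)] by simp
  have xOm: "x \<in> Om" using x by (simp add: W_def)
  have neg: "l p < 0" if "p \<in> A" "t0 p = 0" for p
  proof (rule ccontr)
    assume "\<not> l p < 0"
    then have "l p > 0" using l_nonzero[OF that(1)] by simp
    then have "x \<in> closure Coam" using mixed_zeros_in_closure_Coam[OF t0 k that _ i(1) i0 i(2)] by simp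
    then show False using xOm by (simp add: Om_def)
  qed
  obtain t where t: "t \<in> Sol x" using x by (auto simp: W_def)
  have tpos: "t \<alpha> > 0" if "\<alpha> \<in> A" for \<alpha> using t that by (simp add: Sol_def)
  define f where "f \<epsilon> \<alpha> = t0 \<alpha> + \<epsilon> * t \<alpha>" for \<epsilon> \<alpha>
  have fS: "f \<epsilon> \<in> Sol x" if "\<epsilon> > 0" for \<epsilon>
  proof -
    have "(\<Sum>\<alpha>\<in>A. f \<epsilon> \<alpha> * cis (u x \<alpha>)) =
        (\<Sum>\<alpha>\<in>A. t0 \<alpha> * cis (u x \<alpha>)) + \<epsilon> * (\<Sum>\<alpha>\<in>A. t \<alpha> * cis (u x \<alpha>))"
      by (simp add: f_def sum_distrib_left sum.distrib[symmetric] algebra_simps)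
    then show ?thesis using t t0 tpos that by (simp add: Sol_def f_def add_nonneg_pos)
  qed
  \<comment> \<open>A lower bound for \<open>h (f \<epsilon>)\<close>: the omitted summands belong
    to the other zeros of \<open>t0\<close> and are nonnegative once
    \<open>\<epsilon> * t \<alpha>\<close> is below 1.\<close>
  define g where "g \<epsilon> = (\<Sum>\<alpha>\<in>A - {i}. if t0 \<alpha> > 0 then l \<alpha> * ln (f \<epsilon> \<alpha>) else 0) + l i * ln (\<epsilon> * t i)" for \<epsilon>
  have "filterlim g at_top (at_right 0)"
    unfolding g_def
  proof (rule filterlim_tendsto_add_at_top)
    show "((\<lambda>\<epsilon>. \<Sum>\<alpha>\<in>A - {i}. if t0 \<alpha> > 0 then l \<alpha> * ln (f \<epsilon> \<alpha>) else 0) \<longlongrightarrow>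
        (\<Sum>\<alpha>\<in>A - {i}. if t0 \<alpha> > 0 then l \<alpha> * ln (t0 \<alpha>) else 0)) (at_right 0)"
    proof (rule tendsto_sum)
      fix \<alpha> assume "\<alpha> \<in> A - {i}"
      show "((\<lambda>\<epsilon>. if t0 \<alpha> > 0 then l \<alpha> * ln (f \<epsilon> \<alpha>) else 0) \<longlongrightarrow>
        (if t0 \<alpha> > 0 then l \<alpha> * ln (t0 \<alpha>) else 0)) (at_right 0)"
        by (auto simp: f_def intro!: tendsto_eq_intros)
    qed
    have "filterlim (\<lambda>\<epsilon>. \<epsilon> * t i) (at_right 0) (at_right 0)"
      unfolding filterlim_at using tpos[OF i(1)]
      by (auto intro!: tendsto_eq_intros simp: eventually_at_right_less)
         (auto simp: eventually_at_filter)
    then have "filterlim (\<lambda>\<epsilon>. ln (\<epsilon> * t i)) at_bot (at_right 0)"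
      using filterlim_compose[OF ln_at_0] by blast
    then have "filterlim (\<lambda>\<epsilon>. - ln (\<epsilon> * t i)) at_top (at_right 0)"
      by (simp add: filterlim_uminus_at_top)
    then have "filterlim (\<lambda>\<epsilon>. (- l i) * (- ln (\<epsilon> * t i))) at_top (at_right 0)"
      using i(2) by (intro filterlim_tendsto_pos_mult_at_top[OF tendsto_const]) auto
    then show "filterlim (\<lambda>\<epsilon>. l i * ln (\<epsilon> * t i)) at_top (at_right 0)" by simp
  qed
  then have ev: "\<forall>\<^sub>F \<epsilon> in at_right 0. \<gamma> \<le> g \<epsilon>" by (simp add: filterlim_at_top)
  have ev1: "\<forall>\<^sub>F \<epsilon> in at_right 0. \<epsilon> * t \<alpha> < 1" for \<alpha>
    by (rule order_tendstoD(2)[of _ 0]) (auto intro!: tendsto_eq_intros)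
  then have "\<forall>\<^sub>F \<epsilon> in at_right 0. \<forall>\<alpha>\<in>A. \<epsilon> * t \<alpha> < 1"
    using fin by (intro eventually_ball_finite) auto
  moreover have "\<forall>\<^sub>F \<epsilon> in at_right (0::real). \<epsilon> > 0" by (rule eventually_at_right_less)
  ultimately have "\<forall>\<^sub>F \<epsilon> in at_right (0::real). \<epsilon> > 0 \<and> \<gamma> \<le> h (f \<epsilon>)"
    using ev
  proof eventually_elim
    case (elim \<epsilon>)
    have "g \<epsilon> \<le> (\<Sum>\<alpha>\<in>A - {i}. l \<alpha> * ln (f \<epsilon> \<alpha>)) + l i * ln (\<epsilon> * t i)"
      unfolding g_def
    proof (intro add_right_mono sum_mono)
      fix \<alpha> assume \<alpha>: "\<alpha> \<in> A - {i}"
      show "(if t0 \<alpha> > 0 then l \<alpha> * ln (f \<epsilon> \<alpha>) else 0) \<le> l \<alpha> * ln (f \<epsilon> \<alpha>)"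
      proof (cases "t0 \<alpha> > 0")
        case False
        then have z: "t0 \<alpha> = 0" using t0(1)[of \<alpha>] \<alpha> by auto
        then have "l \<alpha> < 0" using neg \<alpha> by auto
        moreover have "ln (f \<epsilon> \<alpha>) \<le> 0"
          using elim \<alpha> tpos[of \<alpha>] by (simp add: f_def z less_imp_le)
        ultimately show ?thesis using False by (simp add: mult_nonpos_nonpos)
      qed simp
    qed
    also have "\<dots> = h (f \<epsilon>)"
      unfolding h_def using fin i(1) by (subst sum.remove[of A i]) (simp_all add: f_def i0)
    finally show ?case using elim by simp
  qed
  then obtain \<epsilon> where "\<epsilon> > 0" "\<gamma> \<le> h (f \<epsilon>)"
    using eventually_happens'[OF trivial_limit_at_right_real] by blast
  then show False using W_all[OF x fS[of \<epsilon>]] by simp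
qed

text \<open>Otherwise the remaining directions have a vanishing combination, which extended by 0 at
  \<open>i\<close> contradicts \<open>W_negative_support\<close>.\<close>

lemma W_half_plane:
  assumes x: "x \<in> W" and i: "i \<in> A" "l i < 0"
  obtains \<phi> where "\<And>\<alpha>. \<alpha> \<in> A - {i} \<Longrightarrow> cos (\<phi> + u x \<alpha>) > 0"
proof (cases rule: half_plane_or_positive_combination[OF finite_Diff[OF fin], of "{i}" "u x"])
  case (1 \<phi>)
  then show ?thesis using that by blast
next
  case (2 t)
  define t0 where "t0 = t (i := 0)"
  obtain k where k: "k \<in> A - {i}" "t k > 0" using 2 by blast
  have "(\<Sum>\<alpha>\<in>A. t0 \<alpha> * cis (u x \<alpha>)) = (\<Sum>\<alpha>\<in>A - {i}. t \<alpha> * cis (u x \<alpha>))"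
    using fin by (intro sum.mono_neutral_cong_right) (auto simp: t0_def)
  then have "t0 i > 0"
    using 2 k i by (intro W_negative_support[OF x, of t0 k i]) (auto simp: t0_def)
  then show ?thesis by (simp add: t0_def)
qed

lemma W_lifts:
  assumes x: "x \<in> W" and i: "i \<in> A" "l i < 0"
  obtains m :: "int ^ 'n \<Rightarrow> int" where
    "\<And>\<alpha> \<beta>. \<alpha> \<in> A - {i} \<Longrightarrow> \<beta> \<in> A - {i} \<Longrightarrow> \<bar>u x \<alpha> + 2 * pi * m \<alpha> - (u x \<beta> + 2 * pi * m \<beta>)\<bar> < pi"
proof -
  obtain \<phi> where "\<And>\<alpha>. \<alpha> \<in> A - {i} \<Longrightarrow> cos (\<phi> + u x \<alpha>) > 0" using W_half_plane[OF assms] by blast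
  then show thesis using lifts_of_half_plane[of "A - {i}" \<phi> "u x"] that by blast
qed


lemma dual_direction:
  fixes D :: "int ^ 'n \<Rightarrow> real"
  assumes "(\<Sum>\<alpha>\<in>A. l \<alpha> * D \<alpha>) = 0"
  obtains v s0 where "\<And>\<alpha>. \<alpha> \<in> A \<Longrightarrow> vreal \<alpha> \<bullet> v = D \<alpha> - s0"
  using dual[OF assms] by (metis add_diff_cancel_right')

lemma u_affine: "u ((1 - s) *\<^sub>R x + s *\<^sub>R y) \<alpha> = (1 - s) * u x \<alpha> + s * u y \<alpha>"
  by (simp add: u_def inner_add_right algebra_simps)

end

section \<open>Every component of the coamoeba complement meets a half-plane cell\<close>

context phased_circuit
begin

text \<open>If \<open>i\<close> is the only negative index, contracting the other arguments to their weighted mean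
  does not lead out of \<open>Om\<close>, since a solution at the contracted point yields one at the original
  point with a larger value of \<open>h\<close>.\<close>

lemma single_negative_segment:
  assumes x: "x \<in> W" and i: "i \<in> A" "l i < 0" and pos: "\<And>\<alpha>. \<alpha> \<in> A - {i} \<Longrightarrow> l \<alpha> > 0"
  obtains y where "y \<in> Th" "closed_segment x y \<subseteq> Om"
proof -
  define B where "B = A - {i}"
  have finB: "finite B" and iB: "i \<notin> B" and BA: "\<And>\<alpha>. \<alpha> \<in> B \<Longrightarrow> \<alpha> \<in> A"
    using fin by (auto simp: B_def)
  have sumA: "(\<Sum>\<alpha>\<in>A. f \<alpha>) = f i + (\<Sum>\<alpha>\<in>B. f \<alpha>)" for f :: "_ \<Rightarrow> 'z::comm_monoid_add"
    unfolding B_def using fin i(1) by (rule sum.remove)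
  obtain m :: "int ^ 'n \<Rightarrow> int" where m: "\<And>\<alpha> \<beta>. \<alpha> \<in> B \<Longrightarrow> \<beta> \<in> B \<Longrightarrow>
      \<bar>u x \<alpha> + 2 * pi * m \<alpha> - (u x \<beta> + 2 * pi * m \<beta>)\<bar> < pi"
    using W_lifts[OF x i] unfolding B_def by blast
  define w where "w z \<alpha> = u z \<alpha> + 2 * pi * m \<alpha> - u z i" for z \<alpha>
  define N where "N = real_of_int (- l i)"
  have N: "N > 0" using i by (simp add: N_def)
  have sumB: "(\<Sum>\<alpha>\<in>B. real_of_int (l \<alpha>)) = N"
    using sum_l_real sumA[of "\<lambda>\<alpha>. real_of_int (l \<alpha>)"] by (simp add: N_def)
  \<comment> \<open>The \<open>l\<close>-weighted mean of \<open>w z\<close> over \<open>B\<close>,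
    which is the same for all \<open>z\<close>. Genericity keeps it from being a multiple of
    \<open>pi\<close>.\<close>
  define \<omega> where "\<omega> = ((\<Sum>\<alpha>\<in>A. l \<alpha> * a \<alpha>) + 2 * pi * (\<Sum>\<alpha>\<in>B. l \<alpha> * m \<alpha>)) / N"
  have mean: "(\<Sum>\<alpha>\<in>B. l \<alpha> * w z \<alpha>) = N * \<omega>" for z
  proof -
    have "(\<Sum>\<alpha>\<in>B. l \<alpha> * w z \<alpha>) = (\<Sum>\<alpha>\<in>B. l \<alpha> * u z \<alpha>) + 2 * pi * (\<Sum>\<alpha>\<in>B. l \<alpha> * m \<alpha>) - N * u z i"
      unfolding sumB[symmetric]
      by (simp add: w_def algebra_simps sum.distrib sum_subtractf sum_distrib_left sum_distrib_right)
    also have "(\<Sum>\<alpha>\<in>B. l \<alpha> * u z \<alpha>) = (\<Sum>\<alpha>\<in>A. l \<alpha> * a \<alpha>) + N * u z i"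
      unfolding sum_l_u[symmetric, of z] sumA by (simp add: N_def)
    finally show ?thesis using N by (simp add: \<omega>_def)
  qed
  have sin\<omega>: "sin \<omega> \<noteq> 0"
  proof
    assume "sin \<omega> = 0"
    then obtain k :: int where "\<omega> = k * pi" unfolding sin_zero_iff_int2 by blast
    then have "(\<Sum>\<alpha>\<in>A. l \<alpha> * a \<alpha>) = of_int (- l i * k - 2 * (\<Sum>\<alpha>\<in>B. l \<alpha> * m \<alpha>)) * pi"
      using N by (simp add: \<omega>_def N_def field_simps)
    then have "sin (\<Sum>\<alpha>\<in>A. l \<alpha> * a \<alpha>) = 0" unfolding sin_zero_iff_int2 by blast
    then show False using generic by simp
  qed
  \<comment> \<open>The displacement that moves every phase of \<open>B\<close> to
    \<open>\<omega>\<close> relative to the phase of \<open>i\<close>; it is annihilated by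
    \<open>l\<close> because \<open>\<omega>\<close> is the mean.\<close>
  define D where "D \<alpha> = (if \<alpha> = i then 0 else \<omega> - w x \<alpha>)" for \<alpha>
  have "(\<Sum>\<alpha>\<in>A. l \<alpha> * D \<alpha>) = (\<Sum>\<alpha>\<in>B. l \<alpha> * (\<omega> - w x \<alpha>))"
    unfolding sumA using iB by (auto simp: D_def intro!: sum.cong)
  also have "\<dots> = (\<Sum>\<alpha>\<in>B. real_of_int (l \<alpha>)) * \<omega> - (\<Sum>\<alpha>\<in>B. l \<alpha> * w x \<alpha>)"
    by (simp add: right_diff_distrib sum_subtractf sum_distrib_right)
  also have "\<dots> = 0" unfolding mean sumB by simp
  finally obtain v s0 where v: "\<And>\<alpha>. \<alpha> \<in> A \<Longrightarrow> vreal \<alpha> \<bullet> v = D \<alpha> - s0"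
    using dual_direction[of D] by auto
  define y where "y = x + v"
  have wy: "w y \<alpha> = \<omega>" if "\<alpha> \<in> B" for \<alpha>
    using v[OF BA[OF that]] v[OF i(1)] that iB by (auto simp: w_def y_def u_def inner_add_right D_def)
  have yTh: "y \<in> Th"
  proof -
    \<comment> \<open>At \<open>y\<close> only two directions are left, at angle
      \<open>\<omega>\<close>. They are not antipodal, so their bisector, up to sign, is the axis of
      a half-plane containing both.\<close>
    have c0: "cos (\<omega> / 2) \<noteq> 0" using sin\<omega> sin_double[of "\<omega> / 2"] by auto
    define \<psi> where "\<psi> = (if cos (\<omega> / 2) > 0 then 0 else pi)"
    have "cos \<psi> * cos (\<omega> / 2) > 0" using c0 by (auto simp: \<psi>_def)
    moreover have "sin \<psi> = 0" by (simp add: \<psi>_def)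
    ultimately have \<psi>: "cos (\<psi> + \<omega> / 2) > 0" "cos (\<psi> - \<omega> / 2) > 0" by (simp_all add: cos_add cos_diff)
    have "cos ((\<psi> - \<omega> / 2 - u y i) + u y \<alpha>) > 0" if "\<alpha> \<in> A" for \<alpha>
    proof (cases "\<alpha> = i")
      case True
      then show ?thesis using \<psi> by simp
    next
      case False
      then have "\<omega> = u y \<alpha> + 2 * pi * m \<alpha> - u y i" using wy[of \<alpha>] that by (auto simp: w_def B_def)
      then have "(\<psi> - \<omega> / 2 - u y i) + u y \<alpha> + 2 * pi * m \<alpha> = \<psi> + \<omega> / 2" by argo
      then have "cis ((\<psi> - \<omega> / 2 - u y i) + u y \<alpha>) = cis (\<psi> + \<omega> / 2)" by (metis cis_shift_int)
      then show ?thesis using \<psi> by (metis cis.sel(1))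
    qed
    then show ?thesis unfolding Th_iff_half_plane by blast
  qed
  define V where "V = W \<inter> {z. \<forall>\<alpha>\<in>B. \<forall>\<beta>\<in>B. \<bar>w z \<alpha> - w z \<beta>\<bar> < pi}"
  have "{z. \<forall>\<alpha>\<in>B. \<forall>\<beta>\<in>B. \<bar>w z \<alpha> - w z \<beta>\<bar> < pi} = (\<Inter>\<alpha>\<in>B. \<Inter>\<beta>\<in>B. {z. \<bar>w z \<alpha> - w z \<beta>\<bar> < pi})" by auto
  moreover have "open \<dots>" unfolding w_def by (intro open_INT ballI finB open_Collect_less continuous_intros)
  ultimately have openV: "open V" unfolding V_def using open_W by (intro open_Int) simp_all
  have xV: "x \<in> V" using x m by (auto simp: V_def w_def algebra_simps)
  have rot: "(\<Sum>\<alpha>\<in>B. t \<alpha> * cis (w z \<alpha>)) = - t i" if "t \<in> Sol z" for t z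
  proof -
    have "(\<Sum>\<alpha>\<in>B. t \<alpha> * cis (w z \<alpha>)) = cis (- u z i) * (\<Sum>\<alpha>\<in>B. t \<alpha> * cis (u z \<alpha>))"
      unfolding sum_distrib_left
    proof (intro sum.cong refl)
      fix \<alpha>
      have "cis (w z \<alpha>) = cis (- u z i + u z \<alpha> + 2 * pi * m \<alpha>)" by (simp add: w_def algebra_simps)
      also have "\<dots> = cis (- u z i) * cis (u z \<alpha>)" by (simp add: cis_mult)
      finally show "t \<alpha> * cis (w z \<alpha>) = cis (- u z i) * (t \<alpha> * cis (u z \<alpha>))" by simp
    qed
    also have "(\<Sum>\<alpha>\<in>B. t \<alpha> * cis (u z \<alpha>)) = - (t i * cis (u z i))"
      using that unfolding Sol_def sumA by (simp add: eq_neg_iff_add_eq_0 add.commute)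
    finally show ?thesis by (simp add: cis_mult)
  qed
  have "closed_segment x y \<subseteq> Om"
  proof
    fix z assume "z \<in> closed_segment x y"
    then obtain s where s: "0 \<le> s" "s \<le> 1" "z = (1 - s) *\<^sub>R x + s *\<^sub>R y" by (auto simp: in_segment)
    show "z \<in> Om"
    proof (cases "s = 1")
      case True
      then show ?thesis using s yTh Th_subset_Om by auto
    next
      case False
      then have s1: "1 - s > 0" using s by simp
      \<comment> \<open>The homothety with centre \<open>y\<close> and ratio \<open>1 - s\<close>
        carries \<open>V\<close> to a neighbourhood of \<open>z\<close>, namely the preimage of
        \<open>V\<close> under \<open>\<kappa>\<close>. If all of it misses \<open>Coam\<close>,
        then \<open>z\<close> is not in the closure either.\<close>
      define \<kappa> where "\<kappa> z' = (1 / (1 - s)) *\<^sub>R (z' - s *\<^sub>R y)" for z'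
      have \<kappa>: "(1 - s) *\<^sub>R \<kappa> z' + s *\<^sub>R y = z'" for z' using s1 by (simp add: \<kappa>_def)
      have "open (\<kappa> -` V)" unfolding \<kappa>_def by (intro open_vimage openV continuous_intros)
      moreover have "z \<in> \<kappa> -` V" using s1 s xV by (simp add: \<kappa>_def)
      moreover have "\<kappa> -` V \<inter> Coam = {}"
      proof (rule ccontr)
        assume "\<kappa> -` V \<inter> Coam \<noteq> {}"
        then obtain z' where z': "\<kappa> z' \<in> V" "z' \<in> Coam" by blast
        define x' where "x' = \<kappa> z'"
        have z'x': "z' = (1 - s) *\<^sub>R x' + s *\<^sub>R y" by (simp add: x'_def \<kappa>)
        have x'V: "x' \<in> W" "\<And>\<alpha> \<beta>. \<alpha> \<in> B \<Longrightarrow> \<beta> \<in> B \<Longrightarrow> \<bar>w x' \<alpha> - w x' \<beta>\<bar> < pi"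
          using z' by (auto simp: V_def x'_def)
        obtain t where t: "t \<in> Sol z'" "h t = \<gamma>" using z' by (auto simp: Coam_def)
        obtain \<tau> where \<tau>: "\<tau> \<in> Sol x'" using x'V by (auto simp: W_def)
        have tp: "t \<alpha> > 0" "\<tau> \<alpha> > 0" if "\<alpha> \<in> A" for \<alpha> using t \<tau> that by (auto simp: Sol_def)
        have wz': "w z' \<alpha> = \<omega> + (1 - s) * (w x' \<alpha> - \<omega>)" if "\<alpha> \<in> B" for \<alpha>
        proof -
          have "w z' \<alpha> = (1 - s) * w x' \<alpha> + s * w y \<alpha>"
            unfolding w_def z'x' u_affine by (simp add: algebra_simps)
          then show ?thesis using wy[OF that] by (simp add: algebra_simps)
        qed
        \<comment> \<open>Rescaling the solution \<open>\<tau>\<close> by this factor makes both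
          combinations over \<open>B\<close> equal to \<open>- t i\<close>.\<close>
        define r where "r = t i / \<tau> i"
        have r: "r > 0" using tp[OF i(1)] by (simp add: r_def)
        have E: "(\<Sum>\<alpha>\<in>B. t \<alpha> * cis (\<omega> + (1 - s) * (w x' \<alpha> - \<omega>))) = (\<Sum>\<alpha>\<in>B. (r * \<tau> \<alpha>) * cis (w x' \<alpha>))"
        proof -
          have "(\<Sum>\<alpha>\<in>B. t \<alpha> * cis (\<omega> + (1 - s) * (w x' \<alpha> - \<omega>))) = - t i"
            using rot[OF t(1)] by (simp add: wz' cong: sum.cong)
          moreover have "(\<Sum>\<alpha>\<in>B. (r * \<tau> \<alpha>) * cis (w x' \<alpha>)) = r * (- \<tau> i)"
          proof -
            have "(\<Sum>\<alpha>\<in>B. (r * \<tau> \<alpha>) * cis (w x' \<alpha>)) = r * (\<Sum>\<alpha>\<in>B. \<tau> \<alpha> * cis (w x' \<alpha>))"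
              unfolding sum_distrib_left by (simp add: mult.assoc)
            then show ?thesis unfolding rot[OF \<tau>] by simp
          qed
          moreover have "r * \<tau> i = t i" using tp[OF i(1)] by (simp add: r_def)
          ultimately show ?thesis by (simp flip: of_real_mult)
        qed
        have \<mu>: "\<omega> = (\<Sum>\<alpha>\<in>B. real_of_int (l \<alpha>) * w x' \<alpha>) / (\<Sum>\<alpha>\<in>B. real_of_int (l \<alpha>))"
          using mean[of x'] sumB N by simp
        have lp: "real_of_int (l \<alpha>) > 0" if "\<alpha> \<in> B" for \<alpha> using pos that by (simp add: B_def)
        have tB: "t \<alpha> > 0" and r\<tau>: "r * \<tau> \<alpha> > 0" if "\<alpha> \<in> B" for \<alpha>
          using tp[OF BA[OF that]] r by auto
        have "\<exists>t'. (\<forall>\<alpha>\<in>B. t' \<alpha> > 0) \<and>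
          (\<Sum>\<alpha>\<in>B. t' \<alpha> * cis (w x' \<alpha>)) = (\<Sum>\<alpha>\<in>B. (r * \<tau> \<alpha>) * cis (w x' \<alpha>)) \<and>
          (\<Sum>\<alpha>\<in>B. l \<alpha> * ln (t \<alpha>)) \<le> (\<Sum>\<alpha>\<in>B. l \<alpha> * ln (t' \<alpha>))"
        proof (rule contraction[OF finB lp x'V(2) s(1,2) \<mu> tB r\<tau> E])
          fix t' :: "int ^ 'n \<Rightarrow> real"
          assume "\<And>\<alpha>. \<alpha> \<in> B \<Longrightarrow> t' \<alpha> > 0"
            "(\<Sum>\<alpha>\<in>B. t' \<alpha> * cis (w x' \<alpha>)) = (\<Sum>\<alpha>\<in>B. (r * \<tau> \<alpha>) * cis (w x' \<alpha>))"
            "(\<Sum>\<alpha>\<in>B. l \<alpha> * ln (t \<alpha>)) \<le> (\<Sum>\<alpha>\<in>B. l \<alpha> * ln (t' \<alpha>))"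
          then show ?thesis by (intro exI[of _ t'] conjI ballI)
        qed
        then obtain t' where t': "\<forall>\<alpha>\<in>B. t' \<alpha> > 0"
          "(\<Sum>\<alpha>\<in>B. t' \<alpha> * cis (w x' \<alpha>)) = (\<Sum>\<alpha>\<in>B. (r * \<tau> \<alpha>) * cis (w x' \<alpha>))"
          "(\<Sum>\<alpha>\<in>B. l \<alpha> * ln (t \<alpha>)) \<le> (\<Sum>\<alpha>\<in>B. l \<alpha> * ln (t' \<alpha>))" by blast
        define t'' where "t'' = t' (i := t i)"
        have t''B: "t'' \<alpha> = t' \<alpha>" if "\<alpha> \<in> B" for \<alpha> using that iB by (auto simp: t''_def)
        have "t'' \<in> Sol x'"
          unfolding Sol_def
        proof (intro CollectI conjI ballI)
          fix \<alpha> assume "\<alpha> \<in> A"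
          then show "t'' \<alpha> > 0" using t'(1) tp i by (auto simp: t''_def B_def)
        next
          have "(\<Sum>\<alpha>\<in>B. t' \<alpha> * cis (w x' \<alpha>)) = - t i"
            using t'(2) E rot[OF t(1)] by (simp add: wz' cong: sum.cong)
          moreover have "(\<Sum>\<alpha>\<in>B. t'' \<alpha> * cis (u x' \<alpha>)) = cis (u x' i) * (\<Sum>\<alpha>\<in>B. t' \<alpha> * cis (w x' \<alpha>))"
            unfolding sum_distrib_left
          proof (intro sum.cong refl)
            fix \<alpha> assume \<alpha>: "\<alpha> \<in> B"
            have "cis (u x' i) * cis (w x' \<alpha>) = cis (u x' \<alpha> + 2 * pi * m \<alpha>)" by (simp add: cis_mult w_def)
            then show "t'' \<alpha> * cis (u x' \<alpha>) = cis (u x' i) * (t' \<alpha> * cis (w x' \<alpha>))"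
              using t''B[OF \<alpha>] by (simp add: mult.left_commute)
          qed
          ultimately show "(\<Sum>\<alpha>\<in>A. t'' \<alpha> * cis (u x' \<alpha>)) = 0"
            unfolding sumA by (simp add: t''_def)
        qed
        moreover have "h t'' \<ge> h t"
          using t'(3) t''B unfolding h_def sumA by (simp add: t''_def cong: sum.cong)
        ultimately show False using W_all[OF x'V(1), of t''] t(2) by simp
      qed
      ultimately have "z \<notin> closure Coam" using open_Int_closure_eq_empty by blast
      then show ?thesis by (simp add: Om_def)
    qed
  qed
  with yTh show thesis by (rule that)
qed


text \<open>All directions other than \<open>i\<close> and \<open>j\<close> lie strictly on one side
  of the line through these two, so a positive combination has a nonzero component normal to that
  line.\<close>

lemma antipodal_Sol_empty:
  fixes w :: "int ^ 'n \<Rightarrow> real"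
  assumes ij: "i \<in> A" "j \<in> A" and o: "o' \<in> A - {i, j}"
    and w: "\<And>\<alpha>. \<alpha> \<in> A \<Longrightarrow> cis (w \<alpha>) = cis (u z \<alpha> + s0)"
    and d: "w i - w j = pi"
    and B: "\<And>\<alpha>. \<alpha> \<in> A - {i, j} \<Longrightarrow> \<bar>w \<alpha> - w i\<bar> < pi \<and> \<bar>w \<alpha> - w j\<bar> < pi"
  shows "Sol z = {}"
proof (rule ccontr)
  assume "Sol z \<noteq> {}"
  then obtain t where t: "t \<in> Sol z" by blast
  have "(\<Sum>\<alpha>\<in>A. t \<alpha> * sin (w \<alpha> - w j)) = Im (cis (s0 - w j) * (\<Sum>\<alpha>\<in>A. t \<alpha> * cis (u z \<alpha>)))"
    unfolding sum_distrib_left Im_sum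
  proof (intro sum.cong refl)
    fix \<alpha> assume "\<alpha> \<in> A"
    have "cis (w \<alpha> - w j) = cis (s0 - w j) * cis (u z \<alpha>)"
      using w[OF \<open>\<alpha> \<in> A\<close>] by (metis add.commute add_diff_eq cis_divide cis_mult times_divide_eq_right)
    then have "sin (w \<alpha> - w j) = Im (cis (s0 - w j) * cis (u z \<alpha>))" by (metis cis.sel(2))
    then show "t \<alpha> * sin (w \<alpha> - w j) = Im (cis (s0 - w j) * (t \<alpha> * cis (u z \<alpha>)))"
      by (simp add: algebra_simps)
  qed
  also have "\<dots> = 0" using t by (simp add: Sol_def)
  finally have "(\<Sum>\<alpha>\<in>A. t \<alpha> * sin (w \<alpha> - w j)) = 0" .
  moreover have "(\<Sum>\<alpha>\<in>A. t \<alpha> * sin (w \<alpha> - w j)) > 0"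
  proof (rule sum_pos2[OF fin, of o'])
    have pos: "sin (w \<alpha> - w j) > 0" if "\<alpha> \<in> A - {i, j}" for \<alpha>
      using B[OF that] d by (intro sin_gt_zero) linarith+
    show "o' \<in> A" using o by simp
    show "0 < t o' * sin (w o' - w j)" using pos[OF o] t o by (auto simp: Sol_def)
    fix \<alpha> assume "\<alpha> \<in> A"
    then show "0 \<le> t \<alpha> * sin (w \<alpha> - w j)"
      using pos[of \<alpha>] t d by (cases "\<alpha> \<in> {i, j}") (auto simp: Sol_def less_imp_le)
  qed
  ultimately show False by simp
qed

text \<open>Here the segment moves only the arguments of \<open>i\<close> and \<open>j\<close>. Seen from the opposite points
  \<open>u i - \<pi>\<close> and \<open>u j + \<pi>\<close> this is an expansion about their weighted mean, and contracting back
  decreases \<open>\<bar>l i\<bar> * ln (t i) + \<bar>l j\<bar> * ln (t j)\<close>, that is, increases \<open>h\<close>.\<close>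

lemma two_negative_segment_aux:
  fixes m :: "int ^ 'n \<Rightarrow> int"
  assumes x: "x \<in> W" and ij: "i \<in> A" "j \<in> A" "l i < 0" "l j < 0" and ij_ne: "i \<noteq> j" and o: "o' \<in> A - {i, j}"
    and m: "\<And>\<alpha> \<beta>. \<alpha> \<in> A \<Longrightarrow> \<beta> \<in> A \<Longrightarrow> {\<alpha>, \<beta>} \<noteq> {i, j} \<Longrightarrow>
      \<bar>u x \<alpha> + 2 * pi * m \<alpha> - (u x \<beta> + 2 * pi * m \<beta>)\<bar> < pi"
    and ge: "u x i + 2 * pi * m i \<ge> u x j + 2 * pi * m j"
  obtains y where "y \<in> Th" "closed_segment x y \<subseteq> Om"
proof -
  define w where "w z \<alpha> = u z \<alpha> + 2 * pi * m \<alpha>" for z \<alpha>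
  define d where "d z = w z i - w z j" for z
  define B where "B = A - {i, j}"
  have finB: "finite B" and BA: "\<And>\<alpha>. \<alpha> \<in> B \<Longrightarrow> \<alpha> \<in> A" and oB: "o' \<in> B"
    using fin o by (auto simp: B_def)
  have Bij: "\<alpha> \<noteq> i" "\<alpha> \<noteq> j" if "\<alpha> \<in> B" for \<alpha> using that by (auto simp: B_def)
  have AB: "A = insert i (insert j B)" "i \<notin> insert j B" "j \<notin> B"
    using ij ij_ne by (auto simp: B_def)
  have sumA: "(\<Sum>\<alpha>\<in>A. f \<alpha>) = f i + (f j + (\<Sum>\<alpha>\<in>B. f \<alpha>))" for f :: "_ \<Rightarrow> 'z::comm_monoid_add"
    by (subst AB(1), subst sum.insert) (use AB finB in auto)
  have cisw: "cis (w z \<alpha>) = cis (u z \<alpha>)" for z \<alpha> by (simp add: w_def)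
  have Pm: "z \<in> P m" if "\<And>\<alpha> \<beta>. \<alpha> \<in> B \<Longrightarrow> \<beta> \<in> B \<Longrightarrow> \<bar>w z \<alpha> - w z \<beta>\<bar> < pi"
      "\<And>\<alpha>. \<alpha> \<in> B \<Longrightarrow> \<bar>w z \<alpha> - w z i\<bar> < pi \<and> \<bar>w z \<alpha> - w z j\<bar> < pi" "\<bar>d z\<bar> < pi" for z
  proof -
    have "\<bar>w z \<alpha> - w z \<beta>\<bar> < pi" if "\<alpha> \<in> A" "\<beta> \<in> A" for \<alpha> \<beta>
    proof -
      have "\<alpha> = i \<or> \<alpha> = j \<or> \<alpha> \<in> B" "\<beta> = i \<or> \<beta> = j \<or> \<beta> \<in> B" using that by (auto simp: B_def)
      then show ?thesis
        using \<open>\<And>\<alpha> \<beta>. \<alpha> \<in> B \<Longrightarrow> \<beta> \<in> B \<Longrightarrow> \<bar>w z \<alpha> - w z \<beta>\<bar> < pi\<close>[of \<alpha> \<beta>]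
          \<open>\<And>\<alpha>. \<alpha> \<in> B \<Longrightarrow> \<bar>w z \<alpha> - w z i\<bar> < pi \<and> \<bar>w z \<alpha> - w z j\<bar> < pi\<close>[of \<alpha>]
          \<open>\<And>\<alpha>. \<alpha> \<in> B \<Longrightarrow> \<bar>w z \<alpha> - w z i\<bar> < pi \<and> \<bar>w z \<alpha> - w z j\<bar> < pi\<close>[of \<beta>] \<open>\<bar>d z\<bar> < pi\<close> pi_gt_zero
        unfolding d_def by (elim disjE) (simp_all add: abs_minus_commute)
    qed
    then show ?thesis by (simp add: P_def w_def)
  qed
  have mx: "\<bar>w x \<alpha> - w x \<beta>\<bar> < pi" if "\<alpha> \<in> B" "\<beta> \<in> B" for \<alpha> \<beta>
    using m[of \<alpha> \<beta>] that BA Bij by (auto simp: w_def doubleton_eq_iff)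
  have mxij: "\<bar>w x \<alpha> - w x i\<bar> < pi \<and> \<bar>w x \<alpha> - w x j\<bar> < pi" if "\<alpha> \<in> B" for \<alpha>
    using m[of \<alpha> i] m[of \<alpha> j] that BA[OF that] ij Bij[OF that] by (auto simp: w_def doubleton_eq_iff)
  have Solx: "Sol x \<noteq> {}" using x by (auto simp: W_def)
  \<comment> \<open>Only the pair \<open>i\<close>, \<open>j\<close> can keep \<open>x\<close> out
    of the cell, so their lifts are at least \<open>pi\<close> apart; distance exactly
    \<open>pi\<close> would be an antipodal configuration, which has no solution.\<close>
  have "x \<notin> P m" using Solx Sol_Th by (auto simp: Th_def)
  then have "\<not> \<bar>d x\<bar> < pi" using Pm[of x] mx mxij by blast
  moreover have "d x \<ge> 0" using ge by (simp add: d_def w_def)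
  moreover have "d x \<noteq> pi"
    using antipodal_Sol_empty[of i j o' "w x" x 0] ij o mxij Solx by (auto simp: d_def cisw B_def)
  ultimately have dx: "d x > pi" by linarith
  \<comment> \<open>The phases of \<open>i\<close> and \<open>j\<close> move in opposite directions
    at rates \<open>1 / \<bar>l i\<bar>\<close> and \<open>1 / \<bar>l j\<bar>\<close>. This keeps
    the weighted sum at 0, and with it the weighted mean of the two phases.\<close>
  define D where "D \<alpha> = (if \<alpha> = i then 1 / l i else if \<alpha> = j then - 1 / l j else 0)" for \<alpha>
  have "(\<Sum>\<alpha>\<in>A. l \<alpha> * D \<alpha>) = 0"
    unfolding sumA using ij ij_ne Bij by (auto simp: D_def intro!: sum.neutral)
  then obtain v s0 where v: "\<And>\<alpha>. \<alpha> \<in> A \<Longrightarrow> vreal \<alpha> \<bullet> v = D \<alpha> - s0" using dual_direction by metis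
  define p where "p = - 1 / real_of_int (l i)"
  define q where "q = - 1 / real_of_int (l j)"
  have pq: "p > 0" "q > 0" using ij by (simp_all add: p_def q_def)
  have lpq: "l i * p = - 1" "l j * q = - 1" using ij by (simp_all add: p_def q_def)
  have wv: "w (z + s *\<^sub>R v) \<alpha> + s * s0 = w z \<alpha>" if "\<alpha> \<in> B" for z s \<alpha>
    using Bij[OF that] by (simp add: w_def u_def inner_add_right v[OF BA[OF that]] D_def algebra_simps)
  have wvi: "w (z + s *\<^sub>R v) i + s * s0 = w z i - s * p" for z s
    by (simp add: w_def u_def inner_add_right v[OF ij(1)] D_def p_def algebra_simps)
  have wvj: "w (z + s *\<^sub>R v) j + s * s0 = w z j + s * q" for z s
    using ij_ne by (simp add: w_def u_def inner_add_right v[OF ij(2)] D_def q_def algebra_simps)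
  have dv: "d (z + s *\<^sub>R v) = d z - s * (p + q)" for z s
    using wvi[of z s] wvj[of z s] by (simp add: d_def algebra_simps)
  \<comment> \<open>The time at which the gap \<open>d\<close> has shrunk to \<open>pi / 2\<close>,
    strictly between 0 and \<open>pi\<close>, so that the end point lies in a cell.\<close>
  define e where "e = (d x - pi / 2) / (p + q)"
  have e: "e > 0" unfolding e_def using dx pq pi_gt_zero by (intro divide_pos_pos) linarith+
  have epq: "e * (p + q) = d x - pi / 2" using pq by (simp add: e_def)
  define V where "V = W \<inter> {z. \<forall>\<alpha>\<in>B. \<forall>\<beta>\<in>B. \<bar>w z \<alpha> - w z \<beta>\<bar> < pi}
      \<inter> {z. \<forall>\<alpha>\<in>B. \<bar>w z \<alpha> - w z i\<bar> < pi \<and> \<bar>w z \<alpha> - w z j\<bar> < pi} \<inter> {z. d z > pi \<and> d z - e * (p + q) > 0}"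
  have "{z. \<forall>\<alpha>\<in>B. \<forall>\<beta>\<in>B. \<bar>w z \<alpha> - w z \<beta>\<bar> < pi} = (\<Inter>\<alpha>\<in>B. \<Inter>\<beta>\<in>B. {z. \<bar>w z \<alpha> - w z \<beta>\<bar> < pi})" by auto
  moreover have "open \<dots>" unfolding w_def by (intro open_INT ballI finB open_Collect_less continuous_intros)
  moreover have "{z. \<forall>\<alpha>\<in>B. \<bar>w z \<alpha> - w z i\<bar> < pi \<and> \<bar>w z \<alpha> - w z j\<bar> < pi} =
      (\<Inter>\<alpha>\<in>B. {z. \<bar>w z \<alpha> - w z i\<bar> < pi} \<inter> {z. \<bar>w z \<alpha> - w z j\<bar> < pi})" by auto
  moreover have "open \<dots>" unfolding w_def by (intro open_INT ballI finB open_Int open_Collect_less continuous_intros)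
  moreover have "open {z. d z > pi \<and> d z - e * (p + q) > 0}"
    unfolding d_def w_def by (intro open_Collect_conj open_Collect_less continuous_intros)
  ultimately have openV: "open V" unfolding V_def using open_W by (intro open_Int) simp_all
  have xV: "x \<in> V" using x mx mxij dx epq pi_gt_zero by (auto simp: V_def)
  have dbound: "d z < 2 * pi" and between: "w z i - pi < w z \<alpha>" "w z \<alpha> < w z j + pi"
    "w z j < w z \<alpha>" "w z \<alpha> < w z i"
    if "z \<in> V" "\<alpha> \<in> B" for z \<alpha>
    using that by (auto simp: V_def d_def abs_less_iff dest!: bspec[of B _ \<alpha>])
  have inTh: "z + s *\<^sub>R v \<in> Th" if z: "z \<in> V" and s: "s \<ge> 0" and dz: "0 < d (z + s *\<^sub>R v)" "d (z + s *\<^sub>R v) < pi" for z s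
  proof -
    have s': "s * p \<ge> 0" "s * q \<ge> 0" using s pq by simp_all
    have "z + s *\<^sub>R v \<in> P m"
    proof (rule Pm)
      fix \<alpha> \<beta> assume ab: "\<alpha> \<in> B" "\<beta> \<in> B"
      then have "\<bar>w z \<alpha> - w z \<beta>\<bar> < pi" using z by (auto simp: V_def)
      then show "\<bar>w (z + s *\<^sub>R v) \<alpha> - w (z + s *\<^sub>R v) \<beta>\<bar> < pi"
        using wv[OF ab(1), of z s] wv[OF ab(2), of z s] by linarith
    next
      fix \<alpha> assume \<alpha>: "\<alpha> \<in> B"
      show "\<bar>w (z + s *\<^sub>R v) \<alpha> - w (z + s *\<^sub>R v) i\<bar> < pi \<and> \<bar>w (z + s *\<^sub>R v) \<alpha> - w (z + s *\<^sub>R v) j\<bar> < pi"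
        using between[OF z \<alpha>] wv[OF \<alpha>, of z s] wvi[of z s] wvj[of z s] s' dz unfolding d_def abs_less_iff by linarith
    qed (use dz in linarith)
    then show ?thesis by (auto simp: Th_def)
  qed
  define y where "y = x + e *\<^sub>R v"
  have yTh: "y \<in> Th" unfolding y_def
    using inTh[OF xV, of e] e dv[of x e] epq pi_gt_zero by simp
  have "closed_segment x y \<subseteq> Om"
  proof
    fix z assume "z \<in> closed_segment x y"
    then obtain r where r: "0 \<le> r" "r \<le> 1" "z = (1 - r) *\<^sub>R x + r *\<^sub>R y" by (auto simp: in_segment)
    define s where "s = r * e"
    have s: "0 \<le> s" "s \<le> e" using r e by (simp_all add: s_def mult_left_le_one_le)
    have z: "z = x + s *\<^sub>R v" by (simp add: r(3) y_def s_def algebra_simps)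
    \<comment> \<open>The motion is a translation, so \<open>V\<close> translated by
      \<open>s *\<^sub>R v\<close> is a neighbourhood of \<open>z\<close>.\<close>
    define \<kappa> where "\<kappa> z' = z' - s *\<^sub>R v" for z'
    have "open (\<kappa> -` V)" unfolding \<kappa>_def by (intro open_vimage openV continuous_intros)
    moreover have "z \<in> \<kappa> -` V" using xV by (simp add: \<kappa>_def z)
    moreover have "\<kappa> -` V \<inter> Coam = {}"
    proof (rule ccontr)
      assume "\<kappa> -` V \<inter> Coam \<noteq> {}"
      then obtain z' where z': "\<kappa> z' \<in> V" "z' \<in> Coam" by blast
      define x' where "x' = \<kappa> z'"
      have z'x': "z' = x' + s *\<^sub>R v" by (simp add: x'_def \<kappa>_def)
      have x'V: "x' \<in> V" and x'W: "x' \<in> W" using z' by (auto simp: x'_def V_def)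
      obtain t where t: "t \<in> Sol z'" "h t = \<gamma>" using z' by (auto simp: Coam_def)
      have tp: "t \<alpha> > 0" if "\<alpha> \<in> A" for \<alpha> using t that by (auto simp: Sol_def)
      have s': "s * p \<ge> 0" "s * q \<ge> 0" using s pq by simp_all
      have "s * (p + q) \<le> e * (p + q)" using s pq by (intro mult_right_mono) auto
      then have dz': "d z' > 0" using x'V by (simp add: z'x' dv V_def)
      have "d z' \<noteq> pi"
      proof
        assume dpi: "d z' = pi"
        have "Sol z' = {}"
        proof (rule antipodal_Sol_empty[OF ij(1,2) o])
          show "cis (w z' \<alpha>) = cis (u z' \<alpha> + 0)" if "\<alpha> \<in> A" for \<alpha> by (simp add: cisw)
          show "w z' i - w z' j = pi" using dpi by (simp add: d_def)
          fix \<alpha> assume "\<alpha> \<in> A - {i, j}"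
          then have \<alpha>: "\<alpha> \<in> B" by (simp add: B_def)
          show "\<bar>w z' \<alpha> - w z' i\<bar> < pi \<and> \<bar>w z' \<alpha> - w z' j\<bar> < pi"
            using between[OF x'V \<alpha>] wv[OF \<alpha>, of x' s] wvi[of x' s] wvj[of x' s] s' dpi x'V
            unfolding d_def abs_less_iff z'x' V_def by auto
        qed
        then show False using t by blast
      qed
      \<comment> \<open>As soon as the gap is below \<open>pi\<close> the point lies in a cell and
        has no solution, so only gaps above \<open>pi\<close> remain.\<close>
      moreover have "\<not> d z' < pi" using inTh[OF x'V s(1)] dz' Sol_Th t by (auto simp: z'x')
      ultimately have dz: "d z' > pi" by linarith
      define vi where "vi z = w z i - pi" for z
      define vj where "vj z = w z j + pi" for z
      have dvij: "vj z - vi z = 2 * pi - d z" for z by (simp add: vi_def vj_def d_def)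
      have dlt: "d z' \<le> d x'" using s' by (simp add: z'x' dv distrib_left)
      have dx': "d x' < 2 * pi" using dbound[OF x'V oB] .
      have dx'pi: "d x' > pi" using x'V by (simp add: V_def)
      define ex where "ex z \<alpha> = (if \<alpha> = i then vi z else vj z)" for z \<alpha>
      define Y where "Y = (\<Sum>\<alpha>\<in>B. t \<alpha> * cis (w x' \<alpha>))"
      have cisvi: "cis (vi z) = - cis (w z i)" "cis (vj z) = - cis (w z j)" for z
        by (simp_all add: vi_def vj_def complex_eq_iff)
      define \<theta> where "\<theta> = s * s0"
      have Yz: "Y = t i * cis (vi z' + \<theta>) + t j * cis (vj z' + \<theta>)"
      proof -
        have "(\<Sum>\<alpha>\<in>A. t \<alpha> * cis (w z' \<alpha>)) = 0" using t by (simp add: Sol_def cisw)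
        then have "0 = cis \<theta> * (\<Sum>\<alpha>\<in>A. t \<alpha> * cis (w z' \<alpha>))" by simp
        also have "\<dots> = (\<Sum>\<alpha>\<in>A. t \<alpha> * cis (w z' \<alpha> + \<theta>))"
          unfolding sum_distrib_left by (intro sum.cong refl) (simp add: algebra_simps flip: cis_mult)
        also have "\<dots> = t i * cis (w z' i + \<theta>) + (t j * cis (w z' j + \<theta>) + Y)"
          unfolding sumA Y_def using wv[of _ x' s] by (simp add: z'x' \<theta>_def)
        finally have "Y = - (t i * cis (w z' i + \<theta>)) - t j * cis (w z' j + \<theta>)" by algebra
        then show ?thesis by (simp add: cisvi flip: cis_mult)
      qed
      have sinx': "sin (vi x' - vj x') < 0"
      proof -
        have "sin (vj x' - vi x') > 0" using dvij[of x'] dx' dx'pi by (intro sin_gt_zero) auto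
        then show ?thesis using sin_minus[of "vj x' - vi x'"] by simp
      qed
      have sinx'': "sin (vj x' - vi x') > 0" using sinx' sin_minus[of "vj x' - vi x'"] by simp
      \<comment> \<open>The contribution \<open>Y\<close> of the other indices is the same at
        \<open>x'\<close> as at \<open>z'\<close> up to the rotation by \<open>\<theta>\<close>.
        Expanding it in the two opposite directions at \<open>x'\<close> gives a solution
        there.\<close>
      define tc where "tc = t (i := Im (Y * cis (- vj x')) / sin (vi x' - vj x'),
        j := Im (Y * cis (- vi x')) / sin (vj x' - vi x'))"
      have tceq: "tc i * cis (vi x') + tc j * cis (vj x') = Y"
        using cis_combination_eq[of "vi x'" "vj x'" Y] sinx' ij_ne by (simp add: tc_def del: Im_complex_div_eq_0)
      have tcB: "tc \<alpha> = t \<alpha>" if "\<alpha> \<in> B" for \<alpha> using Bij[OF that] by (simp add: tc_def)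
      have ImY: "Im (Y * cis (- \<phi>)) = (\<Sum>\<alpha>\<in>B. t \<alpha> * sin (w x' \<alpha> - \<phi>))" for \<phi>
        unfolding Y_def sum_distrib_right Im_sum
        by (intro sum.cong refl) (simp add: sin_diff algebra_simps)
      have neg: "sin (vj x' - w x' \<alpha>) > 0" if "\<alpha> \<in> B" for \<alpha>
        using between[OF x'V that] by (intro sin_gt_zero) (auto simp: vj_def)
      have "0 < (\<Sum>\<alpha>\<in>B. t \<alpha> * sin (vj x' - w x' \<alpha>))"
        using neg tp BA oB by (intro sum_pos2[OF finB oB]) (auto intro!: mult_nonneg_nonneg mult_pos_pos simp: less_imp_le)
      also have "\<dots> = - (\<Sum>\<alpha>\<in>B. t \<alpha> * sin (w x' \<alpha> - vj x'))"
        unfolding sum_negf[symmetric]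
      proof (intro sum.cong refl)
        fix \<alpha>
        show "t \<alpha> * sin (vj x' - w x' \<alpha>) = - (t \<alpha> * sin (w x' \<alpha> - vj x'))"
          using sin_minus[of "w x' \<alpha> - vj x'"] by simp
      qed
      finally have "Im (Y * cis (- vj x')) < 0" unfolding ImY by simp
      then have tci: "tc i > 0" using sinx' ij_ne by (simp add: tc_def divide_neg_neg)
      have "Im (Y * cis (- vi x')) > 0"
        unfolding ImY
      proof (rule sum_pos2)
        show "finite B" by (rule finB)
        show "o' \<in> B" by (rule oB)
        have pos: "sin (w x' \<alpha> - vi x') > 0" if "\<alpha> \<in> B" for \<alpha>
          using between[OF x'V that] by (intro sin_gt_zero) (auto simp: vi_def)
        show "0 < t o' * sin (w x' o' - vi x')" using pos[OF oB] tp[OF BA[OF oB]] by simp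
        show "0 \<le> t \<alpha> * sin (w x' \<alpha> - vi x')" if "\<alpha> \<in> B" for \<alpha>
          using pos[OF that] tp[OF BA[OF that]] by simp
      qed
      then have tcj: "tc j > 0" using sinx'' by (simp add: tc_def)
      have "tc \<in> Sol x'"
        unfolding Sol_def
      proof (intro CollectI conjI ballI)
        fix \<alpha> assume "\<alpha> \<in> A"
        then show "tc \<alpha> > 0" using tci tcj tcB tp AB(1) by auto
      next
        have "(\<Sum>\<alpha>\<in>A. tc \<alpha> * cis (w x' \<alpha>)) = tc i * cis (w x' i) + (tc j * cis (w x' j) + Y)"
          unfolding sumA Y_def using tcB by simp
        also have "\<dots> = 0" unfolding tceq[symmetric] by (simp add: cisvi)
        finally show "(\<Sum>\<alpha>\<in>A. tc \<alpha> * cis (u x' \<alpha>)) = 0" by (simp add: cisw)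
      qed
      define L where "L \<alpha> = - real_of_int (l \<alpha>)" for \<alpha>
      have L: "L \<alpha> > 0" if "\<alpha> \<in> {i, j}" for \<alpha> using ij that by (auto simp: L_def)
      define wz where "wz \<alpha> = (if \<alpha> = i then vi z' + \<theta> else vj z' + \<theta>)" for \<alpha>
      have sum2: "(\<Sum>\<alpha>\<in>{i, j}. f \<alpha>) = f i + f j" for f :: "_ \<Rightarrow> 'z::comm_monoid_add" using ij_ne by simp
      define \<mu> where "\<mu> = (\<Sum>\<alpha>\<in>{i, j}. L \<alpha> * wz \<alpha>) / (\<Sum>\<alpha>\<in>{i, j}. L \<alpha>)"
      \<comment> \<open>The opposite points are \<open>2 * pi - d\<close> apart, which at
        \<open>x'\<close> is at most its value at \<open>z'\<close>; as their weighted mean is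
        fixed, the pair at \<open>x'\<close> is the pair at \<open>z'\<close> contracted with this
        ratio.\<close>
      define \<rho> where "\<rho> = (2 * pi - d x') / (2 * pi - d z')"
      have \<rho>: "0 \<le> 1 - \<rho>" "1 - \<rho> \<le> 1" using dx' dlt by (simp_all add: \<rho>_def)
      have \<rho>d: "\<rho> * (vj z' - vi z') = vj x' - vi x'" using dx' dlt by (simp add: \<rho>_def dvij)
      have Lij: "L i > 0" "L j > 0" using L by auto
      have viz: "vi z' + \<theta> = vi x' - s * p" "vj z' + \<theta> = vj x' + s * q"
        using wvi[of x' s] wvj[of x' s] by (simp_all add: vi_def vj_def \<theta>_def z'x')
      have Lpq: "L i * p = 1" "L j * q = 1" using lpq by (simp_all add: L_def)
      have \<mu>x: "\<mu> * (L i + L j) = L i * vi x' + L j * vj x'"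
      proof -
        have "\<mu> * (L i + L j) = L i * (vi z' + \<theta>) + L j * (vj z' + \<theta>)"
          unfolding \<mu>_def sum2 using Lij ij_ne by (simp add: wz_def)
        also have "\<dots> = L i * vi x' + L j * vj x' - s * (L i * p) + s * (L j * q)"
          unfolding viz by (simp add: algebra_simps)
        finally show ?thesis using Lpq by simp
      qed
      have \<mu>z: "\<mu> * (L i + L j) = L i * (vi z' + \<theta>) + L j * (vj z' + \<theta>)"
        unfolding \<mu>_def sum2 using Lij ij_ne by (simp add: wz_def)
      have ci: "\<mu> + \<rho> * (vi z' + \<theta> - \<mu>) = vi x'"
      proof -
        have "(vi z' + \<theta> - \<mu>) * (L i + L j) = - L j * (vj z' - vi z')"
          using \<mu>z by (simp add: algebra_simps)
        moreover have "(vi x' - \<mu>) * (L i + L j) = - L j * (vj x' - vi x')"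
          using \<mu>x by (simp add: algebra_simps)
        ultimately have "(\<rho> * (vi z' + \<theta> - \<mu>)) * (L i + L j) = (vi x' - \<mu>) * (L i + L j)"
          unfolding \<rho>d[symmetric] by (simp add: mult.assoc mult.left_commute)
        then show ?thesis using Lij by simp
      qed
      have cj: "\<mu> + \<rho> * (vj z' + \<theta> - \<mu>) = vj x'"
      proof -
        have "\<mu> + \<rho> * (vj z' + \<theta> - \<mu>) = (\<mu> + \<rho> * (vi z' + \<theta> - \<mu>)) + \<rho> * (vj z' - vi z')"
          by (simp add: algebra_simps)
        then show ?thesis unfolding ci \<rho>d by simp
      qed
      have wzsp: "\<bar>wz \<alpha> - wz \<beta>\<bar> < pi" if "\<alpha> \<in> {i, j}" "\<beta> \<in> {i, j}" for \<alpha> \<beta>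
        using that dvij[of z'] dz dlt dx' pi_gt_zero by (auto simp: wz_def abs_less_iff)
      have E: "(\<Sum>\<alpha>\<in>{i, j}. tc \<alpha> * cis (\<mu> + (1 - (1 - \<rho>)) * (wz \<alpha> - \<mu>))) = (\<Sum>\<alpha>\<in>{i, j}. t \<alpha> * cis (wz \<alpha>))"
        unfolding sum2 using ci cj tceq Yz ij_ne by (simp add: wz_def)
      have fin2: "finite {i, j}" by simp
      have tc2: "tc \<alpha> > 0" and t2: "t \<alpha> > 0" if "\<alpha> \<in> {i, j}" for \<alpha>
        using that tci tcj tp ij by auto
      have "\<exists>t'. (\<forall>\<alpha>\<in>{i, j}. t' \<alpha> > 0) \<and>
        (\<Sum>\<alpha>\<in>{i, j}. t' \<alpha> * cis (wz \<alpha>)) = (\<Sum>\<alpha>\<in>{i, j}. t \<alpha> * cis (wz \<alpha>)) \<and>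
        (\<Sum>\<alpha>\<in>{i, j}. L \<alpha> * ln (tc \<alpha>)) \<le> (\<Sum>\<alpha>\<in>{i, j}. L \<alpha> * ln (t' \<alpha>))"
      proof (rule contraction[OF fin2 L wzsp \<rho> \<mu>_def tc2 t2 E])
        fix t' :: "int ^ 'n \<Rightarrow> real"
        assume "\<And>\<alpha>. \<alpha> \<in> {i, j} \<Longrightarrow> t' \<alpha> > 0"
          "(\<Sum>\<alpha>\<in>{i, j}. t' \<alpha> * cis (wz \<alpha>)) = (\<Sum>\<alpha>\<in>{i, j}. t \<alpha> * cis (wz \<alpha>))"
          "(\<Sum>\<alpha>\<in>{i, j}. L \<alpha> * ln (tc \<alpha>)) \<le> (\<Sum>\<alpha>\<in>{i, j}. L \<alpha> * ln (t' \<alpha>))"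
        then show ?thesis by (intro exI[of _ t'] conjI ballI)
      qed
      then obtain t' where t':
        "(\<Sum>\<alpha>\<in>{i, j}. t' \<alpha> * cis (wz \<alpha>)) = (\<Sum>\<alpha>\<in>{i, j}. t \<alpha> * cis (wz \<alpha>))"
        "(\<Sum>\<alpha>\<in>{i, j}. L \<alpha> * ln (tc \<alpha>)) \<le> (\<Sum>\<alpha>\<in>{i, j}. L \<alpha> * ln (t' \<alpha>))" by blast
      \<comment> \<open>Two independent directions determine the weights, so the \<open>t'\<close>
        supplied by \<open>contraction\<close> agrees with \<open>t\<close> at \<open>i\<close> and
        \<open>j\<close>.\<close>
      have "sin (wz i - wz j) \<noteq> 0"
      proof -
        have "sin (vj z' - vi z') > 0" using dvij[of z'] dz dlt dx' by (intro sin_gt_zero) auto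
        then show ?thesis using sin_minus[of "vj z' - vi z'"] ij_ne by (simp add: wz_def)
      qed
      then have "t' i = t i \<and> t' j = t j" using t'(1) unfolding sum2 by (rule cis_combination_unique)
      then have "L i * ln (tc i) + L j * ln (tc j) \<le> L i * ln (t i) + L j * ln (t j)"
        using t'(2) unfolding sum2 by simp
      then have "h tc \<ge> h t" unfolding h_def sumA using tcB by (simp add: L_def cong: sum.cong)
      then show False using W_all[OF x'W \<open>tc \<in> Sol x'\<close>] t(2) by simp
    qed
    ultimately have "z \<notin> closure Coam" using open_Int_closure_eq_empty by blast
    then show "z \<in> Om" by (simp add: Om_def)
  qed
  with yTh show thesis by (rule that)
qed

text \<open>Omitting \<open>i\<close> or omitting \<open>j\<close> leaves a half-plane in each case.
  The two systems of lifts, normalised at a third index \<open>o'\<close>, agree off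
  \<open>i\<close> and \<open>j\<close>, and together they control every pair except
  \<open>i\<close> with \<open>j\<close>.\<close>

lemma two_negative_segment:
  assumes x: "x \<in> W" and ij: "i \<in> A" "j \<in> A" "i \<noteq> j" "l i < 0" "l j < 0"
  obtains y where "y \<in> Th" "closed_segment x y \<subseteq> Om"
proof -
  obtain m1 :: "int ^ 'n \<Rightarrow> int" where m1: "\<And>\<alpha> \<beta>. \<alpha> \<in> A - {j} \<Longrightarrow> \<beta> \<in> A - {j} \<Longrightarrow>
      \<bar>u x \<alpha> + 2 * pi * m1 \<alpha> - (u x \<beta> + 2 * pi * m1 \<beta>)\<bar> < pi"
    using W_lifts[OF x ij(2,5)] by blast
  obtain m2 :: "int ^ 'n \<Rightarrow> int" where m2: "\<And>\<alpha> \<beta>. \<alpha> \<in> A - {i} \<Longrightarrow> \<beta> \<in> A - {i} \<Longrightarrow>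
      \<bar>u x \<alpha> + 2 * pi * m2 \<alpha> - (u x \<beta> + 2 * pi * m2 \<beta>)\<bar> < pi"
    using W_lifts[OF x ij(1,4)] by blast
  have "\<not> A \<subseteq> {i, j}"
  proof
    assume "A \<subseteq> {i, j}"
    then have "card A \<le> card {i, j}" by (intro card_mono) auto
    then show False using card_A ij(3) by simp
  qed
  then obtain o' where o: "o' \<in> A - {i, j}" by blast
  define m where "m \<alpha> = (if \<alpha> = j then m2 j - m2 o' else m1 \<alpha> - m1 o')" for \<alpha>
  have eq: "m1 \<alpha> - m1 o' = m2 \<alpha> - m2 o'" if "\<alpha> \<in> A - {i, j}" for \<alpha>
  proof -
    have "\<bar>2 * pi * of_int ((m1 \<alpha> - m1 o') - (m2 \<alpha> - m2 o'))\<bar> < 2 * pi"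
      using m1[of \<alpha> o'] m2[of \<alpha> o'] that o by (simp add: algebra_simps abs_less_iff)
    then have "\<bar>of_int ((m1 \<alpha> - m1 o') - (m2 \<alpha> - m2 o')) :: real\<bar> < 1"
      by (simp add: abs_mult)
    then show ?thesis by linarith
  qed
  have m: "\<bar>u x \<alpha> + 2 * pi * m \<alpha> - (u x \<beta> + 2 * pi * m \<beta>)\<bar> < pi"
    if ab: "\<alpha> \<in> A" "\<beta> \<in> A" "{\<alpha>, \<beta>} \<noteq> {i, j}" for \<alpha> \<beta>
  proof -
    have m2': "m \<delta> = m2 \<delta> - m2 o'" if "\<delta> \<in> A - {i}" for \<delta> using eq[of \<delta>] that by (auto simp: m_def)
    have m1': "m \<delta> = m1 \<delta> - m1 o'" if "\<delta> \<in> A - {j}" for \<delta> using that by (auto simp: m_def)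
    have "(\<alpha> \<in> A - {j} \<and> \<beta> \<in> A - {j}) \<or> (\<alpha> \<in> A - {i} \<and> \<beta> \<in> A - {i})" using ab ij(3) by auto
    then show ?thesis
    proof
      assume *: "\<alpha> \<in> A - {j} \<and> \<beta> \<in> A - {j}"
      then have e: "m \<alpha> = m1 \<alpha> - m1 o'" "m \<beta> = m1 \<beta> - m1 o'" using m1' by blast+
      show ?thesis using m1[of \<alpha> \<beta>] * unfolding e of_int_diff by (simp add: right_diff_distrib)
    next
      assume *: "\<alpha> \<in> A - {i} \<and> \<beta> \<in> A - {i}"
      then have e: "m \<alpha> = m2 \<alpha> - m2 o'" "m \<beta> = m2 \<beta> - m2 o'" using m2' by blast+
      show ?thesis using m2[of \<alpha> \<beta>] * unfolding e of_int_diff by (simp add: right_diff_distrib)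
    qed
  qed
  show thesis
  proof (cases "u x i + 2 * pi * m i \<ge> u x j + 2 * pi * m j")
    case True
    show ?thesis by (rule two_negative_segment_aux[OF x ij(1,2,4,5,3) o m True]) (assumption+, rule that)
  next
    case False
    have m': "\<bar>u x \<alpha> + 2 * pi * m \<alpha> - (u x \<beta> + 2 * pi * m \<beta>)\<bar> < pi"
      if "\<alpha> \<in> A" "\<beta> \<in> A" "{\<alpha>, \<beta>} \<noteq> {j, i}" for \<alpha> \<beta>
    proof -
      have "{\<alpha>, \<beta>} \<noteq> {i, j}" using that(3) by (simp add: insert_commute)
      then show ?thesis by (rule m[OF that(1,2)])
    qed
    have o2: "o' \<in> A - {j, i}" using o by auto
    have ge: "u x j + 2 * pi * m j \<ge> u x i + 2 * pi * m i" using False by simp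
    show ?thesis by (rule two_negative_segment_aux[OF x ij(2,1,5,4) ij(3)[symmetric] o2 m' ge]) (assumption+, rule that)
  qed
qed

lemma W_segment:
  assumes x: "x \<in> W"
  obtains y where "y \<in> Th" "closed_segment x y \<subseteq> Om"
proof -
  have "\<exists>i\<in>A. l i < 0"
  proof (rule ccontr)
    assume "\<not> ?thesis"
    then have "\<forall>\<alpha>\<in>A. l \<alpha> > 0" using l_nonzero by force
    then have "(\<Sum>\<alpha>\<in>A. l \<alpha>) > 0" using fin A_nonempty by (intro sum_pos) auto
    then show False using sum_l by simp
  qed
  then obtain i where i: "i \<in> A" "l i < 0" by blast
  show thesis
  proof (cases "\<forall>\<alpha>\<in>A - {i}. l \<alpha> > 0")
    case True
    then show ?thesis using single_negative_segment[OF x i] that by blast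
  next
    case False
    then obtain j where "j \<in> A" "j \<noteq> i" "l j < 0" using l_nonzero by force
    then show ?thesis using two_negative_segment[OF x, of i j] i that by blast
  qed
qed


lemma flip: "phased_circuit A (\<lambda>\<alpha>. - l \<alpha>) b a"
proof
  show "\<exists>s. \<forall>\<alpha>\<in>A. \<delta> \<alpha> = vreal \<alpha> \<bullet> (\<Sum>\<beta>\<in>A. \<delta> \<beta> *\<^sub>R b \<beta>) + s"
    if "(\<Sum>\<alpha>\<in>A. real_of_int (- l \<alpha>) * \<delta> \<alpha>) = 0" for \<delta>
    using dual[of \<delta>] that by (simp add: sum_negf)
qed (use fin card_A l_nonzero sum_l sum_l_coord generic in \<open>auto simp: sum_negf\<close>)

lemma flip_Coam: "phased_circuit.Coam A (\<lambda>\<alpha>. - l \<alpha>) a (- \<gamma>) = Coam"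
proof -
  interpret F: phased_circuit A "\<lambda>\<alpha>. - l \<alpha>" b a "- \<gamma>" by (rule flip)
  show ?thesis unfolding Coam_def F.Coam_def by (simp add: h_def F.h_def sum_negf)
qed

text \<open>A point of \<open>Om\<close> outside \<open>Th\<close> may have no solution, being only
  a limit of points that have one. It is first moved inside a ball in \<open>Om\<close> to such a
  point, which lies in the region \<open>W\<close> for \<open>l\<close> or for
  \<open>- l\<close>.\<close>

lemma Om_connects_to_Th:
  assumes "x \<in> Om"
  obtains C where "connected C" "x \<in> C" "C \<subseteq> Om" "C \<inter> Th \<noteq> {}"
proof (cases "x \<in> Th")
  case True
  then show ?thesis using assms that[of "{x}"] by auto
next
  case False
  interpret F: phased_circuit A "\<lambda>\<alpha>. - l \<alpha>" b a "- \<gamma>" by (rule flip)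
  have FOm: "F.Om = Om" unfolding Om_def F.Om_def flip_Coam ..
  obtain e where e: "e > 0" "ball x e \<subseteq> Om" using open_Om assms by (metis openE)
  obtain x' where x': "dist x' x < e" "Sol x' \<noteq> {}"
    using not_Th_in_closure_Sol[OF False] e(1) unfolding closure_approachable by blast
  then have x'b: "x' \<in> ball x e" by (simp add: dist_commute)
  then have x'Om: "x' \<in> Om" using e by blast
  obtain t where t: "t \<in> Sol x'" using x' by blast
  have "\<exists>y. y \<in> Th \<and> closed_segment x' y \<subseteq> Om"
  proof (cases "h t < \<gamma>")
    case True
    then have "x' \<in> W" using t x'Om by (auto simp: W_def)
    then show ?thesis using W_segment by blast
  next
    case False
    then have "h t > \<gamma>" using not_in_Coam[OF x'Om t] by simp
    then have "F.h t < - \<gamma>" by (simp add: h_def F.h_def sum_negf)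
    then have "x' \<in> F.W" unfolding F.W_def using t x'Om FOm by blast
    then show ?thesis using F.W_segment unfolding FOm by blast
  qed
  then obtain y where y: "y \<in> Th" "closed_segment x' y \<subseteq> Om" by blast
  show ?thesis
  proof (rule that[of "ball x e \<union> closed_segment x' y"])
    show "connected (ball x e \<union> closed_segment x' y)"
      using x'b by (intro connected_Un connected_ball connected_segment) auto
  qed (use e y in auto)
qed

end

section \<open>Distinct half-plane cells stay separated\<close>

context phased_circuit
begin

text \<open>As \<open>l\<close> sums to 0, this is the sum of its positive values.\<close>

definition N :: real where
  "N = (\<Sum>\<alpha>\<in>A. \<bar>real_of_int (l \<alpha>)\<bar>) / 2"

text \<open>The \<open>l\<close>-weighted sum of the lifted phases, written so as to show that it is
  the same at every point; see \<open>Lam_eq\<close>.\<close>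

definition Lam :: "(int ^ 'n \<Rightarrow> int) \<Rightarrow> real" where
  "Lam m = (\<Sum>\<alpha>\<in>A. l \<alpha> * a \<alpha>) + 2 * pi * (\<Sum>\<alpha>\<in>A. l \<alpha> * m \<alpha>)"

lemma Lam_eq: "Lam m = (\<Sum>\<alpha>\<in>A. l \<alpha> * (u x \<alpha> + 2 * pi * m \<alpha>))"
  unfolding Lam_def sum_l_u[of x, symmetric]
  by (simp add: distrib_left sum.distrib sum_distrib_left mult.left_commute)

text \<open>In a cell each lift is within \<open>pi / 2\<close> of the midpoint \<open>c\<close> of
  their range, and subtracting \<open>c\<close> does not change the weighted sum.\<close>

lemma Lam_bound:
  assumes "x \<in> P m"
  shows "\<bar>Lam m\<bar> < pi * N"
proof -
  define w where "w \<alpha> = u x \<alpha> + 2 * pi * m \<alpha>" for \<alpha>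
  define hi where "hi = Max (w ` A)"
  define lo where "lo = Min (w ` A)"
  have hl: "lo \<le> w \<alpha>" "w \<alpha> \<le> hi" if "\<alpha> \<in> A" for \<alpha> using that fin by (auto simp: hi_def lo_def)
  have "hi \<in> w ` A" "lo \<in> w ` A" using fin A_nonempty by (auto simp: hi_def lo_def)
  then have hl': "hi - lo < pi" using assms by (fastforce simp: P_def w_def)
  define c where "c = (hi + lo) / 2"
  have wc: "\<bar>w \<alpha> - c\<bar> < pi / 2" if "\<alpha> \<in> A" for \<alpha>
    using hl[OF that] hl' unfolding c_def abs_less_iff by (simp add: field_simps)
  have "Lam m = (\<Sum>\<alpha>\<in>A. l \<alpha> * (w \<alpha> - c))"
    unfolding Lam_eq[of m x] using sum_l_real
    by (simp add: w_def right_diff_distrib sum_subtractf flip: sum_distrib_right)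
  then have "\<bar>Lam m\<bar> \<le> (\<Sum>\<alpha>\<in>A. \<bar>real_of_int (l \<alpha>)\<bar> * \<bar>w \<alpha> - c\<bar>)"
    by (simp add: abs_mult[symmetric] sum_abs)
  also have "\<dots> < (\<Sum>\<alpha>\<in>A. \<bar>real_of_int (l \<alpha>)\<bar> * (pi / 2))"
    using wc l_nonzero fin A_nonempty by (intro sum_strict_mono mult_strict_left_mono) auto
  also have "\<dots> = pi * N" unfolding sum_distrib_right[symmetric] by (simp add: N_def)
  finally show ?thesis .
qed

text \<open>The extremal configuration has all lifts at \<open>\<rho>\<close> for positive and at
  \<open>- \<rho>\<close> for negative \<open>l\<close>. Its weighted sum is
  \<open>2 * N * \<rho>\<close>, and the bound on \<open>Lam m\<close> is exactly
  \<open>\<bar>\<rho>\<bar> < pi / 2\<close>.\<close>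

lemma P_nonempty:
  assumes "\<bar>Lam m\<bar> < pi * N"
  shows "P m \<noteq> {}"
proof -
  have N0: "N > 0" unfolding N_def using fin A_nonempty l_nonzero by (intro divide_pos_pos sum_pos) auto
  define \<rho> where "\<rho> = Lam m / (2 * N)"
  have \<rho>: "\<bar>\<rho>\<bar> < pi / 2" using assms N0 by (simp add: \<rho>_def field_simps)
  define D where "D \<alpha> = \<rho> * sgn (real_of_int (l \<alpha>)) - a \<alpha> - 2 * pi * m \<alpha>" for \<alpha>
  have "(\<Sum>\<alpha>\<in>A. l \<alpha> * D \<alpha>) = \<rho> * (\<Sum>\<alpha>\<in>A. \<bar>real_of_int (l \<alpha>)\<bar>) - Lam m"
    by (simp add: D_def Lam_def right_diff_distrib sum_subtractf sum_distrib_left sum.distrib abs_sgn algebra_simps)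
  also have "\<dots> = 0" using N0 by (simp add: \<rho>_def N_def)
  finally obtain v s0 where v: "\<And>\<alpha>. \<alpha> \<in> A \<Longrightarrow> vreal \<alpha> \<bullet> v = D \<alpha> - s0" using dual_direction by metis
  have uv: "u v \<alpha> + 2 * pi * m \<alpha> = \<rho> * sgn (real_of_int (l \<alpha>)) - s0" if "\<alpha> \<in> A" for \<alpha>
    unfolding u_def v[OF that] by (simp add: D_def)
  have b: "\<bar>\<rho> * sgn (real_of_int k)\<bar> < pi / 2" for k
    using \<rho> pi_gt_zero by (auto simp: sgn_if abs_mult)
  have "v \<in> P m"
    unfolding P_def
  proof (intro CollectI ballI)
    fix \<alpha> \<beta> assume ab: "\<alpha> \<in> A" "\<beta> \<in> A"
    show "\<bar>u v \<alpha> + 2 * pi * m \<alpha> - (u v \<beta> + 2 * pi * m \<beta>)\<bar> < pi"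
      unfolding uv[OF ab(1)] uv[OF ab(2)] using b[of "l \<alpha>"] b[of "l \<beta>"] by linarith
  qed
  then show ?thesis by blast
qed

lemma lifts_unique:
  fixes k k' :: int and X :: real
  assumes "\<bar>X + 2 * pi * k\<bar> < pi" "\<bar>X + 2 * pi * k'\<bar> < pi"
  shows "k = k'"
proof -
  have "\<bar>2 * pi * of_int (k - k')\<bar> < 2 * pi" using assms by (simp add: right_diff_distrib abs_less_iff)
  then have "\<bar>of_int (k - k') :: real\<bar> < 1" by (simp add: abs_mult)
  then show ?thesis by linarith
qed

lemma P_lifts_unique:
  fixes m m' :: "int ^ 'n \<Rightarrow> int"
  assumes "x \<in> P m'" "\<alpha> \<in> A" "\<beta> \<in> A" "\<bar>u x \<alpha> + 2 * pi * m \<alpha> - (u x \<beta> + 2 * pi * m \<beta>)\<bar> < pi"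
  shows "m' \<alpha> - m \<alpha> = m' \<beta> - m \<beta>"
proof -
  have "\<bar>u x \<alpha> + 2 * pi * m' \<alpha> - (u x \<beta> + 2 * pi * m' \<beta>)\<bar> < pi"
    using assms by (auto simp: P_def)
  then have "m' \<alpha> - m' \<beta> = m \<alpha> - m \<beta>"
    using assms(4) by (intro lifts_unique[of "u x \<alpha> - u x \<beta>"]) (simp_all add: algebra_simps)
  then show ?thesis by simp
qed

text \<open>With a single negative index, \<open>N\<close> equals \<open>\<bar>l i\<bar>\<close>. A
  nonzero integer discrepancy at \<open>i\<close> would move \<open>Lam\<close> by at least
  \<open>2 * pi * N\<close>, the full length of the interval allowed by
  \<open>Lam_bound\<close>.\<close>

lemma const_of_single_negative:
  assumes x: "x \<in> P m" and y: "y \<in> P m'" and i: "i \<in> A" "l i < 0"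
    and pos: "\<And>\<alpha>. \<alpha> \<in> A - {i} \<Longrightarrow> l \<alpha> > 0" and c: "\<And>\<alpha>. \<alpha> \<in> A - {i} \<Longrightarrow> m' \<alpha> = m \<alpha> + c"
  shows "m' i = m i + c"
proof -
  have sumA: "(\<Sum>\<alpha>\<in>A. f \<alpha>) = f i + (\<Sum>\<alpha>\<in>A - {i}. f \<alpha>)" for f :: "_ \<Rightarrow> 'z::comm_monoid_add"
    using fin i(1) by (rule sum.remove)
  have sB: "(\<Sum>\<alpha>\<in>A - {i}. real_of_int (l \<alpha>)) = - l i" using sum_l_real unfolding sumA by simp
  have "(\<Sum>\<alpha>\<in>A - {i}. \<bar>real_of_int (l \<alpha>)\<bar>) = (\<Sum>\<alpha>\<in>A - {i}. real_of_int (l \<alpha>))"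
    using pos by (intro sum.cong refl) (simp add: less_imp_le)
  then have NL: "N = - l i" unfolding N_def sumA sB using i by simp
  have "(\<Sum>\<alpha>\<in>A. real_of_int (l \<alpha>) * m' \<alpha>) - (\<Sum>\<alpha>\<in>A. real_of_int (l \<alpha>) * m \<alpha>) = l i * (m' i - m i) + (\<Sum>\<alpha>\<in>A - {i}. real_of_int (l \<alpha>)) * c"
  proof -
    have "(\<Sum>\<alpha>\<in>A - {i}. real_of_int (l \<alpha>) * m' \<alpha>) = (\<Sum>\<alpha>\<in>A - {i}. real_of_int (l \<alpha>) * (m \<alpha> + c))"
      using c by (intro sum.cong refl) simp
    also have "\<dots> = (\<Sum>\<alpha>\<in>A - {i}. real_of_int (l \<alpha>) * m \<alpha>) + (\<Sum>\<alpha>\<in>A - {i}. real_of_int (l \<alpha>)) * c"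
      by (simp add: distrib_left sum.distrib sum_distrib_right)
    finally show ?thesis unfolding sumA by (simp add: algebra_simps)
  qed
  then have E: "(\<Sum>\<alpha>\<in>A. real_of_int (l \<alpha>) * m' \<alpha>) - (\<Sum>\<alpha>\<in>A. real_of_int (l \<alpha>) * m \<alpha>) =
      l i * (m' i - m i - c)"
    unfolding sB by (simp add: algebra_simps)
  have "Lam m' - Lam m = 2 * pi * (l i * (m' i - m i - c))"
    unfolding E[symmetric] by (simp add: Lam_def right_diff_distrib)
  moreover have "\<bar>Lam m' - Lam m\<bar> < 2 * pi * N" using Lam_bound[OF x] Lam_bound[OF y] by linarith
  ultimately have "\<bar>real_of_int (l i)\<bar> * \<bar>real_of_int (m' i - m i - c)\<bar> < \<bar>real_of_int (l i)\<bar> * 1"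
    using i NL by (simp add: abs_mult)
  then have "\<bar>real_of_int (m' i - m i - c)\<bar> < 1" using i by (subst (asm) mult_less_cancel_left_pos) auto
  then show ?thesis by linarith
qed

text \<open>Equal weights on an antipodal pair form a vanishing combination with zeros at
  \<open>p\<close> and at \<open>q\<close>, so \<open>mixed_zeros_in_closure_Coam\<close>
  applies.\<close>

lemma not_antipodal_on_Om:
  assumes x: "x \<in> Om" and \<alpha>\<beta>: "\<alpha> \<in> A" "\<beta> \<in> A" "\<alpha> \<noteq> \<beta>"
    and p: "p \<in> A - {\<alpha>, \<beta>}" "l p > 0" and q: "q \<in> A - {\<alpha>, \<beta>}" "l q < 0"
  shows "cos (u x \<alpha> - u x \<beta>) \<noteq> -1"
proof
  assume c: "cos (u x \<alpha> - u x \<beta>) = -1"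
  define t0 where "t0 \<delta> = (if \<delta> \<in> {\<alpha>, \<beta>} then 1 else 0 :: real)" for \<delta>
  have "sin (u x \<alpha> - u x \<beta>) = 0" using c sin_cos_squared_add[of "u x \<alpha> - u x \<beta>"] by simp
  then have "cis (u x \<alpha> - u x \<beta>) = -1" using c by (simp add: complex_eq_iff)
  then have "cis (u x \<alpha>) = - cis (u x \<beta>)" by (simp flip: cis_divide add: divide_eq_eq)
  moreover have "(\<Sum>\<delta>\<in>A. t0 \<delta> * cis (u x \<delta>)) = (\<Sum>\<delta>\<in>{\<alpha>, \<beta>}. cis (u x \<delta>))"
    using fin \<alpha>\<beta> by (intro sum.mono_neutral_cong_right) (auto simp: t0_def)
  ultimately have s: "(\<Sum>\<delta>\<in>A. t0 \<delta> * cis (u x \<delta>)) = 0" using \<alpha>\<beta>(3) by simp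
  have "x \<in> closure Coam"
    using p q \<alpha>\<beta> s by (intro mixed_zeros_in_closure_Coam[of t0 x \<alpha> p q]) (auto simp: t0_def)
  then show False using x by (simp add: Om_def)
qed

text \<open>The difference of two lifts can leave the interval from \<open>-pi\<close> to
  \<open>pi\<close> only through an antipodal position.\<close>

lemma lifts_preserved:
  assumes C: "connected C" "x \<in> C" "y \<in> C"
    and na: "\<And>z. z \<in> C \<Longrightarrow> cos (u z \<alpha> - u z \<beta>) \<noteq> -1"
    and x: "\<bar>u x \<alpha> + 2 * pi * m \<alpha> - (u x \<beta> + 2 * pi * m \<beta>)\<bar> < pi"
  shows "\<bar>u y \<alpha> + 2 * pi * of_int (m \<alpha>) - (u y \<beta> + 2 * pi * of_int (m \<beta>))\<bar> < pi"
proof (rule ccontr)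
  define f where "f z = u z \<alpha> + 2 * pi * m \<alpha> - (u z \<beta> + 2 * pi * m \<beta>)" for z
  assume "\<not> ?thesis"
  then have fy: "\<bar>f y\<bar> \<ge> pi" by (simp add: f_def)
  have fx: "\<bar>f x\<bar> < pi" using x by (simp add: f_def)
  have con: "connected (f ` C)" unfolding f_def using C(1) by (intro connected_continuous_image continuous_intros)
  have "\<exists>r\<in>{pi, -pi}. r \<in> f ` C"
  proof (cases "f y \<ge> pi")
    case True
    then have "pi \<in> f ` C" using connectedD_interval[OF con, of "f x" "f y" pi] C fx by auto
    then show ?thesis by blast
  next
    case False
    then have "-pi \<in> f ` C" using connectedD_interval[OF con, of "f y" "f x" "-pi"] C fx fy by auto
    then show ?thesis by blast
  qed
  then obtain z where z: "z \<in> C" "f z = pi \<or> f z = - pi" by force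
  have "cis (f z) = cis ((u z \<alpha> - u z \<beta>) + 2 * pi * of_int (m \<alpha> - m \<beta>))"
    unfolding f_def of_int_diff by (simp add: algebra_simps)
  then have "cos (f z) = cos (u z \<alpha> - u z \<beta>)" unfolding cis_shift_int by (simp add: complex_eq_iff)
  then show False using z na[OF z(1)] by auto
qed

lemma separation_edge:
  assumes C: "connected C" "C \<subseteq> Om" "x \<in> C" "y \<in> C" and x: "x \<in> P m" and y: "y \<in> P m'"
    and \<alpha>\<beta>: "\<alpha> \<in> A" "\<beta> \<in> A" "\<alpha> \<noteq> \<beta>"
    and p: "p \<in> A - {\<alpha>, \<beta>}" "l p > 0" and q: "q \<in> A - {\<alpha>, \<beta>}" "l q < 0"
  shows "m' \<alpha> - m \<alpha> = m' \<beta> - m \<beta>"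
proof (rule P_lifts_unique[OF y \<alpha>\<beta>(1,2)])
  show "\<bar>u y \<alpha> + 2 * pi * m \<alpha> - (u y \<beta> + 2 * pi * m \<beta>)\<bar> < pi"
  proof (rule lifts_preserved[OF C(1,3,4)])
    show "cos (u z \<alpha> - u z \<beta>) \<noteq> -1" if "z \<in> C" for z
      using not_antipodal_on_Om[OF _ \<alpha>\<beta> p q] that C(2) by blast
    show "\<bar>u x \<alpha> + 2 * pi * m \<alpha> - (u x \<beta> + 2 * pi * m \<beta>)\<bar> < pi"
      using x \<alpha>\<beta> by (auto simp: P_def)
  qed
qed


lemma sin_lift: "sin (u z \<alpha> + 2 * pi * of_int j - (u z \<beta> + 2 * pi * of_int k)) = sin (u z \<alpha> - u z \<beta>)"
proof -
  have "cis (u z \<alpha> + 2 * pi * of_int j - (u z \<beta> + 2 * pi * of_int k)) =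
      cis ((u z \<alpha> - u z \<beta>) + 2 * pi * of_int (j - k))"
    by (simp add: algebra_simps)
  then show ?thesis unfolding cis_shift_int by (simp add: complex_eq_iff)
qed

text \<open>For \<open>n = 1\<close> there are no edges to argue with. A direction triangle around the origin has
  a unique solution up to scaling, by the law of sines, and \<open>\<Phi>\<close> has the sign of \<open>h - \<gamma>\<close> on it.\<close>

lemma separation_three:
  fixes m m' :: "int ^ 'n \<Rightarrow> int"
  assumes A: "A = {i, p, q}" "i \<noteq> p" "i \<noteq> q" "p \<noteq> q" and sg: "l i < 0" "l p > 0" "l q > 0"
    and C: "connected C" "C \<subseteq> Om" "x \<in> C" "y \<in> C" and x: "x \<in> P m" and y: "y \<in> P m'"
  shows "\<exists>c. \<forall>\<alpha>\<in>A. m' \<alpha> = m \<alpha> + c"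
proof -
  define w where "w z \<alpha> = u z \<alpha> + 2 * pi * m \<alpha>" for z \<alpha>
  define X where "X z = w z p - w z i" for z
  define Y where "Y z = w z q - w z i" for z
  define D where "D z = w z p - w z q" for z
  have DXY: "D z = X z - Y z" for z by (simp add: D_def X_def Y_def)
  have cisw: "cis (w z \<alpha>) = cis (u z \<alpha>)" for z \<alpha> by (simp add: w_def)
  have sinw: "sin (w z \<alpha> - w z \<beta>) = sin (u z \<alpha> - u z \<beta>)" for z \<alpha> \<beta>
    unfolding w_def by (rule sin_lift)
  have sumA: "(\<Sum>\<alpha>\<in>A. f \<alpha>) = f i + (f p + f q)" for f :: "_ \<Rightarrow> 'z::comm_monoid_add"
    using A by simp
  have mem: "i \<in> A" "p \<in> A" "q \<in> A" using A(1) by auto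
  have Api: "\<alpha> = p \<or> \<alpha> = q" if "\<alpha> \<in> A - {i}" for \<alpha> using that A(1) by blast
  have sl: "- l i = l p + l q" using sum_l unfolding sumA by simp
  have sin_swap: "sin (w z \<alpha> - w z \<beta>) = - sin (w z \<beta> - w z \<alpha>)" for z \<alpha> \<beta>
    using sin_minus[of "w z \<beta> - w z \<alpha>"] by simp
  have nc: "\<not> (sin (X z) = 0 \<and> sin (Y z) = 0 \<and> sin (D z) = 0)" for z
  proof
    assume *: "sin (X z) = 0 \<and> sin (Y z) = 0 \<and> sin (D z) = 0"
    have "sin (u z \<alpha> - u z \<beta>) = 0" if "\<alpha> \<in> A" "\<beta> \<in> A" for \<alpha> \<beta>
      using that * sin_swap[of z i p] sin_swap[of z i q] sin_swap[of z q p]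
      unfolding A(1) sinw[symmetric] X_def Y_def D_def by auto
    then show False using not_collinear[of z] by blast
  qed
  have nXY: "\<not> (sin (X z) = 0 \<and> sin (Y z) = 0)" for z using nc[of z] by (auto simp: DXY sin_diff)
  have nXD: "\<not> (sin (X z) = 0 \<and> sin (D z) = 0)" for z
  proof
    assume *: "sin (X z) = 0 \<and> sin (D z) = 0"
    have "Y z = X z - D z" by (simp add: DXY)
    then have "sin (Y z) = 0" using * by (simp add: sin_diff)
    then show False using nc * by blast
  qed
  have nYD: "\<not> (sin (Y z) = 0 \<and> sin (D z) = 0)" for z
  proof
    assume *: "sin (Y z) = 0 \<and> sin (D z) = 0"
    have "X z = Y z + D z" by (simp add: DXY)
    then have "sin (X z) = 0" using * by (simp add: sin_add)
    then show False using nc * by blast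
  qed
  \<comment> \<open>Law of sines: the vanishing sum is projected onto the normals of the three
    directions in turn.\<close>
  have law: "t p * sin (D z) = t i * sin (Y z)" "t q * sin (D z) = - t i * sin (X z)"
    "t p * sin (X z) = - t q * sin (Y z)"
    if "(\<Sum>\<alpha>\<in>A. t \<alpha> * cis (u z \<alpha>)) = 0" for t :: "int ^ 'n \<Rightarrow> real" and z
  proof -
    have 0: "t i * sin (w z i - \<phi>) + (t p * sin (w z p - \<phi>) + t q * sin (w z q - \<phi>)) = 0" for \<phi>
    proof -
      have "0 = Im (cis (- \<phi>) * (\<Sum>\<alpha>\<in>A. t \<alpha> * cis (w z \<alpha>)))" unfolding cisw that by simp
      also have "\<dots> = (\<Sum>\<alpha>\<in>A. t \<alpha> * sin (w z \<alpha> - \<phi>))"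
        unfolding sum_distrib_left Im_sum by (intro sum.cong refl) (simp add: sin_diff algebra_simps)
      finally show ?thesis unfolding sumA by simp
    qed
    show "t p * sin (D z) = t i * sin (Y z)"
      using 0[of "w z q"] sin_swap[of z i q] by (simp add: D_def Y_def)
    show "t q * sin (D z) = - t i * sin (X z)"
      using 0[of "w z p"] sin_swap[of z i p] sin_swap[of z q p] by (simp add: D_def X_def)
    show "t p * sin (X z) = - t q * sin (Y z)"
      using 0[of "w z i"] by (simp add: X_def Y_def)
  qed
  define P' where "P' = nat (l p)"
  define Q' where "Q' = nat (l q)"
  have PQ: "real P' = l p" "real Q' = l q" "P' > 0" "Q' > 0" using sg by (simp_all add: P'_def Q'_def)
  have zp: "(0::real) ^ P' = 0" "(0::real) ^ Q' = 0" "(0::real) ^ (P' + Q') = 0"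
    using PQ by (simp_all add: zero_power)
  \<comment> \<open>By the law of sines the weights at \<open>p\<close>, \<open>q\<close>,
    \<open>i\<close> are proportional to the absolute sines of \<open>Y\<close>, \<open>X\<close>,
    \<open>D\<close>. Since \<open>- l i = l p + l q\<close>, exponentiating turns
    \<open>h = \<gamma>\<close> into equality of the two products, an expression that is also
    defined where no solution exists.\<close>
  define \<Phi> where "\<Phi> z = \<bar>sin (Y z)\<bar> ^ P' * \<bar>sin (X z)\<bar> ^ Q' - exp \<gamma> * \<bar>sin (D z)\<bar> ^ (P' + Q')" for z
  have cX: "continuous_on S X" "continuous_on S Y" "continuous_on S D" for S
    unfolding X_def Y_def D_def w_def by (intro continuous_intros)+
  have c\<Phi>: "continuous_on S \<Phi>" for S
    unfolding \<Phi>_def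
    by (intro continuous_on_diff continuous_on_mult continuous_on_power continuous_on_rabs
        continuous_on_sin continuous_on_const cX)
  have F2: "\<Phi> z \<noteq> 0" if zOm: "z \<in> Om" and Sz: "Sol z \<noteq> {}" for z
  proof
    assume 0: "\<Phi> z = 0"
    obtain t where t: "t \<in> Sol z" using Sz by blast
    have s: "(\<Sum>\<alpha>\<in>A. t \<alpha> * cis (u z \<alpha>)) = 0" using t by (simp add: Sol_def)
    have tp: "t i > 0" "t p > 0" "t q > 0" using t mem unfolding Sol_def by blast+
    have sD: "sin (D z) \<noteq> 0"
    proof
      assume "sin (D z) = 0"
      then show False using law(1)[OF s] tp nYD[of z] by simp
    qed
    define \<kappa> where "\<kappa> = \<bar>sin (D z)\<bar> / t i"
    have \<kappa>: "\<kappa> > 0" using sD tp by (simp add: \<kappa>_def)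
    have "t p * \<bar>sin (D z)\<bar> = t i * \<bar>sin (Y z)\<bar>" "t q * \<bar>sin (D z)\<bar> = t i * \<bar>sin (X z)\<bar>"
      using arg_cong[OF law(1)[OF s], of abs] arg_cong[OF law(2)[OF s], of abs] tp
      by (simp_all add: abs_mult)
    then have e: "\<bar>sin (Y z)\<bar> = \<kappa> * t p" "\<bar>sin (X z)\<bar> = \<kappa> * t q" "\<bar>sin (D z)\<bar> = \<kappa> * t i"
      using tp by (simp_all add: \<kappa>_def field_simps)
    have "(\<kappa> * t p) ^ P' * (\<kappa> * t q) ^ Q' = exp \<gamma> * (\<kappa> * t i) ^ (P' + Q')"
      using 0 unfolding \<Phi>_def e by simp
    then have "\<kappa> ^ (P' + Q') * (t p ^ P' * t q ^ Q') = \<kappa> ^ (P' + Q') * (exp \<gamma> * t i ^ (P' + Q'))"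
      by (simp add: power_mult_distrib power_add algebra_simps)
    then have "t p ^ P' * t q ^ Q' = exp \<gamma> * t i ^ (P' + Q')" using \<kappa> by simp
    then have "ln (t p ^ P' * t q ^ Q') = ln (exp \<gamma> * t i ^ (P' + Q'))" by simp
    then have "P' * ln (t p) + Q' * ln (t q) = \<gamma> + (P' + Q') * ln (t i)"
      using tp by (simp add: ln_mult ln_realpow)
    moreover have li: "real_of_int (l i) = - (l p + l q)" using sl by simp
    ultimately have "h t = \<gamma>" unfolding h_def sumA li by (simp add: PQ algebra_simps)
    then show False using not_in_Coam[OF zOm t] by simp
  qed
  \<comment> \<open>A region on which \<open>m\<close> is pinned down up to a constant. Where
    \<open>\<Phi>\<close> is negative, \<open>\<bar>D\<bar>\<close> cannot reach \<open>pi\<close>,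
    because there \<open>\<Phi> \<ge> 0\<close>; where it is positive, neither
    \<open>\<bar>X\<bar>\<close> nor \<open>\<bar>Y\<bar>\<close> can, because there
    \<open>\<Phi> \<le> 0\<close>. The cell itself covers points with \<open>\<Phi> = 0\<close>. The
    trace on \<open>C\<close> will be open and closed.\<close>
  define L0 where "L0 = {z. \<bar>D z\<bar> < pi \<and> \<Phi> z < 0} \<union> {z. \<bar>X z\<bar> < pi \<and> \<bar>Y z\<bar> < pi \<and> \<Phi> z > 0} \<union> P m"
  have openL0: "open L0"
    unfolding L0_def
    by (intro open_Un open_P open_Collect_conj open_Collect_less continuous_on_rabs continuous_on_const cX c\<Phi>)
  have PL: "\<bar>D z\<bar> < pi" "\<bar>X z\<bar> < pi" "\<bar>Y z\<bar> < pi" if "z \<in> P m" for z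
    using that mem unfolding P_def D_def X_def Y_def w_def by blast+
  have F3: "\<exists>c. \<forall>\<alpha>\<in>A. m'' \<alpha> = m \<alpha> + c" if z: "z \<in> P m''" "z \<in> L0" for z m''
  proof -
    consider "\<bar>D z\<bar> < pi" | "\<bar>X z\<bar> < pi" "\<bar>Y z\<bar> < pi"
      using z(2) PL(1)[of z] unfolding L0_def by blast
    then show ?thesis
    proof cases
      case 1
      then have pq: "m'' p - m p = m'' q - m q"
        by (intro P_lifts_unique[OF z(1) mem(2,3)]) (simp add: D_def w_def)
      have c: "m'' \<alpha> = m \<alpha> + (m'' p - m p)" if "\<alpha> \<in> A - {i}" for \<alpha>
        using Api[OF that] pq by (elim disjE) simp_all
      have "l \<alpha> > 0" if "\<alpha> \<in> A - {i}" for \<alpha> using Api[OF that] sg by (elim disjE) simp_all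
      then have "m'' i = m i + (m'' p - m p)"
        by (intro const_of_single_negative[OF x z(1) mem(1) sg(1) _ c])
      then show ?thesis using pq unfolding A(1) by (intro exI[of _ "m'' p - m p"]) simp
    next
      case 2
      have "m'' p - m p = m'' i - m i"
        using 2 by (intro P_lifts_unique[OF z(1) mem(2,1)]) (simp add: X_def w_def)
      moreover have "m'' q - m q = m'' i - m i"
        using 2 by (intro P_lifts_unique[OF z(1) mem(3,1)]) (simp add: Y_def w_def)
      ultimately show ?thesis unfolding A(1) by (intro exI[of _ "m'' i - m i"]) simp
    qed
  qed
  have F4: "z \<in> L0" if zOm: "z \<in> Om" and zc: "z \<in> closure L0" for z
  proof -
    have inter: "z \<in> closure (L0 \<inter> S)" if "open S" "z \<in> S" for S
      using open_Int_closure_subset[OF that(1), of L0] zc that(2) by (auto simp: Int_commute)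
    consider "\<Phi> z < 0" | "\<Phi> z > 0" | "\<Phi> z = 0" by linarith
    then show ?thesis
    proof cases
      case 1
      have "z \<in> closure (L0 \<inter> {z. \<Phi> z < 0})"
        by (intro inter open_Collect_less c\<Phi> continuous_on_const) (use 1 in auto)
      moreover have "L0 \<inter> {z. \<Phi> z < 0} \<subseteq> {z. \<bar>D z\<bar> \<le> pi}" using PL by (auto simp: L0_def less_imp_le)
      moreover have "closed {z. \<bar>D z\<bar> \<le> pi}" by (intro closed_Collect_le continuous_on_rabs continuous_on_const cX)
      ultimately have "\<bar>D z\<bar> \<le> pi" using closure_minimal by blast
      moreover have "\<bar>D z\<bar> \<noteq> pi"
      proof
        assume "\<bar>D z\<bar> = pi"
        then have "sin \<bar>D z\<bar> = 0" by simp
        then have "sin (D z) = 0" by (cases "D z \<ge> 0") auto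
        then have "\<Phi> z \<ge> 0" by (simp add: \<Phi>_def zp)
        then show False using 1 by simp
      qed
      ultimately show ?thesis using 1 by (simp add: L0_def)
    next
      case 2
      have "z \<in> closure (L0 \<inter> {z. \<Phi> z > 0})"
        by (intro inter open_Collect_less c\<Phi> continuous_on_const) (use 2 in auto)
      moreover have "L0 \<inter> {z. \<Phi> z > 0} \<subseteq> {z. \<bar>X z\<bar> \<le> pi \<and> \<bar>Y z\<bar> \<le> pi}" using PL by (auto simp: L0_def less_imp_le)
      moreover have "closed {z. \<bar>X z\<bar> \<le> pi \<and> \<bar>Y z\<bar> \<le> pi}" by (intro closed_Collect_conj closed_Collect_le continuous_on_rabs continuous_on_const cX)
      ultimately have "\<bar>X z\<bar> \<le> pi \<and> \<bar>Y z\<bar> \<le> pi" using closure_minimal by blast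
      moreover have "\<bar>X z\<bar> \<noteq> pi"
      proof
        assume "\<bar>X z\<bar> = pi"
        then have "sin \<bar>X z\<bar> = 0" by simp
        then have "sin (X z) = 0" by (cases "X z \<ge> 0") auto
        then have "\<Phi> z \<le> 0" by (simp add: \<Phi>_def zp)
        then show False using 2 by simp
      qed
      moreover have "\<bar>Y z\<bar> \<noteq> pi"
      proof
        assume "\<bar>Y z\<bar> = pi"
        then have "sin \<bar>Y z\<bar> = 0" by simp
        then have "sin (Y z) = 0" by (cases "Y z \<ge> 0") auto
        then have "\<Phi> z \<le> 0" by (simp add: \<Phi>_def zp)
        then show False using 2 by simp
      qed
      ultimately show ?thesis using 2 by (simp add: L0_def)
    next
      case 3
      \<comment> \<open>At a zero of \<open>\<Phi>\<close> in \<open>Om\<close> there is no solution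
        and no two directions are parallel. Then no vanishing combination exists at all, and the
        point lies in a cell; this cell meets \<open>L0\<close> and is therefore
        \<open>P m\<close>.\<close>
      then have Sz: "Sol z = {}" using F2[OF zOm] by blast
      have nonz: "sin (D z) \<noteq> 0" "sin (X z) \<noteq> 0" "sin (Y z) \<noteq> 0"
      proof -
        show D: "sin (D z) \<noteq> 0"
        proof
          assume "sin (D z) = 0"
          then have "\<bar>sin (Y z)\<bar> ^ P' * \<bar>sin (X z)\<bar> ^ Q' = 0" using 3 by (simp add: \<Phi>_def zp)
          then show False using \<open>sin (D z) = 0\<close> nXD[of z] nYD[of z] by auto
        qed
        show "sin (X z) \<noteq> 0" "sin (Y z) \<noteq> 0" using 3 D by (auto simp: \<Phi>_def zp)
      qed
      have "z \<in> Th"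
      proof (cases rule: half_plane_or_positive_combination[OF fin, of "u z"])
        case (1 \<phi>)
        then show ?thesis unfolding Th_iff_half_plane by blast
      next
        case (2 t)
        have tA: "t i \<ge> 0" "t p \<ge> 0" "t q \<ge> 0" using 2(1) mem by auto
        have "\<not> (t i > 0 \<and> t p > 0 \<and> t q > 0)"
        proof
          assume "t i > 0 \<and> t p > 0 \<and> t q > 0"
          then have "\<forall>\<alpha>\<in>A. t \<alpha> > 0" unfolding A(1) by blast
          then have "t \<in> Sol z" unfolding Sol_def using 2(3) by blast
          then show False using Sz by blast
        qed
        then have "t i = 0 \<or> t p = 0 \<or> t q = 0" using tA by linarith
        then have "t i = 0 \<and> t p = 0 \<and> t q = 0"
          using law[OF 2(3)] nonz by auto
        then show ?thesis using 2(2) A by auto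
      qed
      then obtain m'' where m'': "z \<in> P m''" by (auto simp: Th_def)
      have "z \<in> closure (L0 \<inter> P m'')" by (rule inter[OF open_P m''])
      then obtain z2 where "z2 \<in> L0" "z2 \<in> P m''" by (metis Int_emptyI closure_empty empty_iff)
      then obtain c where "\<forall>\<alpha>\<in>A. m'' \<alpha> = m \<alpha> + c" using F3 by blast
      then have "P m'' = P (\<lambda>\<alpha>. m \<alpha> + c)" by (intro P_cong) auto
      then show ?thesis using m'' P_shift by (auto simp: L0_def)
    qed
  qed
  have "C \<inter> L0 = C \<inter> closure L0" using F4 C(2) closure_subset[of L0] by blast
  then have "closedin (top_of_set C) (C \<inter> L0)" using closedin_closed_Int[of "closure L0" C] by simp
  moreover have "openin (top_of_set C) (C \<inter> L0)" by (rule openin_open_Int[OF openL0])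
  ultimately have "C \<inter> L0 = {} \<or> C \<inter> L0 = C" using C(1) unfolding connected_clopen by blast
  moreover have "x \<in> C \<inter> L0" using C(3) x by (simp add: L0_def)
  ultimately have "y \<in> L0" using C(4) by blast
  then show ?thesis using F3[OF y] by blast
qed

text \<open>With at least four indices, a pair of positive ones leaves \<open>i\<close> and a
  further positive index outside, so \<open>separation_edge\<close> applies; the value at
  \<open>i\<close> follows from \<open>const_of_single_negative\<close>. Three indices leave no such
  room and need \<open>separation_three\<close>.\<close>

lemma separation_single_negative:
  fixes m m' :: "int ^ 'n \<Rightarrow> int"
  assumes i: "i \<in> A" "l i < 0" and pos: "\<And>\<alpha>. \<alpha> \<in> A - {i} \<Longrightarrow> l \<alpha> > 0"
    and C: "connected C" "C \<subseteq> Om" "x \<in> C" "y \<in> C" and x: "x \<in> P m" and y: "y \<in> P m'"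
  shows "\<exists>c. \<forall>\<alpha>\<in>A. m' \<alpha> = m \<alpha> + c"
proof (cases "card A = 3")
  case True
  then have "card (A - {i}) = 2" using i fin by simp
  then obtain p q where pq: "A - {i} = {p, q}" "p \<noteq> q" by (meson card_2_iff)
  then have "A = {i, p, q}" "i \<noteq> p" "i \<noteq> q" using i by auto
  then show ?thesis using separation_three[of i p q C x y m m'] pq i pos C x y by auto
next
  case False
  then have c4: "card A \<ge> 4" using card_A zero_less_card_finite[where 'a = 'n] by linarith
  have eq: "m' \<alpha> - m \<alpha> = m' \<beta> - m \<beta>" if ab: "\<alpha> \<in> A - {i}" "\<beta> \<in> A - {i}" for \<alpha> \<beta>
  proof (cases "\<alpha> = \<beta>")
    case False
    have "\<not> A \<subseteq> {i, \<alpha>, \<beta>}"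
    proof
      assume "A \<subseteq> {i, \<alpha>, \<beta>}"
      then have "card A \<le> card {i, \<alpha>, \<beta>}" by (intro card_mono) auto
      also have "\<dots> \<le> 3" by (simp add: card_insert_if)
      finally show False using c4 by simp
    qed
    then obtain p where p: "p \<in> A" "p \<notin> {i, \<alpha>, \<beta>}" by blast
    show ?thesis
      using ab p i pos[of p] False by (intro separation_edge[OF C x y, of \<alpha> \<beta> p i]) auto
  qed simp
  have "\<not> A \<subseteq> {i}"
  proof
    assume "A \<subseteq> {i}"
    then have "card A \<le> card {i}" by (intro card_mono) auto
    then show False using c4 by simp
  qed
  then obtain o' where o: "o' \<in> A - {i}" by auto
  have B: "m' \<alpha> = m \<alpha> + (m' o' - m o')" if "\<alpha> \<in> A - {i}" for \<alpha>
    using eq[OF that o] by simp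
  then have "m' i = m i + (m' o' - m o')"
    by (intro const_of_single_negative[OF x y i pos])
  then show ?thesis using B by (intro exI[of _ "m' o' - m o'"]) auto
qed

text \<open>With two indices of each sign, every pair of opposite signs leaves both signs outside
  it, and \<open>separation_edge\<close> along the complete bipartite graph between the signs fixes
  \<open>m' - m\<close>. Otherwise one sign occurs only once, and changing the sign of
  \<open>l\<close> if necessary makes it the negative one.\<close>

lemma separation:
  fixes m m' :: "int ^ 'n \<Rightarrow> int"
  assumes C: "connected C" "C \<subseteq> Om" "x \<in> C" "y \<in> C" and x: "x \<in> P m" and y: "y \<in> P m'"
  shows "\<exists>c. \<forall>\<alpha>\<in>A. m' \<alpha> = m \<alpha> + c"
proof -
  interpret F: phased_circuit A "\<lambda>\<alpha>. - l \<alpha>" b a "- \<gamma>" by (rule flip)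
  have FOm: "F.Om = Om" unfolding Om_def F.Om_def flip_Coam ..
  have "\<exists>i\<in>A. l i < 0"
  proof (rule ccontr)
    assume "\<not> ?thesis"
    then have "\<forall>\<alpha>\<in>A. l \<alpha> > 0" using l_nonzero by force
    then have "(\<Sum>\<alpha>\<in>A. l \<alpha>) > 0" using fin A_nonempty by (intro sum_pos) auto
    then show False using sum_l by simp
  qed
  then obtain i where i: "i \<in> A" "l i < 0" by blast
  have "\<exists>j\<in>A. l j > 0"
  proof (rule ccontr)
    assume "\<not> ?thesis"
    then have "\<forall>\<alpha>\<in>A. - l \<alpha> > 0" using l_nonzero by force
    then have "(\<Sum>\<alpha>\<in>A. - l \<alpha>) > 0" using fin A_nonempty by (intro sum_pos) auto
    then show False using sum_l by (simp add: sum_negf)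
  qed
  then obtain j where j: "j \<in> A" "l j > 0" by blast
  consider "\<forall>\<alpha>\<in>A - {i}. l \<alpha> > 0" | "\<forall>\<alpha>\<in>A - {j}. l \<alpha> < 0"
    | i' j' where "i' \<in> A - {i}" "l i' < 0" "j' \<in> A - {j}" "l j' > 0"
    using l_nonzero by (metis DiffD1 linorder_neqE)
  then show ?thesis
  proof cases
    case 1
    then show ?thesis using separation_single_negative[OF i _ C x y] by blast
  next
    case 2
    then show ?thesis using F.separation_single_negative[of j C x y m m'] j C x y unfolding FOm by auto
  next
    case 3
    have eq: "m' \<alpha> - m \<alpha> = m' \<beta> - m \<beta>" if ab: "\<alpha> \<in> A" "l \<alpha> > 0" "\<beta> \<in> A" "l \<beta> < 0" for \<alpha> \<beta>
    proof -
      have "\<exists>p. p \<in> A - {\<alpha>, \<beta>} \<and> l p > 0" 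
        using 3 j ab by (intro exI[of _ "if \<alpha> = j then j' else j"]) (auto split: if_splits)
      moreover have "\<exists>q. q \<in> A - {\<alpha>, \<beta>} \<and> l q < 0" 
        using 3 i ab by (intro exI[of _ "if \<beta> = i then i' else i"]) (auto split: if_splits)
      ultimately obtain p q where "p \<in> A - {\<alpha>, \<beta>}" "l p > 0" "q \<in> A - {\<alpha>, \<beta>}" "l q < 0" by blast
      then show ?thesis using ab by (intro separation_edge[OF C x y, of \<alpha> \<beta> p q]) auto
    qed
    have "m' \<alpha> = m \<alpha> + (m' i - m i)" if "\<alpha> \<in> A" for \<alpha>
    proof (cases "l \<alpha> > 0")
      case True
      then show ?thesis using eq[OF that True i] by simp
    next
      case False
      then have "l \<alpha> < 0" using l_nonzero[OF that] by simp
      then show ?thesis using eq[OF j that] eq[OF j i] by simp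
    qed
    then show ?thesis by blast
  qed
qed

end

section \<open>Cosets of a full rank lattice\<close>

text \<open>Cut \<open>F\<close> along the translates of \<open>G\<close> and move each piece back
  by its translation vector: the pieces reassemble to \<open>G\<close>.\<close>

lemma emeasure_fundamental_domain:
  fixes F G :: "'a::euclidean_space set"
  assumes V: "countable V" "\<And>v. v \<in> V \<Longrightarrow> - v \<in> V"
    and F: "F \<in> sets lebesgue" "\<And>x. \<exists>!v. v \<in> V \<and> x - v \<in> F"
    and G: "G \<in> sets lebesgue" "\<And>x. \<exists>!v. v \<in> V \<and> x - v \<in> G"
  shows "emeasure lebesgue F = emeasure lebesgue G"
proof -
  have tr: "emeasure lebesgue ((+) a ` S) = emeasure lebesgue S" for a and S :: "'a set"
    using emeasure_lebesgue_affine[of 1 a S] by (simp add: add.commute)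
  have mt: "(+) a ` S \<in> sets lebesgue" if "S \<in> sets lebesgue" for a and S :: "'a set"
    using lebesgue_sets_translation[OF that] by simp
  have im: "x \<in> (+) a ` S \<longleftrightarrow> x - a \<in> S" for x a and S :: "'a set"
    by (metis (no_types, lifting) add.commute diff_add_cancel imageE image_eqI add_diff_cancel_left')
  have F1: "F = (\<Union>v\<in>V. F \<inter> (+) v ` G)"
    using G(2) by (fastforce simp: im)
  have G1: "G = (\<Union>v\<in>V. G \<inter> (+) v ` F)"
    using F(2) by (fastforce simp: im)
  have uF: "v = v'" if "v \<in> V" "v' \<in> V" "x - v \<in> F" "x - v' \<in> F" for x v v'
    using F(2)[of x] that by blast
  have uG: "v = v'" if "v \<in> V" "v' \<in> V" "x - v \<in> G" "x - v' \<in> G" for x v v'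
    using G(2)[of x] that by blast
  have dF: "disjoint_family_on (\<lambda>v. F \<inter> (+) v ` G) V"
    unfolding disjoint_family_on_def using uG by (simp add: disjoint_iff im) blast
  have dG: "disjoint_family_on (\<lambda>v. G \<inter> (+) v ` F) V"
    unfolding disjoint_family_on_def using uF by (simp add: disjoint_iff im) blast
  have "emeasure lebesgue F = (\<integral>\<^sup>+v. emeasure lebesgue (F \<inter> (+) v ` G) \<partial>count_space V)"
    by (subst F1, rule emeasure_UN_countable)
       (use V F(1) G(1) mt dF in \<open>auto intro: sets.Int\<close>)
  also have "\<dots> = (\<integral>\<^sup>+v. emeasure lebesgue (G \<inter> (+) (- v) ` F) \<partial>count_space V)"
  proof (rule nn_integral_cong)
    fix v
    have "(+) (-v) ` (F \<inter> (+) v ` G) = G \<inter> (+) (- v) ` F"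
      by (auto simp: im)
    then show "emeasure lebesgue (F \<inter> (+) v ` G) = emeasure lebesgue (G \<inter> (+) (- v) ` F)"
      using tr[of "-v" "F \<inter> (+) v ` G"] by simp
  qed
  also have "\<dots> = (\<integral>\<^sup>+v. emeasure lebesgue (G \<inter> (+) v ` F) \<partial>count_space V)"
    by (rule nn_integral_bij_count_space)
       (use V(2) in \<open>auto intro!: bij_betwI[of _ _ _ uminus]\<close>)
  also have "\<dots> = emeasure lebesgue G"
    by (subst (2) G1, rule emeasure_UN_countable[symmetric])
       (use V F(1) G(1) mt dG in \<open>auto intro: sets.Int\<close>)
  finally show ?thesis .
qed

definition mreal :: "int ^ 'n ^ 'm \<Rightarrow> real ^ 'n ^ 'm" where
  "mreal D = (\<chi> i j. real_of_int (D $ i $ j))"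

text \<open>Half-open, so that the integer translates tile space without overlap.\<close>

definition unit_cell :: "(real ^ 'm) set" where
  "unit_cell = {x. \<forall>i. 0 \<le> x $ i \<and> x $ i < 1}"

lemma vreal_add: "vreal (x + y) = vreal x + vreal y"
  and vreal_diff: "vreal (x - y) = vreal x - vreal y"
  and vreal_mult: "vreal (D *v x) = mreal D *v vreal x"
  and vreal_inject: "vreal x = vreal y \<longleftrightarrow> x = y"
  by (simp_all add: vreal_def mreal_def vec_eq_iff matrix_vector_mult_def)

lemma measure_unit_cell: "(unit_cell :: (real ^ 'm) set) \<in> lmeasurable" "measure lebesgue (unit_cell :: (real ^ 'm) set) = 1"
proof -
  have b: "box 0 1 \<subseteq> (unit_cell :: (real ^ 'm) set)" "(unit_cell :: (real ^ 'm) set) \<subseteq> cbox 0 1"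
    by (auto simp: unit_cell_def mem_box_cart less_imp_le)
  have conv: "convex (unit_cell :: (real ^ 'm) set)"
    unfolding unit_cell_def
  proof (intro convexI; safe)
    fix x y :: "real ^ 'm" and u v :: real and i
    assume *: "\<forall>i. 0 \<le> x $ i \<and> x $ i < 1" "\<forall>i. 0 \<le> y $ i \<and> y $ i < 1" "0 \<le> u" "0 \<le> v" "u + v = 1"
    show "0 \<le> (u *\<^sub>R x + v *\<^sub>R y) $ i" using * by simp
    show "(u *\<^sub>R x + v *\<^sub>R y) $ i < 1" using * convex_bound_lt[of "x $ i" 1 "y $ i" u v] by simp
  qed
  have bdd: "bounded (unit_cell :: (real ^ 'm) set)" using b(2) bounded_cbox bounded_subset by blast
  show m: "(unit_cell :: (real ^ 'm) set) \<in> lmeasurable" using conv bdd by (rule measurable_convex)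
  have "measure lebesgue (box 0 1 :: (real ^ 'm) set) = 1"
    "measure lebesgue (cbox 0 1 :: (real ^ 'm) set) = 1"
    by (auto simp: measure_lborel_box_eq measure_lborel_cbox_eq intro!: prod.neutral simp: Basis_vec_def inner_axis)
  moreover have "measure lebesgue (box 0 1 :: (real ^ 'm) set) \<le> measure lebesgue (unit_cell :: (real ^ 'm) set)"
    using b m by (intro measure_mono_fmeasurable) auto
  moreover have "measure lebesgue (unit_cell :: (real ^ 'm) set) \<le> measure lebesgue (cbox 0 1 :: (real ^ 'm) set)"
    using b m by (intro measure_mono_fmeasurable) auto
  ultimately show "measure lebesgue (unit_cell :: (real ^ 'm) set) = 1" by simp
qed

lemma unit_cell_unique: "\<exists>!v. v \<in> range vreal \<and> x - v \<in> (unit_cell :: (real ^ 'm) set)"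
proof (rule ex1I)
  show "vreal (\<chi> i. \<lfloor>x $ i\<rfloor>) \<in> range vreal \<and> x - vreal (\<chi> i. \<lfloor>x $ i\<rfloor>) \<in> unit_cell"
    by (intro conjI image_eqI[of _ _ "\<chi> i. \<lfloor>x $ i\<rfloor>"]) (auto simp: unit_cell_def vreal_def, linarith)
  fix v assume "v \<in> range vreal \<and> x - v \<in> unit_cell"
  then obtain y where y: "v = vreal y" "\<And>i. 0 \<le> x $ i - y $ i \<and> x $ i - y $ i < 1"
    by (auto simp: unit_cell_def vreal_def)
  have "\<lfloor>x $ i\<rfloor> = y $ i" for i using y(2)[of i] by (simp add: floor_unique)
  then show "v = vreal (\<chi> i. \<lfloor>x $ i\<rfloor>)" by (simp add: y(1) vreal_def)
qed

text \<open>The parallelepiped \<open>F\<close> spanned by \<open>D\<close> and the union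
  \<open>G\<close> of the unit cells at the integer points of \<open>F\<close> are fundamental
  domains of the same lattice. The first has measure \<open>\<bar>det (mreal D)\<bar>\<close>; the
  measure of the second is the number of integer points in \<open>F\<close>, which represent the
  cosets.\<close>

lemma card_lattice_cosets:
  fixes D :: "((int, 'm) vec, 'm::{finite,wellorder}) vec"
  assumes det: "det (mreal D) \<noteq> 0"
  defines "coset \<equiv> \<lambda>y. range (\<lambda>a. y + D *v a)"
  shows "finite (range coset)" "real (card (range coset)) = \<bar>det (mreal D)\<bar>"
proof -
  let ?R = "mreal D"
  define F where "F = (*v) ?R ` unit_cell"
  have lin: "linear ((*v) ?R)" by simp
  obtain B where B: "B ** ?R = mat 1" "?R ** B = mat 1"
    using det by (metis invertible_def invertible_det_nz)
  have BR: "B *v (?R *v x) = x" "?R *v (B *v x) = x" for x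
    by (simp_all add: matrix_vector_mul_assoc B)
  have Fm: "F \<in> lmeasurable" "measure lebesgue F = \<bar>det ?R\<bar>"
    unfolding F_def using lin
    by (rule measurable_linear_image[OF _ measure_unit_cell(1)])
       (simp add: measure_linear_image[OF _ measure_unit_cell(1)] measure_unit_cell(2))
  have memF: "x \<in> F \<longleftrightarrow> B *v x \<in> unit_cell" for x
  proof
    assume "x \<in> F"
    then show "B *v x \<in> unit_cell" by (auto simp: F_def BR)
  next
    assume "B *v x \<in> unit_cell"
    then show "x \<in> F" unfolding F_def by (rule image_eqI[rotated]) (simp add: BR)
  qed
  define V where "V = range (\<lambda>a. ?R *v vreal a)"
  have V1: "countable V" unfolding V_def by simp
  have V2: "- v \<in> V" if v: "v \<in> V" for v
  proof -
    obtain a where "v = ?R *v vreal a" using v by (auto simp: V_def)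
    then have "- v = ?R *v vreal (- a)"
      by (simp add: vreal_def matrix_vector_mult_def vec_eq_iff sum_negf)
    then show ?thesis by (auto simp: V_def)
  qed
  have F1: "\<exists>!v. v \<in> V \<and> x - v \<in> F" for x
  proof -
    obtain v where v: "v \<in> range vreal" "B *v x - v \<in> unit_cell"
      and u: "\<And>v'. v' \<in> range vreal \<Longrightarrow> B *v x - v' \<in> unit_cell \<Longrightarrow> v' = v"
      using unit_cell_unique[of "B *v x"] by blast
    show ?thesis
    proof (rule ex1I[of _ "?R *v v"])
      show "?R *v v \<in> V \<and> x - ?R *v v \<in> F"
        using v by (auto simp: V_def memF matrix_vector_mult_diff_distrib BR)
      fix v' assume v': "v' \<in> V \<and> x - v' \<in> F"
      then obtain a where a: "v' = ?R *v vreal a" by (auto simp: V_def)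
      then have "vreal a = v" using u[of "vreal a"] v' by (simp add: memF matrix_vector_mult_diff_distrib BR)
      then show "v' = ?R *v v" using a by simp
    qed
  qed
  define Y where "Y = {y. vreal y \<in> F}"
  have Yfin: "finite Y"
  proof -
    have "bounded F"
      unfolding F_def using lin
      by (intro bounded_linear_image linear_conv_bounded_linear[THEN iffD1] bounded_subset[OF bounded_cbox[of 0 1]])
         (auto simp: unit_cell_def mem_box_cart less_imp_le)
    then obtain K where K: "\<And>x. x \<in> F \<Longrightarrow> norm x \<le> K" by (auto simp: bounded_iff)
    have "Y \<subseteq> vec_lambda ` (PiE UNIV (\<lambda>_. {-\<lceil>K\<rceil>..\<lceil>K\<rceil>}))"
    proof
      fix y assume y: "y \<in> Y"
      have "\<bar>real_of_int (y $ i)\<bar> \<le> K" for i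
        using component_le_norm_cart[of "vreal y" i] K[of "vreal y"] y by (auto simp: Y_def vreal_def)
      then have "y $ i \<in> {-\<lceil>K\<rceil>..\<lceil>K\<rceil>}" for i
        by (smt (verit) atLeastAtMost_iff le_of_int_ceiling of_int_le_iff of_int_minus)
      then show "y \<in> vec_lambda ` (PiE UNIV (\<lambda>_. {-\<lceil>K\<rceil>..\<lceil>K\<rceil>}))"
        by (intro image_eqI[of _ _ "vec_nth y"]) auto
    qed
    then show ?thesis by (rule finite_subset) (intro finite_imageI finite_PiE; simp)
  qed
  have coset_eq: "coset y = coset y' \<longleftrightarrow> (\<exists>a. y = y' + D *v a)" for y y'
  proof
    assume "coset y = coset y'"
    moreover have "y \<in> coset y" unfolding coset_def by (intro image_eqI[of _ _ 0]) auto
    ultimately show "\<exists>a. y = y' + D *v a" by (auto simp: coset_def)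
  next
    assume "\<exists>a. y = y' + D *v a"
    then obtain a where a: "y = y' + D *v a" ..
    show "coset y = coset y'"
    proof
      show "coset y \<subseteq> coset y'"
        unfolding coset_def a by (auto simp: add.assoc simp flip: matrix_vector_mult_add_rdistrib matrix_vector_right_distrib)
      show "coset y' \<subseteq> coset y"
        unfolding coset_def a
      proof safe
        fix b
        have "y' + D *v b = y' + D *v a + D *v (b - a)"
          by (simp add: add.assoc flip: matrix_vector_right_distrib)
        then show "y' + D *v b \<in> range (\<lambda>b. y' + D *v a + D *v b)" by blast
      qed
    qed
  qed
  have bij: "bij_betw coset Y (range coset)"
    unfolding bij_betw_def
  proof
    show "inj_on coset Y"
    proof
      fix y y' assume y: "y \<in> Y" "y' \<in> Y" "coset y = coset y'"
      then obtain a where a: "y = y' + D *v a" using coset_eq by blast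
      have "vreal y - ?R *v vreal a \<in> F" "?R *v vreal a \<in> V"
        using y(2) by (auto simp: a vreal_add vreal_mult Y_def V_def)
      moreover have "vreal y - 0 \<in> F" "0 \<in> V"
      proof -
        show "vreal y - 0 \<in> F" using y(1) by (auto simp: Y_def)
        have "?R *v vreal 0 = 0" by (simp add: vreal_def matrix_vector_mult_def vec_eq_iff)
        then show "0 \<in> V" unfolding V_def by (metis rangeI)
      qed
      ultimately have "?R *v vreal a = 0" using F1[of "vreal y"] by blast
      then show "y = y'" using a by (metis vreal_inject vreal_add vreal_mult add.right_neutral)
    qed
    show "coset ` Y = range coset"
    proof safe
      fix y
      obtain a where "vreal y - ?R *v vreal a \<in> F" using F1[of "vreal y"] by (auto simp: V_def)
      then have "y - D *v a \<in> Y" by (simp add: Y_def vreal_diff vreal_mult)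
      moreover have "coset y = coset (y - D *v a)" unfolding coset_eq by (intro exI[of _ a]) simp
      ultimately show "coset y \<in> coset ` Y" by blast
    qed auto
  qed
  then show "finite (range coset)" using Yfin bij_betw_finite by blast
  define G where "G = (\<Union>y\<in>Y. (+) (vreal y) ` unit_cell)"
  have im: "x \<in> (+) a ` S \<longleftrightarrow> x - a \<in> S" for x a and S :: "((real, 'm) vec) set"
    by (metis (no_types, lifting) add.commute diff_add_cancel imageE image_eqI add_diff_cancel_left')
  have mG: "(+) (vreal y) ` unit_cell \<in> lmeasurable"
    "measure lebesgue ((+) (vreal y) ` unit_cell) = 1" for y :: "(int, 'm) vec"
    by (rule measurable_translation[OF measure_unit_cell(1)])
       (simp add: measure_translation measure_unit_cell(2))
  have "measure lebesgue G = (\<Sum>y\<in>Y. measure lebesgue ((+) (vreal y) ` unit_cell))"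
    unfolding G_def
  proof (rule measure_negligible_finite_Union_image[OF Yfin mG(1)])
    show "pairwise (\<lambda>x y. negligible ((+) (vreal x) ` unit_cell \<inter> (+) (vreal y) ` unit_cell)) Y"
    proof (intro pairwiseI)
      fix y y' assume "y \<in> Y" "y' \<in> Y" "y \<noteq> y'"
      have "y = y'" if z: "z - vreal y \<in> unit_cell" "z - vreal y' \<in> unit_cell" for z
      proof -
        have "vreal y = vreal y'" using unit_cell_unique[of z] z by blast
        then show ?thesis by (simp add: vreal_inject)
      qed
      with \<open>y \<noteq> y'\<close> have "(+) (vreal y) ` unit_cell \<inter> (+) (vreal y') ` unit_cell = {}"
        unfolding disjoint_iff im by blast
      then show "negligible ((+) (vreal y) ` unit_cell \<inter> (+) (vreal y') ` unit_cell)" by simp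
    qed
  qed
  then have Gcard: "measure lebesgue G = card Y" by (simp add: mG)
  have Gm: "G \<in> lmeasurable" unfolding G_def using Yfin mG(1) by (intro fmeasurable.finite_UN) auto
  have G1: "\<exists>!v. v \<in> V \<and> x - v \<in> G" for x
  proof -
    obtain y where y: "x - vreal y \<in> unit_cell" and uy: "\<And>y'. x - vreal y' \<in> unit_cell \<Longrightarrow> y' = y"
      using unit_cell_unique[of x] vreal_inject by (metis rangeE rangeI)
    obtain v where v: "v \<in> V" "vreal y - v \<in> F" and uv: "\<And>v'. v' \<in> V \<Longrightarrow> vreal y - v' \<in> F \<Longrightarrow> v' = v"
      using F1[of "vreal y"] by blast
    have *: "x - v' \<in> G \<longleftrightarrow> vreal y - v' \<in> F" if v': "v' \<in> V" for v'
    proof -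
      obtain a where a: "v' = vreal (D *v a)" using v' by (auto simp: V_def vreal_mult)
      have "x - v' \<in> G \<longleftrightarrow> (\<exists>z\<in>Y. x - vreal (z + D *v a) \<in> unit_cell)"
        unfolding G_def UN_iff im a vreal_add by (simp add: diff_diff_eq add.commute)
      also have "\<dots> \<longleftrightarrow> (\<exists>z\<in>Y. z + D *v a = y)" using y uy by blast
      also have "\<dots> \<longleftrightarrow> y - D *v a \<in> Y" by (metis add_diff_cancel diff_add_cancel)
      finally show ?thesis by (simp add: Y_def vreal_diff a)
    qed
    show ?thesis using v uv * by blast
  qed
  have "emeasure lebesgue F = emeasure lebesgue G"
    using V1 V2 Fm(1) Gm F1 G1 by (intro emeasure_fundamental_domain[of V]) auto
  then have "measure lebesgue F = measure lebesgue G" by (simp add: measure_def)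
  then show "real (card (range coset)) = \<bar>det (mreal D)\<bar>"
    using Fm(2) Gcard bij_betw_same_card[OF bij] by simp
qed

section \<open>Simplex volumes over an unordered index type\<close>

text \<open>The library volume formula \<open>content_simplex\<close> needs an index type of class \<open>wellorder\<close>, whereas
  the coordinates of the theorem are indexed by an arbitrary finite type.\<close>

typedef 'a wellordered = "UNIV :: 'a set" ..

instance wellordered :: (finite) finite
proof
  show "finite (UNIV :: 'a wellordered set)"
    by (rule finite_imageD[where f = Rep_wellordered]) (simp_all add: inj_on_def Rep_wellordered_inject)
qed

lemma CARD_wellordered: "CARD('a wellordered) = CARD('a)"
  using type_definition.card[OF type_definition_wellordered] by simp

definition wo_index :: "'a::finite wellordered \<Rightarrow> nat" where
  "wo_index = (SOME f. inj f)"

lemma inj_wo_index: "inj (wo_index :: 'a::finite wellordered \<Rightarrow> nat)"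
proof -
  have "\<exists>f :: 'a wellordered \<Rightarrow> nat. inj f"
    using finite_imp_inj_to_nat_seg[of "UNIV :: 'a wellordered set"] by auto
  then show ?thesis unfolding wo_index_def by (rule someI_ex)
qed

instantiation wellordered :: (finite) wellorder
begin

definition less_eq_wellordered :: "'a wellordered \<Rightarrow> 'a wellordered \<Rightarrow> bool" where
  "less_eq_wellordered x y \<longleftrightarrow> wo_index x \<le> wo_index y"

definition less_wellordered :: "'a wellordered \<Rightarrow> 'a wellordered \<Rightarrow> bool" where
  "less_wellordered x y \<longleftrightarrow> wo_index x < wo_index y"

instance
proof
  fix P :: "'a wellordered \<Rightarrow> bool" and a :: "'a wellordered"
  assume H: "\<And>x. (\<And>y. y < x \<Longrightarrow> P y) \<Longrightarrow> P x"
  show "P a"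
  proof (induction a rule: measure_induct_rule[of wo_index])
    case (less x)
    show ?case by (rule H, rule less) (simp add: less_wellordered_def)
  qed
next
  fix x y :: "'a wellordered"
  assume "x \<le> y" "y \<le> x"
  then have "wo_index x = wo_index y" by (simp add: less_eq_wellordered_def)
  then show "x = y" by (rule injD[OF inj_wo_index])
qed (auto simp: less_eq_wellordered_def less_wellordered_def)

end

definition relabel :: "'b ^ 'n \<Rightarrow> 'b ^ 'n wellordered" where
  "relabel x = (\<chi> i. x $ Rep_wellordered i)"

lemma relabel_nth [simp]: "relabel x $ i = x $ Rep_wellordered i"
  by (simp add: relabel_def)

lemma all_wellordered: "(\<forall>i. P (Rep_wellordered i)) \<longleftrightarrow> (\<forall>i. P i)"
proof
  assume *: "\<forall>i. P (Rep_wellordered i)"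
  show "\<forall>i. P i"
  proof
    fix i
    have "P (Rep_wellordered (Abs_wellordered i))" using * by blast
    then show "P i" by (simp add: Abs_wellordered_inverse)
  qed
qed blast

lemma linear_relabel: "linear (relabel :: real ^ 'n \<Rightarrow> _)"
  by (intro linearI) (auto simp: vec_eq_iff)

text \<open>Lebesgue measure is determined by its values on boxes, and relabelling the coordinates
  only permutes the side lengths of a box.\<close>

lemma measure_relabel:
  fixes S :: "(real ^ 'n) set"
  assumes "compact S"
  shows "measure lebesgue (relabel ` S) = measure lebesgue S"
proof -
  let ?r = "relabel :: real ^ 'n \<Rightarrow> real ^ 'n wellordered"
  define g :: "real ^ 'n wellordered \<Rightarrow> real ^ 'n" where "g y = (\<chi> i. y $ Abs_wellordered i)" for y
  have gr: "g (?r x) = x" for x by (simp add: g_def vec_eq_iff Abs_wellordered_inverse)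
  have rg: "?r (g x) = x" for x by (simp add: g_def vec_eq_iff Rep_wellordered_inverse)
  have ling: "linear g" by (intro linearI) (auto simp: g_def vec_eq_iff)
  have meas: "?r \<in> borel_measurable borel"
    by (intro borel_measurable_continuous_onI linear_continuous_on linear_relabel
         linear_conv_bounded_linear[THEN iffD1])
  have "lborel = distr lborel borel ?r"
  proof (rule lborel_eqI)
    fix l u :: "real ^ 'n wellordered"
    assume *: "\<And>b. b \<in> Basis \<Longrightarrow> l \<bullet> b \<le> u \<bullet> b"
    have le: "l $ i \<le> u $ i" for i using *[of "axis i 1"] by (auto simp: Basis_vec_def cart_eq_inner_axis)
    have "?r -` box l u = box (g l) (g u)"
    proof -
      have "(\<forall>i. l $ i < x $ Rep_wellordered i \<and> x $ Rep_wellordered i < u $ i) \<longleftrightarrow>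
        (\<forall>i. l $ Abs_wellordered i < x $ i \<and> x $ i < u $ Abs_wellordered i)" for x :: "real ^ 'n"
        using all_wellordered[of "\<lambda>i. l $ Abs_wellordered i < x $ i \<and> x $ i < u $ Abs_wellordered i"]
        by (simp add: Rep_wellordered_inverse)
      then show ?thesis by (auto simp: mem_box_cart g_def)
    qed
    then have "emeasure (distr lborel borel ?r) (box l u) = emeasure lborel (box (g l) (g u))"
      using meas by (simp add: emeasure_distr)
    also have "\<dots> = ennreal (\<Prod>b\<in>Basis. (g u - g l) \<bullet> b)"
    proof -
      have "g l \<bullet> b \<le> g u \<bullet> b" if "b \<in> Basis" for b
        using that le by (auto simp: Basis_vec_def g_def simp flip: cart_eq_inner_axis)
      then show ?thesis by (simp add: emeasure_lborel_box_eq)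
    qed
    also have "(\<Prod>b\<in>Basis. (g u - g l) \<bullet> b) = (\<Prod>i\<in>UNIV. (g u - g l) $ i)"
      by (simp add: Basis_vec_def cart_eq_inner_axis axis_eq_axis prod.UNION_disjoint)
    also have "\<dots> = (\<Prod>i\<in>UNIV. (u - l) $ i)"
      by (rule prod.reindex_bij_witness[of _ Rep_wellordered Abs_wellordered])
         (auto simp: g_def Abs_wellordered_inverse Rep_wellordered_inverse)
    also have "\<dots> = (\<Prod>b\<in>Basis. (u - l) \<bullet> b)"
      by (simp add: Basis_vec_def cart_eq_inner_axis axis_eq_axis prod.UNION_disjoint)
    finally show "emeasure (distr lborel borel ?r) (box l u) = (\<Prod>b\<in>Basis. (u - l) \<bullet> b)" .
  qed simp
  moreover have c: "compact (?r ` S)"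
    using assms linear_relabel
    by (intro compact_continuous_image linear_continuous_on linear_conv_bounded_linear[THEN iffD1])
  have "emeasure (distr lborel borel ?r) (?r ` S) = emeasure lborel S"
  proof -
    have "?r -` ?r ` S = S" using gr by (metis inj_onI inj_vimage_image_eq)
    then show ?thesis using meas c by (subst emeasure_distr) (auto simp: compact_imp_closed)
  qed
  ultimately have "emeasure lborel (?r ` S) = emeasure lborel S" by simp
  moreover have "emeasure lebesgue (?r ` S) = emeasure lborel (?r ` S)"
    "emeasure lebesgue S = emeasure lborel S"
    using c assms by (simp_all add: borel_compact)
  ultimately show ?thesis by (simp add: measure_def)
qed

lemma content_simplex_relabel:
  fixes X :: "(real ^ 'n) set"
  assumes X: "finite X" "card X = Suc CARD('n)" and x0: "x0 \<in> X"
    and f: "bij_betw f (UNIV :: 'n wellordered set) (X - {x0})"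
  shows "fact CARD('n) * measure lebesgue (convex hull X) = \<bar>det (\<chi> i j. relabel (f i - x0) $ j)\<bar>"
proof -
  let ?r = "relabel :: real ^ 'n \<Rightarrow> real ^ 'n wellordered"
  have inj: "inj ?r" 
  proof (rule injI)
    fix x y assume "?r x = ?r y"
    then have "\<forall>i. x $ Rep_wellordered i = y $ Rep_wellordered i" by (simp add: vec_eq_iff)
    then have "\<forall>i. x $ i = y $ i" by (simp add: all_wellordered[of "\<lambda>i. x $ i = y $ i"])
    then show "x = y" by (simp add: vec_eq_iff)
  qed
  have b: "bij_betw (?r \<circ> f) UNIV (?r ` X - {?r x0})"
  proof -
    have "bij_betw ?r (X - {x0}) (?r ` (X - {x0}))" using inj_on_subset[OF inj] by (simp add: bij_betw_def)
    moreover have "?r ` (X - {x0}) = ?r ` X - {?r x0}" using inj by (simp add: image_set_diff)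
    ultimately show ?thesis using bij_betw_trans[OF f] by simp
  qed
  have "measure lebesgue (convex hull X) = measure lebesgue (?r ` (convex hull X))"
    using X by (simp add: measure_relabel finite_imp_compact_convex_hull)
  also have "?r ` (convex hull X) = convex hull (?r ` X)"
    by (rule convex_hull_linear_image[OF linear_relabel])
  also have "measure lebesgue \<dots> = measure lborel (convex hull (?r ` X))"
    using X by (intro measure_completion) (simp add: borel_compact finite_imp_compact_convex_hull)
  also have "\<dots> = \<bar>det (\<chi> i j. (?r \<circ> f) j $ i - ?r x0 $ i)\<bar> / fact CARD('n wellordered)"
    using X x0 inj b unfolding comp_def by (intro content_simplex) (auto simp: card_image inj_on_subset[OF inj] CARD_wellordered)
  also have "(\<chi> i j. (?r \<circ> f) j $ i - ?r x0 $ i) = transpose (\<chi> i j. relabel (f i - x0) $ j)"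
    by (simp add: transpose_def vec_eq_iff)
  finally show ?thesis by (simp add: det_transpose CARD_wellordered)
qed

section \<open>The torus as a quotient\<close>

definition proj :: "real ^ 'n \<Rightarrow> angle ^ 'n" where
  "proj x = (\<chi> k. abs_angle (x $ k))"

lemma abs_angle_eq_iff: "abs_angle x = abs_angle y \<longleftrightarrow> (\<exists>k::int. y = x + of_int k * (2 * pi))"
  by (simp add: angle.abs_eq_iff rcong_altdef)

lemma proj_eq_iff: "proj x = proj y \<longleftrightarrow> (\<exists>v. y = x + (2 * pi) *\<^sub>R vreal v)"
proof
  assume "proj x = proj y"
  then have "\<forall>k. \<exists>j::int. y $ k = x $ k + of_int j * (2 * pi)"
    by (simp add: proj_def vec_eq_iff abs_angle_eq_iff)
  then obtain v :: "_ \<Rightarrow> int" where v: "\<And>k. y $ k = x $ k + of_int (v k) * (2 * pi)" by metis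
  have "y = x + (2 * pi) *\<^sub>R vreal (\<chi> k. v k)"
    using v by (simp add: vec_eq_iff vreal_def)
  then show "\<exists>v. y = x + (2 * pi) *\<^sub>R vreal v" by blast
next
  assume "\<exists>v. y = x + (2 * pi) *\<^sub>R vreal v"
  then obtain v where v: "y = x + (2 * pi) *\<^sub>R vreal v" by blast
  then have "y $ k = x $ k + of_int (v $ k) * (2 * pi)" for k by (simp add: vreal_def)
  then show "proj x = proj y" unfolding proj_def vec_eq_iff abs_angle_eq_iff vec_lambda_beta by blast
qed

lemma surj_proj: "surj proj"
proof (rule surjI)
  fix \<theta> :: "angle ^ 'n"
  show "proj (\<chi> k. rep_angle (\<theta> $ k)) = \<theta>"
    by (simp add: proj_def vec_eq_iff Quotient3_abs_rep[OF Quotient3_angle])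
qed

lemma continuous_abs_angle: "continuous_on UNIV abs_angle"
  unfolding continuous_on_open_vimage[OF open_UNIV] by (simp add: open_angle_def)

lemma continuous_proj: "continuous_on S proj"
proof -
  have "continuous_on S (\<lambda>x. \<chi> k. abs_angle (x $ k))"
    by (intro continuous_on_vec_lambda continuous_on_compose2[OF continuous_abs_angle] continuous_intros) auto
  then show ?thesis by (simp add: proj_def[abs_def])
qed

lemma open_abs_angle_image: "open V \<Longrightarrow> open (abs_angle ` V)"
proof -
  assume V: "open V"
  have "abs_angle -` abs_angle ` V = (\<Union>k::int. (\<lambda>v. of_int k * (2 * pi) + v) ` V)"
  proof (intro set_eqI)
    fix x
    have "x \<in> abs_angle -` abs_angle ` V \<longleftrightarrow> (\<exists>v\<in>V. abs_angle v = abs_angle x)"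
      unfolding vimage_eq image_iff by (rule bex_cong) auto
    also have "\<dots> \<longleftrightarrow> (\<exists>v\<in>V. \<exists>k::int. x = of_int k * (2 * pi) + v)"
      unfolding abs_angle_eq_iff by (simp add: add.commute)
    finally show "x \<in> abs_angle -` abs_angle ` V \<longleftrightarrow> x \<in> (\<Union>k::int. (\<lambda>v. of_int k * (2 * pi) + v) ` V)"
      by blast
  qed
  then show ?thesis using V by (simp add: open_angle_def open_UN open_translation)
qed

text \<open>A product neighbourhood reduces the claim to single coordinates, where the preimage of
  an image under \<open>abs_angle\<close> is a union of translates.\<close>

lemma open_proj_image:
  fixes V :: "(real ^ 'n) set"
  assumes V: "open V"
  shows "open (proj ` V)"
  unfolding open_vec_def
proof
  fix \<theta> assume "\<theta> \<in> proj ` V"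
  then obtain x where x: "x \<in> V" "\<theta> = proj x" by blast
  have "\<exists>S. (\<forall>i. open (S i) \<and> x $ i \<in> S i) \<and> (\<forall>y. (\<forall>i. y $ i \<in> S i) \<longrightarrow> y \<in> V)"
    using V x(1) unfolding open_vec_def by (rule bspec)
  then obtain S where S': "\<forall>i. open (S i) \<and> x $ i \<in> S i" "\<forall>y. (\<forall>i. y $ i \<in> S i) \<longrightarrow> y \<in> V"
    by (elim exE conjE) (rule that)
  then have S: "open (S i)" "x $ i \<in> S i" for i by simp_all
  show "\<exists>S. (\<forall>i. open (S i) \<and> \<theta> $ i \<in> S i) \<and> (\<forall>y. (\<forall>i. y $ i \<in> S i) \<longrightarrow> y \<in> proj ` V)"
  proof (intro exI conjI allI impI)
    show "open (abs_angle ` S i)" for i using S(1) by (rule open_abs_angle_image)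
    show "\<theta> $ i \<in> abs_angle ` S i" for i using S(2) by (simp add: x(2) proj_def)
    fix \<eta> assume "\<forall>i. \<eta> $ i \<in> abs_angle ` S i"
    then have "\<forall>i. \<exists>y. y \<in> S i \<and> \<eta> $ i = abs_angle y" by blast
    then obtain y where y: "\<And>i. y i \<in> S i" "\<And>i. \<eta> $ i = abs_angle (y i)" by metis
    have "(\<chi> i. y i) \<in> V" using y S'(2) by simp
    moreover have "\<eta> = proj (\<chi> i. y i)" using y by (simp add: proj_def vec_eq_iff)
    ultimately show "\<eta> \<in> proj ` V" by blast
  qed
qed

text \<open>One inclusion is continuity of \<open>proj\<close>. The other is openness: an open set
  missing the preimage projects to an open set missing \<open>S\<close>.\<close>

lemma closure_proj_vimage: "proj -` closure S = closure (proj -` S)"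
proof
  show "closure (proj -` S) \<subseteq> proj -` closure S"
  proof (rule closure_minimal)
    show "proj -` S \<subseteq> proj -` closure S" using closure_subset by blast
    show "closed (proj -` closure S)" by (intro closed_vimage continuous_proj closed_closure)
  qed
  show "proj -` closure S \<subseteq> closure (proj -` S)"
  proof (rule ccontr)
    assume "\<not> ?thesis"
    then obtain x where x: "proj x \<in> closure S" "x \<notin> closure (proj -` S)" by blast
    define V where "V = - closure (proj -` S)"
    have "open V" "x \<in> V" using x(2) by (simp_all add: V_def open_Compl)
    have "proj ` V \<inter> S = {}"
      using closure_subset[of "proj -` S"] by (auto simp: V_def)
    then have "proj ` V \<inter> closure S = {}"
      using open_proj_image[OF \<open>open V\<close>] by (simp add: open_Int_closure_eq_empty)
    then show False using x(1) \<open>x \<in> V\<close> by blast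
  qed
qed

section \<open>Connected components of open subsets of the torus\<close>

lemma components_eq_partition:
  fixes S :: "'a::topological_space set"
  assumes un: "\<Union>\<C> = S" and C: "\<And>C. C \<in> \<C> \<Longrightarrow> open C \<and> connected C \<and> C \<noteq> {}"
    and dis: "\<And>C D. C \<in> \<C> \<Longrightarrow> D \<in> \<C> \<Longrightarrow> C \<inter> D \<noteq> {} \<Longrightarrow> C = D"
  shows "components S = \<C>"
proof -
  have max: "connected_component_set S x = C" if C': "C \<in> \<C>" "x \<in> C" for C x
  proof
    show "C \<subseteq> connected_component_set S x"
      using C[OF C'(1)] C' un by (intro connected_component_maximal) auto
    show "connected_component_set S x \<subseteq> C"
    proof (rule ccontr)
      let ?K = "connected_component_set S x"
      assume "\<not> ?K \<subseteq> C"
      moreover have "?K \<subseteq> C \<union> \<Union>(\<C> - {C})"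
        using connected_component_subset[of S x] un by blast
      moreover have "C \<inter> \<Union>(\<C> - {C}) \<inter> ?K = {}" using dis C'(1) by blast
      moreover have "open C" "open (\<Union>(\<C> - {C}))" using C C' by auto
      moreover have "x \<in> ?K" using C' un connected_component_refl_eq[of S x] by auto
      ultimately have "C \<inter> ?K = {} \<or> \<Union>(\<C> - {C}) \<inter> ?K = {}"
        by (intro connectedD[OF connected_connected_component[of S x]])
      then show False
        using \<open>x \<in> ?K\<close> C'(2) \<open>\<not> ?K \<subseteq> C\<close> \<open>?K \<subseteq> C \<union> \<Union>(\<C> - {C})\<close> by blast
    qed
  qed
  show ?thesis
  proof
    show "components S \<subseteq> \<C>"
    proof
      fix K assume "K \<in> components S"
      then obtain x where x: "x \<in> S" "K = connected_component_set S x" by (auto simp: components_def)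
      then obtain C where "C \<in> \<C>" "x \<in> C" using un by blast
      then show "K \<in> \<C>" using max x by simp
    qed
    show "\<C> \<subseteq> components S"
    proof
      fix K assume K: "K \<in> \<C>"
      then obtain x where "x \<in> K" using C by blast
      then show "K \<in> components S" using max[OF K] K un by (auto simp: components_def)
    qed
  qed
qed

lemma connected_translate_component:
  fixes V :: "(real ^ 'n) set"
  assumes tr: "\<And>x. x \<in> V \<Longrightarrow> x + d \<in> V"
    and x: "x \<in> V"
  shows "(\<lambda>y. y + d) ` connected_component_set V x \<subseteq> connected_component_set V (x + d)"
proof (rule connected_component_maximal)
  show "x + d \<in> (\<lambda>y. y + d) ` connected_component_set V x" using x by auto
  show "connected ((\<lambda>y. y + d) ` connected_component_set V x)"
    by (intro connected_continuous_image continuous_intros connected_connected_component)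
  show "(\<lambda>y. y + d) ` connected_component_set V x \<subseteq> V"
    using connected_component_subset[of V x] tr by blast
qed

text \<open>Deck transformations permute the components upstairs, so two projected components that
  meet coincide. Being open and connected, they are the components of \<open>S\<close>.\<close>

lemma components_proj:
  fixes S :: "(angle ^ 'n) set"
  assumes "open S"
  shows "components S = (\<lambda>x. proj ` connected_component_set (proj -` S) x) ` (proj -` S)"
proof (rule components_eq_partition)
  let ?V = "proj -` S"
  have openV: "open ?V" using assms by (intro open_vimage continuous_proj)
  have tr: "x + (2 * pi) *\<^sub>R vreal v \<in> ?V" if "x \<in> ?V" for x v
  proof -
    have "proj x = proj (x + (2 * pi) *\<^sub>R vreal v)" unfolding proj_eq_iff by blast
    then show ?thesis using that by simp
  qed
  show "\<Union>((\<lambda>x. proj ` connected_component_set ?V x) ` ?V) = S"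
  proof
    show "\<Union>((\<lambda>x. proj ` connected_component_set ?V x) ` ?V) \<subseteq> S"
      using connected_component_subset[of ?V] by blast
    show "S \<subseteq> \<Union>((\<lambda>x. proj ` connected_component_set ?V x) ` ?V)"
    proof
      fix \<theta> assume \<theta>: "\<theta> \<in> S"
      obtain x where x: "\<theta> = proj x" using surj_proj by (metis surjE)
      then have "x \<in> ?V" using \<theta> by simp
      then show "\<theta> \<in> \<Union>((\<lambda>x. proj ` connected_component_set ?V x) ` ?V)"
        using x by (intro UN_I[of x] image_eqI[of _ _ x]) auto
    qed
  qed
  show "open C \<and> connected C \<and> C \<noteq> {}" if C: "C \<in> (\<lambda>x. proj ` connected_component_set ?V x) ` ?V" for C
  proof -
    obtain x where x: "x \<in> ?V" "C = proj ` connected_component_set ?V x" using C by blast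
    have "open (connected_component_set ?V x)" using openV by (rule open_connected_component)
    moreover have "x \<in> connected_component_set ?V x" using x(1) by (simp add: connected_component_refl_eq)
    ultimately show ?thesis unfolding x(2)
      by (intro conjI open_proj_image connected_continuous_image continuous_proj connected_connected_component) blast+
  qed
  fix C D assume CD: "C \<in> (\<lambda>x. proj ` connected_component_set ?V x) ` ?V"
    "D \<in> (\<lambda>x. proj ` connected_component_set ?V x) ` ?V" "C \<inter> D \<noteq> {}"
  have sub: "proj ` connected_component_set ?V x \<subseteq> proj ` connected_component_set ?V y"
    if xy: "x \<in> ?V" "y \<in> ?V" "p \<in> connected_component_set ?V x" "q \<in> connected_component_set ?V y" "proj p = proj q"
    for x y p q
  proof -
    obtain v where v: "q = p + (2 * pi) *\<^sub>R vreal v" using xy(5) unfolding proj_eq_iff by blast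
    have px: "connected_component_set ?V p = connected_component_set ?V x"
      using connected_component_eq[OF xy(3)] by simp
    have qy: "connected_component_set ?V q = connected_component_set ?V y"
      using connected_component_eq[OF xy(4)] by simp
    have "p \<in> ?V" using xy(3) connected_component_subset by blast
    then have "(\<lambda>z. z + (2 * pi) *\<^sub>R vreal v) ` connected_component_set ?V p \<subseteq> connected_component_set ?V q"
      unfolding v by (intro connected_translate_component tr)
    then have *: "(\<lambda>z. z + (2 * pi) *\<^sub>R vreal v) ` connected_component_set ?V x \<subseteq> connected_component_set ?V y"
      unfolding px qy .
    show ?thesis
    proof
      fix \<theta> assume "\<theta> \<in> proj ` connected_component_set ?V x"
      then obtain z where z: "z \<in> connected_component_set ?V x" "\<theta> = proj z" by blast
      have "\<theta> = proj (z + (2 * pi) *\<^sub>R vreal v)" unfolding z(2) proj_eq_iff by blast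
      then show "\<theta> \<in> proj ` connected_component_set ?V y" using * z(1) by blast
    qed
  qed
  obtain x y where x: "x \<in> ?V" "C = proj ` connected_component_set ?V x"
    and y: "y \<in> ?V" "D = proj ` connected_component_set ?V y" using CD(1,2) by blast
  obtain \<theta> where "\<theta> \<in> C" "\<theta> \<in> D" using CD(3) by blast
  then obtain p q where "p \<in> connected_component_set ?V x" "q \<in> connected_component_set ?V y" "\<theta> = proj p" "\<theta> = proj q"
    unfolding x(2) y(2) by (elim imageE) (rule that)
  then show "C = D" unfolding x(2) y(2)
    by (intro subset_antisym sub[OF x(1) y(1), of p q] sub[OF y(1) x(1), of q p]) simp_all
qed

lemma pairing_proj: "pairing \<alpha> (proj x) = abs_angle (vreal \<alpha> \<bullet> x)"
proof -
  have s: "(\<Sum>k\<in>S. abs_angle (f k)) = abs_angle (\<Sum>k\<in>S. f k)" if "finite S" for S and f :: "'n \<Rightarrow> real"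
    using that by (induction S) (simp_all add: zero_angle.abs_eq plus_angle.abs_eq)
  show ?thesis
    by (simp add: pairing_def proj_def scale_angle.abs_eq s inner_vec_def vreal_def)
qed

lemma monomial_directions_proj:
  "monomial_directions A c (proj x) = {cis (Arg (c \<alpha>) + vreal \<alpha> \<bullet> x) | \<alpha>. \<alpha> \<in> A}"
  by (simp add: monomial_directions_def pairing_proj arg_angle.abs_eq plus_angle.abs_eq cis_angle.abs_eq arg_angle_def)

section \<open>The affine relation of a circuit\<close>

lemma det_mreal: "det (mreal M) = of_int (det M)" for M :: "int ^ 'm ^ 'm"
  by (simp add: det_def mreal_def)

lemma trivial_kernel_det:
  fixes M :: "real ^ 'm ^ 'm"
  assumes "\<And>x. M *v x = 0 \<Longrightarrow> x = 0"
  shows "det M \<noteq> 0"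
proof -
  obtain B where "B ** M = mat 1" using assms matrix_left_invertible_ker[of M] by blast
  then have "invertible M" using matrix_left_right_inverse unfolding invertible_def by blast
  then show ?thesis by (simp add: invertible_det_nz)
qed

lemma circuit_finite: "circuit A \<Longrightarrow> finite A" and circuit_card: "circuit A \<Longrightarrow> card A = CARD('n) + 2"
  for A :: "(int ^ 'n) set"
  unfolding circuit_def by (auto intro: card_ge_0_finite)

text \<open>The coefficients form a kernel vector of the maximal minor with columns from
  \<open>A - {k}\<close>, and this minor is invertible.\<close>

lemma circuit_independent:
  fixes A :: "(int ^ 'n) set" and y :: "int ^ 'n \<Rightarrow> real"
  assumes A: "circuit A" and k: "k \<in> A"
    and y: "(\<Sum>\<alpha>\<in>A - {k}. y \<alpha>) = 0" "(\<Sum>\<alpha>\<in>A - {k}. y \<alpha> *\<^sub>R vreal \<alpha>) = 0"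
  shows "\<forall>\<alpha>\<in>A - {k}. y \<alpha> = 0"
proof -
  have fin: "finite A" and card: "card A = CARD('n) + 2" using A by (rule circuit_finite, rule circuit_card)
  have "card (UNIV :: 'n option set) = card (A - {k})" using fin card k by (simp add: card_UNIV_option)
  then obtain a where a: "bij_betw a (UNIV :: 'n option set) (A - {k})"
    using finite_same_card_bij[of "UNIV :: 'n option set" "A - {k}"] fin by auto
  have inj: "inj a" and rng: "range a = A - {k}" using a by (auto simp: bij_betw_def)
  then have d: "det (column_matrix a) \<noteq> 0" using A unfolding circuit_def by blast
  define M where "M = mreal (column_matrix a)"
  have "invertible M" using d by (simp add: M_def invertible_det_nz det_mreal)
  then obtain B where B: "B ** M = mat 1" unfolding invertible_def by blast
  define x where "x = (\<chi> j. y (a j))"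
  have re: "(\<Sum>j\<in>UNIV. g (a j)) = (\<Sum>\<alpha>\<in>A - {k}. g \<alpha>)" for g :: "int ^ 'n \<Rightarrow> real"
    using a by (rule sum.reindex_bij_betw)
  have "(M *v x) $ r = 0" for r
  proof (cases r)
    case None
    then have "(M *v x) $ r = (\<Sum>j\<in>UNIV. y (a j))"
      by (simp add: M_def x_def mreal_def column_matrix_def matrix_vector_mult_def)
    then show ?thesis using re[of y] y(1) by simp
  next
    case (Some i)
    then have "(M *v x) $ r = (\<Sum>j\<in>UNIV. y (a j) * (vreal (a j) $ i))"
      by (simp add: M_def x_def mreal_def column_matrix_def matrix_vector_mult_def vreal_def mult.commute)
    also have "\<dots> = (\<Sum>\<alpha>\<in>A - {k}. y \<alpha> *\<^sub>R vreal \<alpha>) $ i"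
      unfolding re[of "\<lambda>\<alpha>. y \<alpha> * (vreal \<alpha> $ i)"] by simp
    finally show ?thesis using y(2) by simp
  qed
  then have "M *v x = 0" by (simp add: vec_eq_iff)
  then have "x = 0" using B by (metis matrix_vector_mul_assoc matrix_vector_mul_lid matrix_vector_mult_0_right)
  then have "y (a j) = 0" for j by (simp add: x_def vec_eq_iff)
  then show ?thesis unfolding rng[symmetric] by blast
qed

text \<open>The \<open>n + 2\<close> vectors \<open>(1, vreal \<alpha>)\<close> live in dimension
  \<open>n + 1\<close>, so they are dependent. A vanishing coefficient would leave a relation among
  the others, against \<open>circuit_independent\<close>.\<close>

lemma circuit_dependency:
  fixes A :: "(int ^ 'n) set"
  assumes A: "circuit A"
  obtains lm :: "int ^ 'n \<Rightarrow> real" where "(\<Sum>\<alpha>\<in>A. lm \<alpha>) = 0" "(\<Sum>\<alpha>\<in>A. lm \<alpha> *\<^sub>R vreal \<alpha>) = 0"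
    "\<And>\<alpha>. \<alpha> \<in> A \<Longrightarrow> lm \<alpha> \<noteq> 0"
proof -
  have fin: "finite A" and card: "card A = CARD('n) + 2" using A by (rule circuit_finite, rule circuit_card)
  define g where "g \<alpha> = (1 :: real, vreal \<alpha>)" for \<alpha> :: "int ^ 'n"
  have inj: "inj_on g A" by (auto simp: g_def inj_on_def vreal_inject)
  have "dependent (g ` A)"
    using fin card inj by (intro dependent_biggerset) (auto simp: card_image)
  then obtain v w where v: "w \<in> g ` A" "v w \<noteq> 0" "(\<Sum>w\<in>g ` A. v w *\<^sub>R w) = 0"
    using fin unfolding dependent_finite[OF finite_imageI[OF fin]] by blast
  define lm where "lm \<alpha> = v (g \<alpha>)" for \<alpha>
  have s: "(\<Sum>\<alpha>\<in>A. lm \<alpha> *\<^sub>R g \<alpha>) = 0" using v(3) inj by (simp add: sum.reindex lm_def)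
  have s1: "(\<Sum>\<alpha>\<in>A. lm \<alpha>) = 0" using arg_cong[OF s, of fst] by (simp add: fst_sum g_def)
  have s2: "(\<Sum>\<alpha>\<in>A. lm \<alpha> *\<^sub>R vreal \<alpha>) = 0" using arg_cong[OF s, of snd] by (simp add: snd_sum g_def)
  have "lm k \<noteq> 0" if k: "k \<in> A" for k
  proof
    assume k0: "lm k = 0"
    have "\<forall>\<alpha>\<in>A - {k}. lm \<alpha> = 0"
    proof (rule circuit_independent[OF A k])
      show "(\<Sum>\<alpha>\<in>A - {k}. lm \<alpha>) = 0" using s1 sum.remove[OF fin k, of lm] k0 by simp
      show "(\<Sum>\<alpha>\<in>A - {k}. lm \<alpha> *\<^sub>R vreal \<alpha>) = 0"
        using s2 sum.remove[OF fin k, of "\<lambda>\<alpha>. lm \<alpha> *\<^sub>R vreal \<alpha>"] k0 by simp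
    qed
    then show False using v(1,2) k0 by (auto simp: lm_def)
  qed
  then show thesis using that[OF s1 s2] by blast
qed

section \<open>Edge vectors and volumes of the simplices of a circuit\<close>

lemma circuit_enum:
  fixes A :: "(int ^ 'n) set" and B :: "'b::finite set"
  assumes A: "circuit A" and kj: "k \<in> A" "j \<in> A" "k \<noteq> j" and c: "CARD('b) = CARD('n)"
  obtains f :: "'b \<Rightarrow> int ^ 'n" where "bij_betw f UNIV (A - {k, j})"
proof -
  have fin: "finite A" and card: "card A = CARD('n) + 2" using A by (rule circuit_finite, rule circuit_card)
  have "card (A - {k, j}) = card A - card {k, j}" using kj fin by (intro card_Diff_subset) auto
  then have "card (UNIV :: 'b set) = card (A - {k, j})" using kj card c by simp
  then show thesis using finite_same_card_bij[of "UNIV :: 'b set" "A - {k, j}"] fin that by auto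
qed

text \<open>Giving \<open>j\<close> minus the sum of the coefficients turns a linear relation
  between the edges at \<open>j\<close> into an affine relation on \<open>A - {k}\<close>.\<close>

lemma circuit_enum_kernel:
  fixes A :: "(int ^ 'n) set" and f :: "'b::finite \<Rightarrow> int ^ 'n" and x :: "'b \<Rightarrow> real"
  assumes A: "circuit A" and kj: "k \<in> A" "j \<in> A" "k \<noteq> j" and f: "bij_betw f UNIV (A - {k, j})"
    and x: "(\<Sum>i\<in>UNIV. x i *\<^sub>R (vreal (f i) - vreal j)) = 0"
  shows "x i = 0"
proof -
  have fin: "finite A" using A by (rule circuit_finite)
  define y where "y \<alpha> = (if \<alpha> = j then - (\<Sum>i\<in>UNIV. x i) else x (inv_into UNIV f \<alpha>))" for \<alpha>
  have inj: "inj f" and rng: "range f = A - {k, j}" using f by (auto simp: bij_betw_def)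
  have yf: "y (f i) = x i" for i
  proof -
    have "f i \<noteq> j" using rng by blast
    then show ?thesis using inj by (simp add: y_def)
  qed
  have S: "(\<Sum>\<alpha>\<in>A - {k}. g \<alpha>) = g j + (\<Sum>i\<in>UNIV. g (f i))" for g :: "int ^ 'n \<Rightarrow> 'z::comm_monoid_add"
  proof -
    have "(\<Sum>\<alpha>\<in>A - {k}. g \<alpha>) = g j + (\<Sum>\<alpha>\<in>A - {k} - {j}. g \<alpha>)" using fin kj by (intro sum.remove) auto
    also have "A - {k} - {j} = A - {k, j}" by auto
    also have "(\<Sum>\<alpha>\<in>A - {k, j}. g \<alpha>) = (\<Sum>i\<in>UNIV. g (f i))" using f by (rule sum.reindex_bij_betw[symmetric])
    finally show ?thesis .
  qed
  have "\<forall>\<alpha>\<in>A - {k}. y \<alpha> = 0"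
  proof (rule circuit_independent[OF A kj(1)])
    show "(\<Sum>\<alpha>\<in>A - {k}. y \<alpha>) = 0" unfolding S by (simp add: yf) (simp add: y_def)
    have "(\<Sum>\<alpha>\<in>A - {k}. y \<alpha> *\<^sub>R vreal \<alpha>) = (\<Sum>i\<in>UNIV. x i *\<^sub>R (vreal (f i) - vreal j))"
      unfolding S yf
      by (simp add: y_def scaleR_diff_right sum_subtractf scaleR_left.sum)
    then show "(\<Sum>\<alpha>\<in>A - {k}. y \<alpha> *\<^sub>R vreal \<alpha>) = 0" using x by simp
  qed
  moreover have "f i \<in> A - {k}" using rng by blast
  ultimately have "y (f i) = 0" by blast
  then show ?thesis by (simp add: yf)
qed

text \<open>The lattice volume of the simplex opposite \<open>k\<close>, normalised so that a
  unimodular simplex has volume 1.\<close>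

definition simplex_vol :: "(int ^ 'n) set \<Rightarrow> int ^ 'n \<Rightarrow> real" where
  "simplex_vol A k = fact CARD('n) * measure lebesgue (convex hull (vreal ` (A - {k})))"

definition edge_matrix :: "('n wellordered \<Rightarrow> int ^ 'n) \<Rightarrow> int ^ 'n \<Rightarrow> int ^ 'n wellordered ^ 'n wellordered" where
  "edge_matrix f j = (\<chi> i. relabel (f i - j))"

lemma edge_matrix_row: "mreal (edge_matrix f j) $ i = relabel (vreal (f i) - vreal j)"
  by (simp add: mreal_def edge_matrix_def vec_eq_iff vreal_def)

lemma simplex_vol_det:
  fixes A :: "(int ^ 'n) set"
  assumes A: "circuit A" and kj: "k \<in> A" "j \<in> A" "k \<noteq> j"
    and f: "bij_betw f (UNIV :: 'n wellordered set) (A - {k, j})"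
  shows "simplex_vol A k = \<bar>det (mreal (edge_matrix f j))\<bar>"
proof -
  have fin: "finite A" and card: "card A = CARD('n) + 2" using A by (rule circuit_finite, rule circuit_card)
  have inj: "inj (vreal :: int ^ 'n \<Rightarrow> _)" by (auto simp: inj_def vreal_inject)
  have b: "bij_betw (\<lambda>i. vreal (f i)) (UNIV :: 'n wellordered set) (vreal ` (A - {k}) - {vreal j})"
  proof -
    have "vreal ` (A - {k}) - {vreal j} = vreal ` (A - {k, j})"
      using inj by (auto simp: inj_def)
    moreover have "bij_betw vreal (A - {k, j}) (vreal ` (A - {k, j}))"
      using inj_on_subset[OF inj] by (simp add: bij_betw_def)
    ultimately show ?thesis using bij_betw_trans[OF f] by (simp add: comp_def)
  qed
  have "fact CARD('n) * measure lebesgue (convex hull (vreal ` (A - {k}))) =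
      \<bar>det (\<chi> i j'. relabel (vreal (f i) - vreal j) $ j')\<bar>"
  proof (rule content_simplex_relabel[OF _ _ _ b])
    show "finite (vreal ` (A - {k}))" using fin by simp
    show "card (vreal ` (A - {k})) = Suc CARD('n)"
      using fin card kj inj_on_subset[OF inj] by (simp add: card_image)
    show "vreal j \<in> vreal ` (A - {k})" using kj by auto
  qed
  also have "(\<chi> i j'. relabel (vreal (f i) - vreal j) $ j') = mreal (edge_matrix f j)"
    by (simp add: vec_eq_iff edge_matrix_row)
  finally show ?thesis by (simp add: simplex_vol_def)
qed

lemma relabel_sum: "relabel (\<Sum>i\<in>S. x i *\<^sub>R v i) = (\<Sum>i\<in>S. x i *\<^sub>R relabel (v i))" for v :: "'a \<Rightarrow> real ^ 'n"
  by (simp add: vec_eq_iff)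

lemma relabel_eq_0: "relabel (v :: real ^ 'n) = 0 \<longleftrightarrow> v = 0"
  using all_wellordered[of "\<lambda>i. v $ i = 0"] by (simp add: vec_eq_iff)

lemma edge_matrix_det_nonzero:
  fixes A :: "(int ^ 'n) set"
  assumes A: "circuit A" and kj: "k \<in> A" "j \<in> A" "k \<noteq> j"
    and f: "bij_betw f (UNIV :: 'n wellordered set) (A - {k, j})"
  shows "det (mreal (edge_matrix f j)) \<noteq> 0"
proof -
  let ?M = "transpose (mreal (edge_matrix f j))"
  have "det ?M \<noteq> 0"
  proof (rule trivial_kernel_det)
    fix x assume "?M *v x = 0"
    moreover have "?M *v x = relabel (\<Sum>i\<in>UNIV. (x $ i) *\<^sub>R (vreal (f i) - vreal j))"
      unfolding relabel_sum
      by (simp add: vec_eq_iff matrix_vector_mult_def transpose_def edge_matrix_row mult.commute)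
    ultimately have "(\<Sum>i\<in>UNIV. (x $ i) *\<^sub>R (vreal (f i) - vreal j)) = 0" by (simp add: relabel_eq_0)
    then have "x $ i = 0" for i by (rule circuit_enum_kernel[OF A kj f])
    then show "x = 0" by (simp add: vec_eq_iff)
  qed
  then show ?thesis by (simp add: det_transpose)
qed

text \<open>The simplices opposite \<open>k\<close> and opposite \<open>j\<close> differ in one
  vertex. From a common vertex \<open>o'\<close>, the edge to \<open>k\<close> is a combination of
  the edges of the simplex opposite \<open>k\<close>, with coefficient \<open>- lm j / lm k\<close>
  at \<open>j\<close>; Cramer's rule makes this the ratio of the determinants.\<close>

lemma simplex_vol_ratio:
  fixes A :: "(int ^ 'n) set" and lm :: "int ^ 'n \<Rightarrow> real"
  assumes A: "circuit A" and lm: "(\<Sum>\<alpha>\<in>A. lm \<alpha>) = 0" "(\<Sum>\<alpha>\<in>A. lm \<alpha> *\<^sub>R vreal \<alpha>) = 0"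
    "\<And>\<alpha>. \<alpha> \<in> A \<Longrightarrow> lm \<alpha> \<noteq> 0" and kj: "k \<in> A" "j \<in> A"
  shows "simplex_vol A k * \<bar>lm j\<bar> = simplex_vol A j * \<bar>lm k\<bar>"
proof (cases "k = j")
  case False
  have fin: "finite A" and card: "card A = CARD('n) + 2" using A by (rule circuit_finite, rule circuit_card)
  have "\<not> A \<subseteq> {k, j}"
  proof
    assume "A \<subseteq> {k, j}"
    then have "card A \<le> card {k, j}" by (intro card_mono) auto
    then show False using card False zero_less_card_finite[where 'a = 'n] by simp
  qed
  then obtain o' where o: "o' \<in> A" "o' \<noteq> k" "o' \<noteq> j" by blast
  obtain f :: "'n wellordered \<Rightarrow> int ^ 'n" where f: "bij_betw f UNIV (A - {k, o'})"
    using circuit_enum[OF A kj(1) o(1)] o CARD_wellordered by metis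
  have inj: "inj f" and rng: "range f = A - {k, o'}" using f by (auto simp: bij_betw_def)
  obtain i0 where i0: "f i0 = j" using rng kj(2) False o by (metis DiffI imageE insertE singletonD)
  define g where "g = f (i0 := k)"
  have g: "bij_betw g UNIV (A - {j, o'})"
    unfolding bij_betw_def
  proof
    show "inj g" using inj rng unfolding g_def by (intro inj_on_fun_updI) auto
    have "f ` (UNIV - {i0}) = A - {k, o'} - {j}" using inj i0 rng by (simp add: image_set_diff)
    moreover have "range g = insert k (f ` (UNIV - {i0}))" by (auto simp: g_def)
    ultimately show "range g = A - {j, o'}" using kj False o by auto
  qed
  let ?D = "mreal (edge_matrix f o')"
  define x where "x = (\<chi> i. - lm (f i) / lm k)"
  have lmk: "lm k \<noteq> 0" using lm(3) kj by simp
  have comb: "vreal k - vreal o' = (\<Sum>i\<in>UNIV. (x $ i) *\<^sub>R (vreal (f i) - vreal o'))"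
  proof -
    have S: "(\<Sum>\<alpha>\<in>A. h \<alpha>) = h k + (h o' + (\<Sum>i\<in>UNIV. h (f i)))" for h :: "int ^ 'n \<Rightarrow> real ^ 'n"
    proof -
      have "(\<Sum>\<alpha>\<in>A. h \<alpha>) = h k + (\<Sum>\<alpha>\<in>A - {k}. h \<alpha>)" using fin kj by (intro sum.remove) auto
      also have "(\<Sum>\<alpha>\<in>A - {k}. h \<alpha>) = h o' + (\<Sum>\<alpha>\<in>A - {k} - {o'}. h \<alpha>)" using fin o by (intro sum.remove) auto
      also have "A - {k} - {o'} = A - {k, o'}" by auto
      also have "(\<Sum>\<alpha>\<in>A - {k, o'}. h \<alpha>) = (\<Sum>i\<in>UNIV. h (f i))" using f by (rule sum.reindex_bij_betw[symmetric])
      finally show ?thesis .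
    qed
    have "(\<Sum>\<alpha>\<in>A. lm \<alpha> *\<^sub>R (vreal \<alpha> - vreal o')) = 0"
      using lm(1,2) by (simp add: scaleR_diff_right sum_subtractf flip: scaleR_sum_left)
    then have "lm k *\<^sub>R (vreal k - vreal o') + (\<Sum>i\<in>UNIV. lm (f i) *\<^sub>R (vreal (f i) - vreal o')) = 0"
      unfolding S by simp
    then have e: "lm k *\<^sub>R (vreal k - vreal o') = - (\<Sum>i\<in>UNIV. lm (f i) *\<^sub>R (vreal (f i) - vreal o'))"
      by (simp add: eq_neg_iff_add_eq_0)
    have "vreal k - vreal o' = (1 / lm k) *\<^sub>R (lm k *\<^sub>R (vreal k - vreal o'))" using lmk by simp
    also have "\<dots> = (\<Sum>i\<in>UNIV. (x $ i) *\<^sub>R (vreal (f i) - vreal o'))"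
      unfolding e by (simp add: x_def scaleR_sum_right sum_negf[symmetric])
    finally show ?thesis .
  qed
  have "(\<chi> i. if i = i0 then (\<Sum>i\<in>UNIV. x $ i *s row i ?D) else row i ?D) = mreal (edge_matrix g o')"
  proof -
    have r: "row i ?D = relabel (vreal (f i) - vreal o')" for i
      by (simp add: row_def vec_eq_iff edge_matrix_row)
    have "(\<Sum>i\<in>UNIV. x $ i *s row i ?D) = relabel (vreal k - vreal o')"
      unfolding comb relabel_sum r by (simp add: scalar_mult_eq_scaleR)
    then show ?thesis by (simp add: vec_eq_iff r edge_matrix_row g_def)
  qed
  then have "det (mreal (edge_matrix g o')) = x $ i0 * det ?D"
    using cramer_lemma_transpose[of i0 x ?D] by simp
  moreover have "simplex_vol A k = \<bar>det ?D\<bar>" using simplex_vol_det[OF A kj(1) o(1) _ f] o by simp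
  moreover have "simplex_vol A j = \<bar>det (mreal (edge_matrix g o'))\<bar>"
    using simplex_vol_det[OF A kj(2) o(1) _ g] o by simp
  ultimately show ?thesis using lmk by (simp add: x_def i0 abs_mult)
qed simp

text \<open>Up to sign, the coefficients of a real relation are proportional to the simplex volumes,
  and these are nonzero integers, being absolute determinants of edge matrices. Rescaling by
  \<open>r\<close> therefore gives an integer relation.\<close>

lemma ex_circuit_relation:
  fixes A :: "(int ^ 'n) set"
  assumes A: "circuit A"
  obtains l :: "int ^ 'n \<Rightarrow> int" where "\<And>\<alpha>. \<alpha> \<in> A \<Longrightarrow> l \<alpha> \<noteq> 0" "(\<Sum>\<alpha>\<in>A. l \<alpha>) = 0"
    "\<And>k. (\<Sum>\<alpha>\<in>A. l \<alpha> * \<alpha> $ k) = 0" "\<And>\<alpha>. \<alpha> \<in> A \<Longrightarrow> \<bar>real_of_int (l \<alpha>)\<bar> = simplex_vol A \<alpha>"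
proof -
  have fin: "finite A" and card: "card A = CARD('n) + 2" using A by (rule circuit_finite, rule circuit_card)
  obtain lm where lm: "(\<Sum>\<alpha>\<in>A. lm \<alpha>) = 0" "(\<Sum>\<alpha>\<in>A. lm \<alpha> *\<^sub>R vreal \<alpha>) = 0" "\<And>\<alpha>. \<alpha> \<in> A \<Longrightarrow> lm \<alpha> \<noteq> 0"
    by (rule circuit_dependency[OF A]) (rule that)
  have "A \<noteq> {}" using card by auto
  then obtain k0 where k0: "k0 \<in> A" by blast
  define r where "r = simplex_vol A k0 / \<bar>lm k0\<bar>"
  have "\<exists>d::int. d \<noteq> 0 \<and> simplex_vol A k = \<bar>real_of_int d\<bar>" if k: "k \<in> A" for k
  proof -
    have "\<not> A \<subseteq> {k}"
    proof
      assume "A \<subseteq> {k}"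
      then have "card A \<le> card {k}" by (intro card_mono) auto
      then show False using card by simp
    qed
    then obtain j where j: "j \<in> A" "k \<noteq> j" by blast
    obtain f :: "'n wellordered \<Rightarrow> int ^ 'n" where f: "bij_betw f UNIV (A - {k, j})"
      using circuit_enum[OF A k j] CARD_wellordered by metis
    have "simplex_vol A k = \<bar>real_of_int (det (edge_matrix f j))\<bar>"
      using simplex_vol_det[OF A k j f] by (simp add: det_mreal)
    moreover have "det (edge_matrix f j) \<noteq> 0"
      using edge_matrix_det_nonzero[OF A k j f] by (simp add: det_mreal)
    ultimately show ?thesis by blast
  qed
  then obtain d :: "int ^ 'n \<Rightarrow> int" where d: "\<And>k. k \<in> A \<Longrightarrow> d k \<noteq> 0"
    "\<And>k. k \<in> A \<Longrightarrow> simplex_vol A k = \<bar>real_of_int (d k)\<bar>" by metis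
  define l where "l \<alpha> = (if lm \<alpha> > 0 then \<bar>d \<alpha>\<bar> else - \<bar>d \<alpha>\<bar>)" for \<alpha>
  have lr: "real_of_int (l \<alpha>) = r * lm \<alpha>" if "\<alpha> \<in> A" for \<alpha>
  proof -
    have "simplex_vol A \<alpha> = r * \<bar>lm \<alpha>\<bar>"
      using simplex_vol_ratio[OF A lm that k0] lm(3)[OF k0] by (simp add: r_def field_simps)
    then show ?thesis using d(2)[OF that] by (auto simp: l_def abs_if split: if_splits)
  qed
  show thesis
  proof
    show "l \<alpha> \<noteq> 0" if "\<alpha> \<in> A" for \<alpha> using d(1)[OF that] by (simp add: l_def)
    show "\<bar>real_of_int (l \<alpha>)\<bar> = simplex_vol A \<alpha>" if "\<alpha> \<in> A" for \<alpha> using d(2)[OF that] by (simp add: l_def)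
    have "real_of_int (\<Sum>\<alpha>\<in>A. l \<alpha>) = r * (\<Sum>\<alpha>\<in>A. lm \<alpha>)"
      unfolding of_int_sum sum_distrib_left by (intro sum.cong refl lr)
    then show "(\<Sum>\<alpha>\<in>A. l \<alpha>) = 0" using lm(1) by (metis mult_zero_right of_int_eq_0_iff)
    fix k
    have "real_of_int (\<Sum>\<alpha>\<in>A. l \<alpha> * \<alpha> $ k) = r * (\<Sum>\<alpha>\<in>A. lm \<alpha> *\<^sub>R vreal \<alpha>) $ k"
      unfolding of_int_sum sum_distrib_left sum_component
      by (intro sum.cong refl) (simp add: lr vreal_def mult.assoc)
    then show "(\<Sum>\<alpha>\<in>A. l \<alpha> * \<alpha> $ k) = 0" using lm(2) by (metis mult_zero_right of_int_eq_0_iff zero_index)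
  qed
qed

text \<open>The vectors \<open>b\<close> come from the basis dual to the edges at \<open>j\<close>,
  so the slope matches the differences of \<open>\<delta>\<close> along these edges. The value at
  the last point \<open>k\<close> is then forced by the relation, because \<open>l k\<close> is
  nonzero.\<close>

lemma circuit_dual:
  fixes A :: "(int ^ 'n) set" and l :: "int ^ 'n \<Rightarrow> int"
  assumes A: "circuit A" and l: "\<And>\<alpha>. \<alpha> \<in> A \<Longrightarrow> l \<alpha> \<noteq> 0" "(\<Sum>\<alpha>\<in>A. l \<alpha>) = 0"
    "\<And>k. (\<Sum>\<alpha>\<in>A. l \<alpha> * \<alpha> $ k) = 0"
  obtains b :: "int ^ 'n \<Rightarrow> real ^ 'n" where "\<And>\<delta> :: int ^ 'n \<Rightarrow> real. (\<Sum>\<alpha>\<in>A. l \<alpha> * \<delta> \<alpha>) = 0 \<Longrightarrow>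
      \<exists>s. \<forall>\<alpha>\<in>A. \<delta> \<alpha> = vreal \<alpha> \<bullet> (\<Sum>\<beta>\<in>A. \<delta> \<beta> *\<^sub>R b \<beta>) + s"
proof -
  have fin: "finite A" and card: "card A = CARD('n) + 2" using A by (rule circuit_finite, rule circuit_card)
  have "A \<noteq> {}" using card by auto
  then obtain k where k: "k \<in> A" by blast
  have "\<not> A \<subseteq> {k}"
  proof
    assume "A \<subseteq> {k}"
    then have "card A \<le> card {k}" by (intro card_mono) auto
    then show False using card by simp
  qed
  then obtain j where j: "j \<in> A" "k \<noteq> j" by blast
  obtain f :: "'n \<Rightarrow> int ^ 'n" where f: "bij_betw f UNIV (A - {k, j})"
    using circuit_enum[OF A k j, where 'b = 'n] by metis
  have inj: "inj f" and rng: "range f = A - {k, j}" using f by (auto simp: bij_betw_def)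
  define D where "D = (\<chi> i. vreal (f i) - vreal j)"
  have "det (transpose D) \<noteq> 0"
  proof (rule trivial_kernel_det)
    fix x assume "transpose D *v x = 0"
    moreover have "transpose D *v x = (\<Sum>i\<in>UNIV. (x $ i) *\<^sub>R (vreal (f i) - vreal j))"
      by (simp add: vec_eq_iff matrix_vector_mult_def transpose_def D_def mult.commute)
    ultimately have "(\<Sum>i\<in>UNIV. (x $ i) *\<^sub>R (vreal (f i) - vreal j)) = 0" by simp
    then have "x $ i = 0" for i by (rule circuit_enum_kernel[OF A k j f])
    then show "x = 0" by (simp add: vec_eq_iff)
  qed
  then have "invertible D" by (simp add: det_transpose invertible_det_nz)
  then obtain B where B: "D ** B = mat 1" unfolding invertible_def by blast
  \<comment> \<open>The choice at \<open>j\<close> makes the sum of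
    \<open>\<delta> \<beta> *\<^sub>R b \<beta>\<close> a combination of dual vectors with
    coefficients \<open>\<delta> (f i) - \<delta> j\<close>.\<close>
  define b where "b \<alpha> = (if \<alpha> = j then - (\<Sum>i\<in>UNIV. column i B) else if \<alpha> = k then 0 else column (inv_into UNIV f \<alpha>) B)" for \<alpha>
  have S: "(\<Sum>\<alpha>\<in>A. h \<alpha>) = h k + (h j + (\<Sum>i\<in>UNIV. h (f i)))" for h :: "int ^ 'n \<Rightarrow> 'z::comm_monoid_add"
  proof -
    have "(\<Sum>\<alpha>\<in>A. h \<alpha>) = h k + (\<Sum>\<alpha>\<in>A - {k}. h \<alpha>)" using fin k by (intro sum.remove) auto
    also have "(\<Sum>\<alpha>\<in>A - {k}. h \<alpha>) = h j + (\<Sum>\<alpha>\<in>A - {k} - {j}. h \<alpha>)" using fin j by (intro sum.remove) auto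
    also have "A - {k} - {j} = A - {k, j}" by auto
    also have "(\<Sum>\<alpha>\<in>A - {k, j}. h \<alpha>) = (\<Sum>i\<in>UNIV. h (f i))" using f by (rule sum.reindex_bij_betw[symmetric])
    finally show ?thesis .
  qed
  have bf: "b (f i) = column i B" for i
  proof -
    have "f i \<noteq> j" "f i \<noteq> k" using rng by blast+
    then show ?thesis using inj by (simp add: b_def)
  qed
  show thesis
  proof
    fix \<delta> :: "int ^ 'n \<Rightarrow> real" assume \<delta>: "(\<Sum>\<alpha>\<in>A. l \<alpha> * \<delta> \<alpha>) = 0"
    define v where "v = (\<Sum>\<beta>\<in>A. \<delta> \<beta> *\<^sub>R b \<beta>)"
    define s where "s = \<delta> j - vreal j \<bullet> v"
    have v: "v = (\<Sum>i\<in>UNIV. (\<delta> (f i) - \<delta> j) *\<^sub>R column i B)"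
      unfolding v_def S bf using j by (simp add: b_def scaleR_diff_left sum_subtractf scaleR_sum_right)
    have e: "\<delta> (f i) = vreal (f i) \<bullet> v + s" for i
    proof -
      have E: "(vreal (f i) - vreal j) \<bullet> column i' B = (if i = i' then 1 else 0)" for i'
      proof -
        have "(D ** B) $ i $ i' = (vreal (f i) - vreal j) \<bullet> column i' B"
          by (simp add: matrix_matrix_mult_def D_def inner_vec_def column_def)
        then show ?thesis unfolding B by (simp add: mat_def)
      qed
      have "(vreal (f i) - vreal j) \<bullet> v = \<delta> (f i) - \<delta> j"
        unfolding v inner_sum_right inner_scaleR_right E by (simp add: if_distrib[of "(*) _"] cong: if_cong)
      then show ?thesis by (simp add: s_def inner_diff_left)
    qed
    have lin: "(\<Sum>\<alpha>\<in>A. l \<alpha> * (vreal \<alpha> \<bullet> v + s)) = 0"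
    proof -
      have "(\<Sum>\<alpha>\<in>A. l \<alpha> * (vreal \<alpha> \<bullet> v)) = (\<Sum>\<alpha>\<in>A. \<Sum>k\<in>UNIV. real_of_int (l \<alpha> * \<alpha> $ k) * v $ k)"
        by (simp add: inner_vec_def vreal_def sum_distrib_left mult.assoc)
      also have "\<dots> = (\<Sum>k\<in>UNIV. real_of_int (\<Sum>\<alpha>\<in>A. l \<alpha> * \<alpha> $ k) * v $ k)"
        by (subst sum.swap) (simp add: sum_distrib_right)
      finally have "(\<Sum>\<alpha>\<in>A. l \<alpha> * (vreal \<alpha> \<bullet> v)) = 0" by (simp add: l(3))
      moreover have "(\<Sum>\<alpha>\<in>A. l \<alpha> * s) = 0" using l(2) by (simp flip: sum_distrib_right of_int_sum)
      ultimately show ?thesis by (simp add: distrib_left sum.distrib)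
    qed
    have ej: "\<delta> j = vreal j \<bullet> v + s" by (simp add: s_def)
    have "l k * \<delta> k = l k * (vreal k \<bullet> v + s)"
      using \<delta> lin unfolding S e ej by linarith
    then have ek: "\<delta> k = vreal k \<bullet> v + s" using l(1)[OF k] by simp
    have "\<delta> \<alpha> = vreal \<alpha> \<bullet> v + s" if \<alpha>: "\<alpha> \<in> A" for \<alpha>
    proof (cases "\<alpha> = k \<or> \<alpha> = j")
      case True
      then show ?thesis using ek ej by auto
    next
      case False
      then obtain i where "\<alpha> = f i" using \<alpha> rng by blast
      then show ?thesis using e by simp
    qed
    then show "\<exists>s. \<forall>\<alpha>\<in>A. \<delta> \<alpha> = vreal \<alpha> \<bullet> (\<Sum>\<beta>\<in>A. \<delta> \<beta> *\<^sub>R b \<beta>) + s" unfolding v_def by blast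
  qed
qed

section \<open>Counting lifts by the volume of the Newton polytope\<close>

definition int_inner :: "int ^ 'n \<Rightarrow> int ^ 'n \<Rightarrow> int" where
  "int_inner \<alpha> v = (\<Sum>k\<in>UNIV. \<alpha> $ k * v $ k)"

lemma int_inner_simps:
  "int_inner \<alpha> 0 = 0" "int_inner \<alpha> (v + w) = int_inner \<alpha> v + int_inner \<alpha> w"
  "int_inner \<alpha> (- v) = - int_inner \<alpha> v" "int_inner (\<alpha> - \<beta>) v = int_inner \<alpha> v - int_inner \<beta> v"
  by (simp_all add: int_inner_def algebra_simps sum.distrib sum_negf sum_subtractf)

lemma vreal_inner_vreal: "vreal \<alpha> \<bullet> vreal v = of_int (int_inner \<alpha> v)"
  by (simp add: int_inner_def inner_vec_def vreal_def)

lemma bij_betw_image_of_same_kernel: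
  assumes "\<And>x y. x \<in> M \<Longrightarrow> y \<in> M \<Longrightarrow> f x = f y \<longleftrightarrow> g x = g y"
  shows "\<exists>h. bij_betw h (f ` M) (g ` M)"
proof -
  define h where "h z = g (SOME x. x \<in> M \<and> f x = z)" for z
  have h: "h (f x) = g x" if "x \<in> M" for x
  proof -
    have "\<exists>y. y \<in> M \<and> f y = f x" using that by blast
    then have "(SOME y. y \<in> M \<and> f y = f x) \<in> M \<and> f (SOME y. y \<in> M \<and> f y = f x) = f x" by (rule someI_ex)
    then show ?thesis using assms[of "SOME y. y \<in> M \<and> f y = f x" x] that by (simp add: h_def)
  qed
  have "inj_on h (f ` M)"
  proof (rule inj_onI)
    fix z z' assume "z \<in> f ` M" "z' \<in> f ` M" "h z = h z'"
    then obtain x x' where "x \<in> M" "x' \<in> M" "z = f x" "z' = f x'" "g x = g x'" using h by auto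
    then show "z = z'" using assms by simp
  qed
  moreover have "h ` f ` M = g ` M" unfolding image_image using h by (rule image_cong[OF refl])
  ultimately show ?thesis unfolding bij_betw_def by blast
qed

locale circuit_relation =
  fixes A :: "(int ^ 'n::finite) set" and l :: "int ^ 'n \<Rightarrow> int"
  assumes A: "circuit A"
    and l_nonzero: "\<And>\<alpha>. \<alpha> \<in> A \<Longrightarrow> l \<alpha> \<noteq> 0"
    and sum_l: "(\<Sum>\<alpha>\<in>A. l \<alpha>) = 0"
    and sum_l_coord: "\<And>k. (\<Sum>\<alpha>\<in>A. l \<alpha> * \<alpha> $ k) = 0"
    and vol: "\<And>\<alpha>. \<alpha> \<in> A \<Longrightarrow> \<bar>real_of_int (l \<alpha>)\<bar> = simplex_vol A \<alpha>"
begin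

lemma fin: "finite A" and card: "card A = CARD('n) + 2"
  using A by (rule circuit_finite, rule circuit_card)

text \<open>A deck transformation by \<open>2 * pi\<close> times \<open>v\<close> changes the lifts
  by \<open>int_inner \<alpha> v\<close>, and a common constant does not affect a cell; equivalent
  lifts thus describe the same subset of the torus.\<close>

definition eqv :: "(int ^ 'n \<Rightarrow> int) \<Rightarrow> (int ^ 'n \<Rightarrow> int) \<Rightarrow> bool" where
  "eqv m m' \<longleftrightarrow> (\<exists>v c. \<forall>\<alpha>\<in>A. m' \<alpha> = m \<alpha> + int_inner \<alpha> v + c)"

definition cls :: "(int ^ 'n \<Rightarrow> int) \<Rightarrow> (int ^ 'n \<Rightarrow> int) set" where
  "cls m = {m'. eqv m m'}"

text \<open>The part of the weighted phase sum that depends on the lifts, in units of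
  \<open>2 * pi\<close>; the affine relation makes it constant on classes.\<close>

definition K :: "(int ^ 'n \<Rightarrow> int) \<Rightarrow> int" where
  "K m = (\<Sum>\<alpha>\<in>A. l \<alpha> * m \<alpha>)"

definition Cl :: "int set \<Rightarrow> (int ^ 'n \<Rightarrow> int) set set" where
  "Cl Z = cls ` {m. K m \<in> Z}"

lemma eqv_refl: "eqv m m"
  unfolding eqv_def by (intro exI[of _ 0]) (simp add: int_inner_simps)

lemma eqv_sym: "eqv m m' \<Longrightarrow> eqv m' m"
proof -
  assume "eqv m m'"
  then obtain v c where "\<forall>\<alpha>\<in>A. m' \<alpha> = m \<alpha> + int_inner \<alpha> v + c" unfolding eqv_def by blast
  then have "\<forall>\<alpha>\<in>A. m \<alpha> = m' \<alpha> + int_inner \<alpha> (- v) + (- c)" by (simp add: int_inner_simps)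
  then show ?thesis unfolding eqv_def by blast
qed

lemma eqv_trans: "eqv m m' \<Longrightarrow> eqv m' m'' \<Longrightarrow> eqv m m''"
proof -
  assume "eqv m m'" "eqv m' m''"
  then obtain v c v' c' where "\<forall>\<alpha>\<in>A. m' \<alpha> = m \<alpha> + int_inner \<alpha> v + c"
    "\<forall>\<alpha>\<in>A. m'' \<alpha> = m' \<alpha> + int_inner \<alpha> v' + c'" unfolding eqv_def by blast
  then have "\<forall>\<alpha>\<in>A. m'' \<alpha> = m \<alpha> + int_inner \<alpha> (v + v') + (c + c')" by (simp add: int_inner_simps)
  then show ?thesis unfolding eqv_def by blast
qed

lemma cls_eq_iff: "cls m = cls m' \<longleftrightarrow> eqv m m'"
  unfolding cls_def using eqv_refl eqv_sym eqv_trans by blast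

lemma sum_l_int_inner: "(\<Sum>\<alpha>\<in>A. l \<alpha> * int_inner \<alpha> v) = 0"
proof -
  have "(\<Sum>\<alpha>\<in>A. l \<alpha> * int_inner \<alpha> v) = (\<Sum>\<alpha>\<in>A. \<Sum>k\<in>UNIV. l \<alpha> * \<alpha> $ k * v $ k)"
    by (simp add: int_inner_def sum_distrib_left mult.assoc)
  also have "\<dots> = (\<Sum>k\<in>UNIV. (\<Sum>\<alpha>\<in>A. l \<alpha> * \<alpha> $ k) * v $ k)"
    by (subst sum.swap) (simp add: sum_distrib_right)
  finally show ?thesis by (simp add: sum_l_coord)
qed

lemma K_shift: "(\<Sum>\<alpha>\<in>A. l \<alpha> * (m \<alpha> + int_inner \<alpha> v + c)) = K m"
proof -
  have "(\<Sum>\<alpha>\<in>A. l \<alpha> * (m \<alpha> + int_inner \<alpha> v + c)) =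
      K m + (\<Sum>\<alpha>\<in>A. l \<alpha> * int_inner \<alpha> v) + (\<Sum>\<alpha>\<in>A. l \<alpha>) * c"
    by (simp add: K_def distrib_left sum.distrib sum_distrib_right)
  then show ?thesis by (simp add: sum_l_int_inner sum_l)
qed

lemma K_eqv:
  assumes "eqv m m'"
  shows "K m' = K m"
proof -
  obtain v c where "\<forall>\<alpha>\<in>A. m' \<alpha> = m \<alpha> + int_inner \<alpha> v + c" using assms unfolding eqv_def by blast
  then have "K m' = (\<Sum>\<alpha>\<in>A. l \<alpha> * (m \<alpha> + int_inner \<alpha> v + c))"
    unfolding K_def by (intro sum.cong refl) simp
  then show ?thesis unfolding K_shift .
qed

lemma Cl_Un: "Cl (Y \<union> Z) = Cl Y \<union> Cl Z"
  by (auto simp: Cl_def)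

lemma Cl_disjoint: "Y \<inter> Z = {} \<Longrightarrow> Cl Y \<inter> Cl Z = {}"
proof (rule ccontr)
  assume YZ: "Y \<inter> Z = {}" and "Cl Y \<inter> Cl Z \<noteq> {}"
  then obtain m m' where m: "K m \<in> Y" "K m' \<in> Z" "cls m = cls m'" by (auto simp: Cl_def)
  then have "K m' = K m" using K_eqv cls_eq_iff by blast
  then show False using m YZ by auto
qed

lemma K_unique_in_window:
  fixes d z :: int
  assumes "z < x" "x \<le> z + \<bar>d\<bar>" "z < x + d * t" "x + d * t \<le> z + \<bar>d\<bar>" "d \<noteq> 0"
  shows "t = 0"
proof (rule ccontr)
  assume "t \<noteq> 0"
  then have "\<bar>d\<bar> * 1 \<le> \<bar>d\<bar> * \<bar>t\<bar>" by (intro mult_left_mono) auto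
  then have "\<bar>d\<bar> \<le> \<bar>d * t\<bar>" by (simp add: abs_mult)
  then show False using assms by linarith
qed

lemma ex_in_window:
  fixes d z x :: int
  assumes "d \<noteq> 0"
  shows "\<exists>t. z < x + d * t \<and> x + d * t \<le> z + \<bar>d\<bar>"
proof -
  define r where "r = (x - z - 1) mod \<bar>d\<bar>"
  have r: "0 \<le> r" "r < \<bar>d\<bar>" using assms by (simp_all add: r_def)
  have "\<bar>d\<bar> dvd (x - z - 1) - r" by (simp add: r_def minus_mod_eq_mult_div)
  then have "d dvd (x - z - 1) - r" by simp
  then obtain t where "(x - z - 1) - r = d * t" by (rule dvdE)
  then have "x + d * (- t) = z + 1 + r" by simp
  then show ?thesis using r by (intro exI[of _ "- t"]) linarith
qed

text \<open>In a window of \<open>\<bar>l k\<bar>\<close> consecutive values of \<open>K\<close> the coordinate \<open>m k\<close> is determined by the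
  others, so the classes are the cosets of the edge lattice of the simplex without \<open>k\<close>.\<close>

lemma card_Cl_window:
  assumes k: "k \<in> A"
  shows "finite (Cl {z<..z + \<bar>l k\<bar>})" "int (card (Cl {z<..z + \<bar>l k\<bar>})) = \<bar>l k\<bar>"
proof -
  have "\<not> A \<subseteq> {k}"
  proof
    assume "A \<subseteq> {k}"
    then have "card A \<le> card {k}" by (intro card_mono) auto
    then show False using card by simp
  qed
  then obtain j where j: "j \<in> A" "k \<noteq> j" by blast
  obtain f :: "'n wellordered \<Rightarrow> int ^ 'n" where f: "bij_betw f UNIV (A - {k, j})"
    using circuit_enum[OF A k j] CARD_wellordered by metis
  have inj: "inj f" and rng: "range f = A - {k, j}" using f by (auto simp: bij_betw_def)
  define D where "D = edge_matrix f j"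
  have D0: "det (mreal D) \<noteq> 0" unfolding D_def by (rule edge_matrix_det_nonzero[OF A k j f])
  define coset where "coset y = range (\<lambda>a. y + D *v a)" for y
  have card_coset: "finite (range coset)" "real (card (range coset)) = \<bar>det (mreal D)\<bar>"
    unfolding coset_def using card_lattice_cosets[OF D0] by simp_all
  have dv: "\<bar>det (mreal D)\<bar> = \<bar>real_of_int (l k)\<bar>"
    unfolding D_def using simplex_vol_det[OF A k j f] vol[OF k] by simp
  define M where "M = {m. K m \<in> {z<..z + \<bar>l k\<bar>}}"
  \<comment> \<open>Differences to \<open>m j\<close> remove the common constant. The value at
    \<open>k\<close> is left out because the window determines it.\<close>
  define y where "y m = (\<chi> i. m (f i) - m j)" for m :: "int ^ 'n \<Rightarrow> int"
  have Dv: "(D *v relabel v) $ i = int_inner (f i - j) v" for v i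
  proof -
    have "(D *v relabel v) $ i = (\<Sum>i'\<in>UNIV. (f i - j) $ Rep_wellordered i' * v $ Rep_wellordered i')"
      by (simp add: D_def edge_matrix_def matrix_vector_mult_def)
    also have "\<dots> = int_inner (f i - j) v"
      unfolding int_inner_def
      by (rule sum.reindex_bij_witness[of _ Abs_wellordered Rep_wellordered])
         (auto simp: Abs_wellordered_inverse Rep_wellordered_inverse)
    finally show ?thesis .
  qed
  have coset_eq: "coset x = coset x' \<longleftrightarrow> (\<exists>a. x' = x + D *v a)" for x x'
  proof
    assume "coset x = coset x'"
    moreover have "x' \<in> coset x'" unfolding coset_def by (intro image_eqI[of _ _ 0]) auto
    ultimately show "\<exists>a. x' = x + D *v a" by (auto simp: coset_def)
  next
    assume "\<exists>a. x' = x + D *v a"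
    then obtain a where a: "x' = x + D *v a" ..
    show "coset x = coset x'"
    proof
      show "coset x' \<subseteq> coset x"
        unfolding coset_def a by (auto simp: add.assoc simp flip: matrix_vector_right_distrib)
      show "coset x \<subseteq> coset x'"
        unfolding coset_def a
      proof safe
        fix c
        have "x + D *v c = x + D *v a + D *v (c - a)"
          by (simp add: add.assoc flip: matrix_vector_right_distrib)
        then show "x + D *v c \<in> range (\<lambda>b. x + D *v a + D *v b)" by blast
      qed
    qed
  qed
  have A_cases: "\<alpha> = k \<or> \<alpha> = j \<or> (\<exists>i. \<alpha> = f i)" if "\<alpha> \<in> A" for \<alpha> using that rng by blast
  have key: "cls m = cls m' \<longleftrightarrow> (coset \<circ> y) m = (coset \<circ> y) m'" if M: "m \<in> M" "m' \<in> M" for m m'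
  proof
    assume "cls m = cls m'"
    then obtain v c where vc: "\<forall>\<alpha>\<in>A. m' \<alpha> = m \<alpha> + int_inner \<alpha> v + c" unfolding cls_eq_iff eqv_def by blast
    have "y m' = y m + D *v relabel v"
    proof -
      have "f i \<in> A" for i using rng by blast
      then show ?thesis using vc j by (simp add: vec_eq_iff y_def Dv int_inner_simps)
    qed
    then show "(coset \<circ> y) m = (coset \<circ> y) m'" using coset_eq by auto
  next
    assume "(coset \<circ> y) m = (coset \<circ> y) m'"
    then obtain a where a: "y m' = y m + D *v a" using coset_eq by auto
    define v where "v = (\<chi> i. a $ Abs_wellordered i)"
    have av: "a = relabel v" by (simp add: v_def vec_eq_iff Rep_wellordered_inverse)
    define c where "c = m' j - m j - int_inner j v"
    \<comment> \<open>The mismatch at the one index not reached by the edges. It changes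
      \<open>K\<close> by \<open>l k * t\<close>, which a window of length
      \<open>\<bar>l k\<bar>\<close> allows only for \<open>t = 0\<close>.\<close>
    define t where "t = m' k - (m k + int_inner k v + c)"
    have e: "m' \<alpha> = m \<alpha> + int_inner \<alpha> v + c + (if \<alpha> = k then t else 0)" if \<alpha>: "\<alpha> \<in> A" for \<alpha>
    proof -
      consider "\<alpha> = k" | "\<alpha> = j" | i where "\<alpha> = f i" using A_cases[OF \<alpha>] by blast
      then show ?thesis
      proof cases
        case 3
        then have "\<alpha> \<noteq> k" using rng by blast
        moreover have "y m' $ i = y m $ i + int_inner (f i - j) v" unfolding a av by (simp add: Dv)
        ultimately show ?thesis using 3 by (simp add: y_def c_def int_inner_simps)
      qed (use j in \<open>auto simp: t_def c_def\<close>)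
    qed
    have "K m' = (\<Sum>\<alpha>\<in>A. l \<alpha> * (m \<alpha> + int_inner \<alpha> v + c) + l \<alpha> * (if \<alpha> = k then t else 0))"
      unfolding K_def by (intro sum.cong refl) (simp add: e distrib_left)
    also have "\<dots> = K m + l k * t"
      unfolding sum.distrib K_shift using fin k by (simp add: if_distrib[of "(*) _"] cong: if_cong)
    finally have "t = 0" using M K_unique_in_window[of z "K m" "l k" t] l_nonzero[OF k] by (simp add: M_def)
    then show "cls m = cls m'" unfolding cls_eq_iff eqv_def using e by (intro exI[of _ v] exI[of _ c]) simp
  qed
  have ran: "(coset \<circ> y) ` M = range coset"
  proof
    show "range coset \<subseteq> (coset \<circ> y) ` M"
    proof
      fix X assume "X \<in> range coset"
      then obtain x where x: "X = coset x" by blast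
      define m0 where "m0 \<alpha> = (if \<alpha> = k \<or> \<alpha> = j then 0 else x $ inv_into UNIV f \<alpha>)" for \<alpha>
      obtain t where t: "z < K m0 + l k * t" "K m0 + l k * t \<le> z + \<bar>l k\<bar>"
        using ex_in_window[OF l_nonzero[OF k]] by blast
      define m where "m = m0 (k := t)"
      have "K m = (\<Sum>\<alpha>\<in>A. l \<alpha> * m0 \<alpha> + l \<alpha> * (if \<alpha> = k then t else 0))"
        unfolding K_def by (intro sum.cong refl) (simp add: m_def m0_def)
      also have "\<dots> = K m0 + l k * t"
        unfolding sum.distrib K_def using fin k by (simp add: if_distrib[of "(*) _"] cong: if_cong)
      finally have "m \<in> M" using t by (simp add: M_def)
      moreover have "y m = x"
      proof -
        have "m (f i) = x $ i" "m j = 0" for i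
        proof -
          have "f i \<noteq> k" "f i \<noteq> j" using rng by blast+
          then show "m (f i) = x $ i" using inj by (simp add: m_def m0_def)
          show "m j = 0" using j by (simp add: m_def m0_def)
        qed
        then show ?thesis by (simp add: y_def vec_eq_iff)
      qed
      ultimately show "X \<in> (coset \<circ> y) ` M" unfolding x by (intro image_eqI[of _ _ m]) auto
    qed
  qed auto
  have "\<exists>h. bij_betw h (cls ` M) ((coset \<circ> y) ` M)"
    by (rule bij_betw_image_of_same_kernel) (rule key)
  then obtain h where "bij_betw h (cls ` M) ((coset \<circ> y) ` M)" by (rule exE)
  then have "bij_betw h (cls ` M) (range coset)" unfolding ran .
  then have h: "bij_betw h (Cl {z<..z + \<bar>l k\<bar>}) (range coset)" by (simp add: Cl_def M_def)
  show "finite (Cl {z<..z + \<bar>l k\<bar>})" using bij_betw_finite[OF h] card_coset by simp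
  have "real (card (Cl {z<..z + \<bar>l k\<bar>})) = real_of_int \<bar>l k\<bar>"
    using bij_betw_same_card[OF h] card_coset dv by simp
  then show "int (card (Cl {z<..z + \<bar>l k\<bar>})) = \<bar>l k\<bar>" by linarith
qed

text \<open>Windows of lengths \<open>\<bar>l k\<bar>\<close> are laid end to end; as
  \<open>K\<close> is constant on classes, disjoint windows have disjoint sets of classes.\<close>

lemma card_Cl_sum:
  assumes "S \<subseteq> A"
  shows "finite (Cl {z<..z + (\<Sum>k\<in>S. \<bar>l k\<bar>)}) \<and> int (card (Cl {z<..z + (\<Sum>k\<in>S. \<bar>l k\<bar>)})) = (\<Sum>k\<in>S. \<bar>l k\<bar>)"
proof -
  have "finite S" using assms fin finite_subset by blast
  then show ?thesis using assms
  proof (induction S)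
    case empty
    then show ?case by (simp add: Cl_def)
  next
    case (insert k S)
    define s where "s = (\<Sum>k\<in>S. \<bar>l k\<bar>)"
    have s0: "s \<ge> 0" by (simp add: s_def sum_nonneg)
    have IH: "finite (Cl {z<..z + s})" "int (card (Cl {z<..z + s})) = s" using insert by (simp_all add: s_def)
    have k: "k \<in> A" using insert by simp
    have "{z<..z + (\<Sum>k\<in>insert k S. \<bar>l k\<bar>)} = {z<..z + s} \<union> {z + s<..(z + s) + \<bar>l k\<bar>}"
      using insert s0 by (auto simp: s_def)
    then have "Cl {z<..z + (\<Sum>k\<in>insert k S. \<bar>l k\<bar>)} = Cl {z<..z + s} \<union> Cl {z + s<..(z + s) + \<bar>l k\<bar>}"
      by (simp add: Cl_Un)
    moreover have "Cl {z<..z + s} \<inter> Cl {z + s<..(z + s) + \<bar>l k\<bar>} = {}" by (rule Cl_disjoint) auto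
    ultimately show ?case
      using IH card_Cl_window[OF k, of "z + s"] insert by (simp add: card_Un_disjoint s_def)
  qed
qed

section \<open>The volume of the Newton polytope by triangulation\<close>

lemma newton_polytope_eq: "newton_polytope A = convex hull (vreal ` A)"
  by (simp add: newton_polytope_def vreal_def[abs_def])

lemma sum_l_vreal: "(\<Sum>\<alpha>\<in>A. real_of_int (l \<alpha>) *\<^sub>R vreal \<alpha>) = 0"
proof -
  have "(\<Sum>\<alpha>\<in>A. real_of_int (l \<alpha>) *\<^sub>R vreal \<alpha>) $ k = real_of_int (\<Sum>\<alpha>\<in>A. l \<alpha> * \<alpha> $ k)" for k
    by (simp add: vreal_def)
  then show ?thesis by (simp add: vec_eq_iff sum_l_coord)
qed

text \<open>The coefficients are indexed by all of \<open>A\<close>, so that representations in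
  different simplices can be subtracted.\<close>

lemma in_hull_iff:
  assumes "S \<subseteq> A"
  shows "x \<in> convex hull (vreal ` S) \<longleftrightarrow>
    (\<exists>\<mu>. (\<forall>\<alpha>\<in>A. \<mu> \<alpha> \<ge> (0::real)) \<and> (\<forall>\<alpha>\<in>A - S. \<mu> \<alpha> = 0) \<and> (\<Sum>\<alpha>\<in>A. \<mu> \<alpha>) = 1 \<and> (\<Sum>\<alpha>\<in>A. \<mu> \<alpha> *\<^sub>R vreal \<alpha>) = x)"
proof -
  have finS: "finite S" using assms fin finite_subset by blast
  have inj: "inj_on vreal S" by (auto simp: inj_on_def vreal_inject)
  have ext: "(\<Sum>\<alpha>\<in>A. g \<alpha>) = (\<Sum>\<alpha>\<in>S. g \<alpha>)" if "\<And>\<alpha>. \<alpha> \<in> A - S \<Longrightarrow> g \<alpha> = 0" for g :: "int ^ 'n \<Rightarrow> 'z::comm_monoid_add"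
    using fin assms that by (intro sum.mono_neutral_right) auto
  show ?thesis
  proof
    assume "x \<in> convex hull (vreal ` S)"
    then obtain w where w: "\<forall>p\<in>vreal ` S. 0 \<le> w p" "sum w (vreal ` S) = 1" "(\<Sum>p\<in>vreal ` S. w p *\<^sub>R p) = x"
      unfolding convex_hull_finite[OF finite_imageI[OF finS]] by blast
    define \<mu> where "\<mu> \<alpha> = (if \<alpha> \<in> S then w (vreal \<alpha>) else 0)" for \<alpha>
    have "(\<Sum>\<alpha>\<in>A. \<mu> \<alpha>) = 1" using w(2) inj by (subst ext) (simp_all add: \<mu>_def sum.reindex)
    moreover have "(\<Sum>\<alpha>\<in>A. \<mu> \<alpha> *\<^sub>R vreal \<alpha>) = x"
      using w(3) inj by (subst ext) (simp_all add: \<mu>_def sum.reindex)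
    moreover have "\<forall>\<alpha>\<in>A. \<mu> \<alpha> \<ge> 0" "\<forall>\<alpha>\<in>A - S. \<mu> \<alpha> = 0" using w(1) by (auto simp: \<mu>_def)
    ultimately show "\<exists>\<mu>. (\<forall>\<alpha>\<in>A. \<mu> \<alpha> \<ge> (0::real)) \<and> (\<forall>\<alpha>\<in>A - S. \<mu> \<alpha> = 0) \<and> (\<Sum>\<alpha>\<in>A. \<mu> \<alpha>) = 1 \<and> (\<Sum>\<alpha>\<in>A. \<mu> \<alpha> *\<^sub>R vreal \<alpha>) = x"
      by blast
  next
    assume "\<exists>\<mu>. (\<forall>\<alpha>\<in>A. \<mu> \<alpha> \<ge> (0::real)) \<and> (\<forall>\<alpha>\<in>A - S. \<mu> \<alpha> = 0) \<and> (\<Sum>\<alpha>\<in>A. \<mu> \<alpha>) = 1 \<and> (\<Sum>\<alpha>\<in>A. \<mu> \<alpha> *\<^sub>R vreal \<alpha>) = x"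
    then obtain \<mu> where \<mu>: "\<forall>\<alpha>\<in>A. \<mu> \<alpha> \<ge> (0::real)" "\<forall>\<alpha>\<in>A - S. \<mu> \<alpha> = 0" "(\<Sum>\<alpha>\<in>A. \<mu> \<alpha>) = 1"
      "(\<Sum>\<alpha>\<in>A. \<mu> \<alpha> *\<^sub>R vreal \<alpha>) = x" by blast
    have "(\<Sum>\<alpha>\<in>S. \<mu> \<alpha>) = 1" using \<mu>(2,3) by (subst (asm) ext) simp_all
    moreover have "(\<Sum>\<alpha>\<in>S. \<mu> \<alpha> *\<^sub>R vreal \<alpha>) = x" using \<mu>(2,4) by (subst (asm) ext) simp_all
    moreover have "(\<Sum>\<alpha>\<in>S. \<mu> \<alpha> *\<^sub>R vreal \<alpha>) \<in> convex hull (vreal ` S)"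
      using calculation(1) \<mu>(1) assms finS by (intro convex_sum) (auto intro: hull_inc)
    ultimately show "x \<in> convex hull (vreal ` S)" by simp
  qed
qed

text \<open>Subtract the multiple of \<open>l\<close> that cancels the coefficient at
  \<open>k\<close>; what remains vanishes by \<open>circuit_independent\<close>.\<close>

lemma dependency_multiple:
  fixes y :: "int ^ 'n \<Rightarrow> real"
  assumes "(\<Sum>\<alpha>\<in>A. y \<alpha>) = 0" "(\<Sum>\<alpha>\<in>A. y \<alpha> *\<^sub>R vreal \<alpha>) = 0"
  obtains \<tau> :: real where "\<And>\<alpha>. \<alpha> \<in> A \<Longrightarrow> y \<alpha> = \<tau> * l \<alpha>"
proof -
  obtain k where k: "k \<in> A" using card by fastforce
  define \<tau> where "\<tau> = y k / l k"
  define y' where "y' \<alpha> = y \<alpha> - \<tau> * l \<alpha>" for \<alpha>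
  have y'k: "y' k = 0" using l_nonzero[OF k] by (simp add: y'_def \<tau>_def)
  have s1: "(\<Sum>\<alpha>\<in>A. y' \<alpha>) = 0"
  proof -
    have "(\<Sum>\<alpha>\<in>A. y' \<alpha>) = (\<Sum>\<alpha>\<in>A. y \<alpha>) - \<tau> * real_of_int (\<Sum>\<alpha>\<in>A. l \<alpha>)"
      by (simp add: y'_def sum_subtractf sum_distrib_left)
    then show ?thesis using assms(1) sum_l by simp
  qed
  have s2: "(\<Sum>\<alpha>\<in>A. y' \<alpha> *\<^sub>R vreal \<alpha>) = 0"
  proof -
    have "(\<Sum>\<alpha>\<in>A. y' \<alpha> *\<^sub>R vreal \<alpha>) = (\<Sum>\<alpha>\<in>A. y \<alpha> *\<^sub>R vreal \<alpha>) - \<tau> *\<^sub>R (\<Sum>\<alpha>\<in>A. real_of_int (l \<alpha>) *\<^sub>R vreal \<alpha>)"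
      by (simp add: y'_def scaleR_diff_left sum_subtractf scaleR_sum_right)
    then show ?thesis using assms(2) sum_l_vreal by simp
  qed
  have "\<forall>\<alpha>\<in>A - {k}. y' \<alpha> = 0"
  proof (rule circuit_independent[OF A k])
    show "(\<Sum>\<alpha>\<in>A - {k}. y' \<alpha>) = 0" using s1 sum.remove[OF fin k, of y'] y'k by simp
    show "(\<Sum>\<alpha>\<in>A - {k}. y' \<alpha> *\<^sub>R vreal \<alpha>) = 0"
      using s2 sum.remove[OF fin k, of "\<lambda>\<alpha>. y' \<alpha> *\<^sub>R vreal \<alpha>"] y'k by simp
  qed
  then show thesis using y'k by (intro that[of \<tau>]) (auto simp: y'_def)
qed

text \<open>The simplices without one positive index triangulate the polytope: subtract from a convex
  combination the largest admissible multiple of the relation \<open>l\<close>.\<close>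

lemma hull_triangulation: "convex hull (vreal ` A) = (\<Union>k\<in>{k \<in> A. l k > 0}. convex hull (vreal ` (A - {k})))"
proof
  show "(\<Union>k\<in>{k \<in> A. l k > 0}. convex hull (vreal ` (A - {k}))) \<subseteq> convex hull (vreal ` A)"
    by (intro UN_least hull_mono) auto
  show "convex hull (vreal ` A) \<subseteq> (\<Union>k\<in>{k \<in> A. l k > 0}. convex hull (vreal ` (A - {k})))"
  proof
    fix x assume "x \<in> convex hull (vreal ` A)"
    then obtain \<mu> where \<mu>: "\<forall>\<alpha>\<in>A. \<mu> \<alpha> \<ge> (0::real)" "(\<Sum>\<alpha>\<in>A. \<mu> \<alpha>) = 1" "(\<Sum>\<alpha>\<in>A. \<mu> \<alpha> *\<^sub>R vreal \<alpha>) = x"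
      using in_hull_iff[of A x] by auto
    define T where "T = (\<lambda>k. \<mu> k / l k) ` {k \<in> A. l k > 0}"
    have "{k \<in> A. l k > 0} \<noteq> {}"
    proof
      assume "{k \<in> A. l k > 0} = {}"
      then have "\<forall>\<alpha>\<in>A. - l \<alpha> > 0" using l_nonzero by force
      moreover have "A \<noteq> {}" using card by auto
      ultimately have "(\<Sum>\<alpha>\<in>A. - l \<alpha>) > 0" using fin by (intro sum_pos) auto
      then show False using sum_l by (simp add: sum_negf)
    qed
    then have T: "finite T" "T \<noteq> {}" using fin by (auto simp: T_def)
    define \<tau> where "\<tau> = Min T"
    have "\<tau> \<in> T" using Min_in[OF T] by (simp add: \<tau>_def)
    then obtain k where k': "\<tau> = \<mu> k / l k" "k \<in> {k \<in> A. l k > 0}" unfolding T_def by (rule imageE)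
    have k: "k \<in> A" "l k > 0" "\<tau> = \<mu> k / l k" using k' by simp_all
    have \<tau>0: "\<tau> \<ge> 0" unfolding k(3) using \<mu>(1) k by simp
    have \<tau>le: "\<tau> \<le> \<mu> \<alpha> / l \<alpha>" if "\<alpha> \<in> A" "l \<alpha> > 0" for \<alpha>
      unfolding \<tau>_def using T(1) that by (intro Min_le) (auto simp: T_def)
    define \<nu> where "\<nu> \<alpha> = \<mu> \<alpha> - \<tau> * l \<alpha>" for \<alpha>
    have "\<nu> \<alpha> \<ge> 0" if "\<alpha> \<in> A" for \<alpha>
    proof (cases "l \<alpha> > 0")
      case True
      then show ?thesis using \<tau>le[OF that True] by (simp add: \<nu>_def field_simps)
    next
      case False
      then have "\<tau> * l \<alpha> \<le> 0" using \<tau>0 by (simp add: mult_nonneg_nonpos)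
      moreover have "\<mu> \<alpha> \<ge> 0" using \<mu>(1) that by simp
      ultimately show ?thesis by (simp add: \<nu>_def)
    qed
    moreover have "\<nu> k = 0" using k by (simp add: \<nu>_def)
    moreover have "(\<Sum>\<alpha>\<in>A. \<nu> \<alpha>) = 1"
    proof -
      have "(\<Sum>\<alpha>\<in>A. \<nu> \<alpha>) = (\<Sum>\<alpha>\<in>A. \<mu> \<alpha>) - \<tau> * real_of_int (\<Sum>\<alpha>\<in>A. l \<alpha>)"
        by (simp add: \<nu>_def sum_subtractf sum_distrib_left)
      then show ?thesis using \<mu>(2) sum_l by simp
    qed
    moreover have "(\<Sum>\<alpha>\<in>A. \<nu> \<alpha> *\<^sub>R vreal \<alpha>) = x"
    proof -
      have "(\<Sum>\<alpha>\<in>A. \<nu> \<alpha> *\<^sub>R vreal \<alpha>) = (\<Sum>\<alpha>\<in>A. \<mu> \<alpha> *\<^sub>R vreal \<alpha>) - \<tau> *\<^sub>R (\<Sum>\<alpha>\<in>A. real_of_int (l \<alpha>) *\<^sub>R vreal \<alpha>)"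
        by (simp add: \<nu>_def scaleR_diff_left sum_subtractf scaleR_sum_right)
      then show ?thesis using \<mu>(3) sum_l_vreal by simp
    qed
    ultimately have "\<exists>\<mu>. (\<forall>\<alpha>\<in>A. \<mu> \<alpha> \<ge> (0::real)) \<and> (\<forall>\<alpha>\<in>A - (A - {k}). \<mu> \<alpha> = 0) \<and> (\<Sum>\<alpha>\<in>A. \<mu> \<alpha>) = 1 \<and> (\<Sum>\<alpha>\<in>A. \<mu> \<alpha> *\<^sub>R vreal \<alpha>) = x"
      by (intro exI[of _ \<nu>]) auto
    then have "x \<in> convex hull (vreal ` (A - {k}))" using in_hull_iff[of "A - {k}" x] by auto
    then show "x \<in> (\<Union>k\<in>{k \<in> A. l k > 0}. convex hull (vreal ` (A - {k})))" using k by blast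
  qed
qed

text \<open>Two representations of a common point differ by \<open>\<tau>\<close> times
  \<open>l\<close>. The coefficient at \<open>k\<close> gives \<open>\<tau> \<ge> 0\<close>, and
  then the one at \<open>j\<close> forces \<open>\<mu> j = 0\<close>. So the point lies in the hull
  of only \<open>n\<close> points, which has empty interior.\<close>

lemma negligible_overlap:
  assumes k: "k \<in> A" "l k > 0" and j: "j \<in> A" "l j > 0" and kj: "k \<noteq> j"
  shows "negligible (convex hull (vreal ` (A - {k})) \<inter> convex hull (vreal ` (A - {j})))"
proof -
  have sub: "convex hull (vreal ` (A - {k})) \<inter> convex hull (vreal ` (A - {j})) \<subseteq> convex hull (vreal ` (A - {k, j}))"
  proof
    fix x assume "x \<in> convex hull (vreal ` (A - {k})) \<inter> convex hull (vreal ` (A - {j}))"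
    then obtain \<mu> \<nu> where \<mu>: "\<forall>\<alpha>\<in>A. \<mu> \<alpha> \<ge> (0::real)" "\<mu> k = 0" "(\<Sum>\<alpha>\<in>A. \<mu> \<alpha>) = 1" "(\<Sum>\<alpha>\<in>A. \<mu> \<alpha> *\<^sub>R vreal \<alpha>) = x"
      and \<nu>: "\<forall>\<alpha>\<in>A. \<nu> \<alpha> \<ge> (0::real)" "\<nu> j = 0" "(\<Sum>\<alpha>\<in>A. \<nu> \<alpha>) = 1" "(\<Sum>\<alpha>\<in>A. \<nu> \<alpha> *\<^sub>R vreal \<alpha>) = x"
      using in_hull_iff[of "A - {k}" x] in_hull_iff[of "A - {j}" x] k j by auto
    obtain \<tau> :: real where \<tau>: "\<And>\<alpha>. \<alpha> \<in> A \<Longrightarrow> \<nu> \<alpha> - \<mu> \<alpha> = \<tau> * l \<alpha>"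
    proof (rule dependency_multiple)
      show "(\<Sum>\<alpha>\<in>A. \<nu> \<alpha> - \<mu> \<alpha>) = 0" using \<mu>(3) \<nu>(3) by (simp add: sum_subtractf)
      show "(\<Sum>\<alpha>\<in>A. (\<nu> \<alpha> - \<mu> \<alpha>) *\<^sub>R vreal \<alpha>) = 0"
        using \<mu>(4) \<nu>(4) by (simp add: scaleR_diff_left sum_subtractf)
    qed (rule that)
    have "\<tau> * l k \<ge> 0" using \<tau>[OF k(1)] \<mu>(2) \<nu>(1) k(1) by fastforce
    then have "\<tau> \<ge> 0" using k(2) by (simp add: zero_le_mult_iff)
    then have "\<tau> * l j \<ge> 0" using j(2) by simp
    moreover have "\<tau> * l j = - \<mu> j" using \<tau>[OF j(1)] \<nu>(2) by simp
    moreover have "\<mu> j \<ge> 0" using \<mu>(1) j(1) by simp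
    ultimately have "\<mu> j = 0" by linarith
    then have "\<exists>\<mu>. (\<forall>\<alpha>\<in>A. \<mu> \<alpha> \<ge> (0::real)) \<and> (\<forall>\<alpha>\<in>A - (A - {k, j}). \<mu> \<alpha> = 0) \<and> (\<Sum>\<alpha>\<in>A. \<mu> \<alpha>) = 1 \<and> (\<Sum>\<alpha>\<in>A. \<mu> \<alpha> *\<^sub>R vreal \<alpha>) = x"
      using \<mu> by (intro exI[of _ \<mu>]) auto
    then show "x \<in> convex hull (vreal ` (A - {k, j}))" using in_hull_iff[of "A - {k, j}" x] by auto
  qed
  have "card (A - {k, j}) = CARD('n)"
  proof -
    have "card (A - {k, j}) = card A - card {k, j}" using k j fin by (intro card_Diff_subset) auto
    then show ?thesis using kj card by simp
  qed
  then have "aff_dim (vreal ` (A - {k, j})) < CARD('n)"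
    using fin aff_dim_le_card[of "vreal ` (A - {k, j})"] card_image_le[of "A - {k, j}" vreal] by simp
  then have "interior (convex hull (vreal ` (A - {k, j}))) = {}"
    using aff_dim_nonempty_interior[of "convex hull (vreal ` (A - {k, j}))"] by (auto simp: aff_dim_convex_hull)
  then have "negligible (convex hull (vreal ` (A - {k, j})))"
    by (rule negligible_convex_interior[THEN iffD2, rotated]) simp
  then show ?thesis using sub negligible_subset by blast
qed

lemma volume: "fact CARD('n) * measure lebesgue (newton_polytope A) = real_of_int (\<Sum>k | k \<in> A \<and> l k > 0. \<bar>l k\<bar>)"
proof -
  let ?S = "{k \<in> A. l k > 0}"
  have "measure lebesgue (newton_polytope A) = (\<Sum>k\<in>?S. measure lebesgue (convex hull (vreal ` (A - {k}))))"
    unfolding newton_polytope_eq hull_triangulation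
  proof (rule measure_negligible_finite_Union_image)
    show "finite ?S" using fin by simp
    show "convex hull (vreal ` (A - {k})) \<in> lmeasurable" for k
      using fin by (intro lmeasurable_compact finite_imp_compact_convex_hull) simp
    show "pairwise (\<lambda>k j. negligible (convex hull (vreal ` (A - {k})) \<inter> convex hull (vreal ` (A - {j})))) ?S"
      unfolding pairwise_def using negligible_overlap by blast
  qed
  then have "fact CARD('n) * measure lebesgue (newton_polytope A) = (\<Sum>k\<in>?S. simplex_vol A k)"
    by (simp add: simplex_vol_def sum_distrib_left)
  also have "\<dots> = (\<Sum>k\<in>?S. \<bar>real_of_int (l k)\<bar>)" by (intro sum.cong refl) (simp add: vol[symmetric])
  finally show ?thesis by simp
qed

end

section \<open>Lopsidedness and the zero locus\<close>

lemma closure_half_space: "closure (half_space \<phi>) = {z. Re (cis \<phi> * z) \<ge> 0}"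
  and frontier_half_space: "frontier (half_space \<phi>) = {z. Re (cis \<phi> * z) = 0}"
proof -
  have i: "Re (cis \<phi> * z) = inner (cis (- \<phi>)) z" for z
    by (simp add: inner_complex_def)
  have "cis (- \<phi>) \<noteq> 0" by simp
  from closure_halfspace_gt[OF this, of 0] frontier_halfspace_gt[OF disjI1[OF this], of 0]
  show "closure (half_space \<phi>) = {z. Re (cis \<phi> * z) \<ge> 0}"
    "frontier (half_space \<phi>) = {z. Re (cis \<phi> * z) = 0}"
    unfolding half_space_def i by simp_all
qed

lemma lopsided_of_half_plane:
  assumes "S \<noteq> {}" "\<And>z. z \<in> S \<Longrightarrow> Re (cis \<phi> * z) > 0"
  shows "lopsided S"
  unfolding lopsided_def closure_half_space frontier_half_space
  using assms by (intro exI[of _ \<phi>]) fastforce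

lemma not_lopsided_of_combination:
  fixes t w :: "'a \<Rightarrow> real"
  assumes fin: "finite B" and t: "\<And>x. x \<in> B \<Longrightarrow> t x > 0" and s: "(\<Sum>x\<in>B. t x * cis (w x)) = 0"
  shows "\<not> lopsided {cis (w x) | x. x \<in> B}"
proof
  assume "lopsided {cis (w x) | x. x \<in> B}"
  then obtain \<phi> where \<phi>: "\<And>x. x \<in> B \<Longrightarrow> Re (cis \<phi> * cis (w x)) \<ge> 0"
    "\<exists>x\<in>B. Re (cis \<phi> * cis (w x)) \<noteq> 0"
    unfolding lopsided_def closure_half_space frontier_half_space by blast
  have "(\<Sum>x\<in>B. t x * Re (cis \<phi> * cis (w x))) = Re (cis \<phi> * (\<Sum>x\<in>B. t x * cis (w x)))"
    unfolding sum_distrib_left Re_sum by (intro sum.cong refl) (simp add: algebra_simps)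
  then have "(\<Sum>x\<in>B. t x * Re (cis \<phi> * cis (w x))) = 0" unfolding s by simp
  then have "\<forall>x\<in>B. t x * Re (cis \<phi> * cis (w x)) = 0"
    using fin t \<phi>(1) by (subst (asm) sum_nonneg_eq_0_iff) (auto intro!: mult_nonneg_nonneg simp: less_imp_le)
  then show False using \<phi>(2) t by force
qed

lemma finite_components_card:
  assumes "finite \<C>" "real (card \<C>) = r" "\<exists>h. bij_betw h \<C> (components S)"
  shows "has_components S r"
proof -
  obtain h where h: "bij_betw h \<C> (components S)" using assms(3) by blast
  show ?thesis
    using bij_betw_finite[OF h] bij_betw_same_card[OF h] assms(1,2) by (simp add: has_components_def)
qed

lemma prod_cis: "(\<Prod>x\<in>S. cis (w x)) = cis (\<Sum>x\<in>S. w x)"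
  by (induction S rule: infinite_finite_induct) (simp_all add: cis_mult)

locale generic_coefficients = circuit_relation A l
  for A :: "(int ^ 'n::finite) set" and l :: "int ^ 'n \<Rightarrow> int" +
  fixes b :: "int ^ 'n \<Rightarrow> real ^ 'n" and c :: "int ^ 'n \<Rightarrow> complex"
  assumes b: "\<And>\<delta> :: int ^ 'n \<Rightarrow> real. (\<Sum>\<alpha>\<in>A. l \<alpha> * \<delta> \<alpha>) = 0 \<Longrightarrow>
      \<exists>s. \<forall>\<alpha>\<in>A. \<delta> \<alpha> = vreal \<alpha> \<bullet> (\<Sum>\<beta>\<in>A. \<delta> \<beta> *\<^sub>R b \<beta>) + s"
    and c0: "\<And>\<alpha>. \<alpha> \<in> A \<Longrightarrow> c \<alpha> \<noteq> 0"
    and Im_prod: "Im (\<Prod>\<alpha>\<in>A. c \<alpha> powi l \<alpha>) \<noteq> 0"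
begin

text \<open>The weighted sum of the arguments is an argument of the product of the
  \<open>c \<alpha> powi l \<alpha>\<close>.\<close>

lemma sin_phase_nonzero: "sin (\<Sum>\<alpha>\<in>A. l \<alpha> * Arg (c \<alpha>)) \<noteq> 0"
proof -
  have "(\<Prod>\<alpha>\<in>A. c \<alpha> powi l \<alpha>) = (\<Prod>\<alpha>\<in>A. of_real (cmod (c \<alpha>) powi l \<alpha>) * cis (l \<alpha> * Arg (c \<alpha>)))"
  proof (intro prod.cong refl)
    fix \<alpha>
    have "c \<alpha> = of_real (cmod (c \<alpha>)) * cis (Arg (c \<alpha>))" using rcis_cmod_Arg[of "c \<alpha>"] by (simp add: rcis_def)
    then have "c \<alpha> powi l \<alpha> = (of_real (cmod (c \<alpha>)) * cis (Arg (c \<alpha>))) powi l \<alpha>" by simp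
    then show "c \<alpha> powi l \<alpha> = of_real (cmod (c \<alpha>) powi l \<alpha>) * cis (l \<alpha> * Arg (c \<alpha>))"
      by (simp add: power_int_mult_distrib cis_power_int of_real_power_int)
  qed
  also have "\<dots> = of_real (\<Prod>\<alpha>\<in>A. cmod (c \<alpha>) powi l \<alpha>) * cis (\<Sum>\<alpha>\<in>A. l \<alpha> * Arg (c \<alpha>))"
    by (simp add: prod.distrib prod_cis)
  finally have "Im (\<Prod>\<alpha>\<in>A. c \<alpha> powi l \<alpha>) =
      (\<Prod>\<alpha>\<in>A. cmod (c \<alpha>) powi l \<alpha>) * sin (\<Sum>\<alpha>\<in>A. l \<alpha> * Arg (c \<alpha>))"
    by (simp only: Im_complex_of_real Re_complex_of_real times_complex.sel cis.sel)
  then show ?thesis using Im_prod by auto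
qed

sublocale ph: phased_circuit A l b "\<lambda>\<alpha>. Arg (c \<alpha>)" "\<Sum>\<alpha>\<in>A. l \<alpha> * ln (cmod (c \<alpha>))"
  using fin card l_nonzero sum_l sum_l_coord b sin_phase_nonzero by unfold_locales

text \<open>A positive solution excludes lopsidedness and an open half-plane implies it.
  Configurations in between, with some directions on the boundary line, are settled by taking
  closures and \<open>closure_Sol\<close>.\<close>

lemma vimage_closure_lopsided: "proj -` closure (lopsided_coamoeba A c) = - ph.Th"
proof -
  define L where "L = proj -` lopsided_coamoeba A c"
  have md: "monomial_directions A c (proj x) = {cis (ph.u x \<alpha>) | \<alpha>. \<alpha> \<in> A}" for x
    unfolding monomial_directions_proj ph.u_def ..
  have 1: "{x. ph.Sol x \<noteq> {}} \<subseteq> L"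
  proof
    fix x assume "x \<in> {x. ph.Sol x \<noteq> {}}"
    then obtain t where "t \<in> ph.Sol x" by blast
    then have "\<not> lopsided {cis (ph.u x \<alpha>) | \<alpha>. \<alpha> \<in> A}"
      using fin by (intro not_lopsided_of_combination[of A t]) (auto simp: ph.Sol_def)
    then show "x \<in> L" by (simp add: L_def lopsided_coamoeba_def md)
  qed
  have 2: "L \<subseteq> - ph.Th"
  proof
    fix x assume x: "x \<in> L"
    show "x \<in> - ph.Th"
    proof
      assume "x \<in> ph.Th"
      then obtain \<phi> where \<phi>: "\<forall>\<alpha>\<in>A. cos (\<phi> + ph.u x \<alpha>) > 0" unfolding ph.Th_iff_half_plane by blast
      have "lopsided {cis (ph.u x \<alpha>) | \<alpha>. \<alpha> \<in> A}"
      proof (rule lopsided_of_half_plane[of _ \<phi>])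
        show "{cis (ph.u x \<alpha>) | \<alpha>. \<alpha> \<in> A} \<noteq> {}" using ph.A_nonempty by blast
        show "0 < Re (cis \<phi> * z)" if z: "z \<in> {cis (ph.u x \<alpha>) | \<alpha>. \<alpha> \<in> A}" for z
        proof -
          obtain \<alpha> where \<alpha>: "\<alpha> \<in> A" "z = cis (ph.u x \<alpha>)" using z by blast
          show ?thesis unfolding \<alpha>(2) cis_mult cis.sel using \<phi> \<alpha>(1) by blast
        qed
      qed
      then show False using x by (simp add: L_def lopsided_coamoeba_def md)
    qed
  qed
  have "closure L = - ph.Th"
  proof
    show "closure L \<subseteq> - ph.Th" using 2 ph.open_Th by (intro closure_minimal) (auto simp: closed_def)
    show "- ph.Th \<subseteq> closure L" unfolding ph.closure_Sol[symmetric] using 1 by (rule closure_mono)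
  qed
  then show ?thesis unfolding closure_proj_vimage L_def .
qed

lemma laurent_polar:
  assumes z: "\<And>k. z $ k = of_real (exp (y $ k)) * cis (x $ k)"
  shows "laurent A c z = (\<Sum>\<alpha>\<in>A. (cmod (c \<alpha>) * exp (vreal \<alpha> \<bullet> y)) * cis (ph.u x \<alpha>))"
  unfolding laurent_def
proof (intro sum.cong refl)
  fix \<alpha>
  have "(\<Prod>k\<in>UNIV. z $ k powi \<alpha> $ k) = (\<Prod>k\<in>UNIV. of_real (exp (\<alpha> $ k * y $ k)) * cis (\<alpha> $ k * x $ k))"
    by (intro prod.cong refl) (simp add: z power_int_mult_distrib cis_power_int exp_power_int flip: of_real_power_int)
  also have "\<dots> = of_real (exp (vreal \<alpha> \<bullet> y)) * cis (vreal \<alpha> \<bullet> x)"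
    by (simp add: prod.distrib prod_cis exp_sum inner_vec_def vreal_def flip: of_real_prod)
  finally have p: "(\<Prod>k\<in>UNIV. z $ k powi \<alpha> $ k) = of_real (exp (vreal \<alpha> \<bullet> y)) * cis (vreal \<alpha> \<bullet> x)" .
  have "c \<alpha> = of_real (cmod (c \<alpha>)) * cis (Arg (c \<alpha>))" using rcis_cmod_Arg[of "c \<alpha>"] by (simp add: rcis_def)
  then have "c \<alpha> * (\<Prod>k\<in>UNIV. z $ k powi \<alpha> $ k) =
      (of_real (cmod (c \<alpha>)) * cis (Arg (c \<alpha>))) * (of_real (exp (vreal \<alpha> \<bullet> y)) * cis (vreal \<alpha> \<bullet> x))"
    unfolding p by simp
  also have "\<dots> = of_real (cmod (c \<alpha>) * exp (vreal \<alpha> \<bullet> y)) * cis (ph.u x \<alpha>)"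
    by (simp add: ph.u_def mult_ac flip: cis_mult)
  finally show "c \<alpha> * (\<Prod>k\<in>UNIV. z $ k powi \<alpha> $ k) = (cmod (c \<alpha>) * exp (vreal \<alpha> \<bullet> y)) * cis (ph.u x \<alpha>)" .
qed

text \<open>The logarithmic moduli \<open>y\<close> of a point add the linear function
  \<open>vreal \<alpha> \<bullet> y\<close> to the logarithms of the coefficient moduli, which
  leaves \<open>h\<close> unchanged. Conversely the equation for \<open>h\<close> yields an affine
  function; its slope is \<open>y\<close>, and its constant only rescales the value of the
  polynomial.\<close>

lemma vimage_coamoeba: "proj -` coamoeba A c = ph.Coam"
proof
  have abs_Arg: "abs_angle (Arg w) = abs_angle r" if "w = of_real (exp q) * cis r" for w q r
  proof -
    have w0: "w \<noteq> 0" using that by simp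
    have "cis (Arg w) = cis r" using w0 that by (simp add: cis_Arg sgn_mult sgn_of_real)
    then have "sin (Arg w) = sin r" "cos (Arg w) = cos r" by (auto simp: complex_eq_iff)
    then obtain k :: int where "Arg w = r + 2 * pi * of_int k" using sin_cos_eq_iff[of "Arg w" r] by auto
    then show ?thesis unfolding abs_angle_eq_iff by (intro exI[of _ "- k"]) simp
  qed
  show "ph.Coam \<subseteq> proj -` coamoeba A c"
  proof
    fix x assume "x \<in> ph.Coam"
    then obtain t where t: "t \<in> ph.Sol x" "ph.h t = (\<Sum>\<alpha>\<in>A. l \<alpha> * ln (cmod (c \<alpha>)))" by (auto simp: ph.Coam_def)
    define \<delta> where "\<delta> \<alpha> = ln (t \<alpha>) - ln (cmod (c \<alpha>))" for \<alpha>
    have "(\<Sum>\<alpha>\<in>A. l \<alpha> * \<delta> \<alpha>) = 0"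
      using t(2) by (simp add: \<delta>_def ph.h_def right_diff_distrib sum_subtractf)
    then obtain y s where y: "\<And>\<alpha>. \<alpha> \<in> A \<Longrightarrow> vreal \<alpha> \<bullet> y = \<delta> \<alpha> - s" by (rule ph.dual_direction) (rule that)
    define z where "z = (\<chi> k. of_real (exp (y $ k)) * cis (x $ k))"
    have zk: "z $ k = of_real (exp (y $ k)) * cis (x $ k)" for k by (simp add: z_def)
    have "laurent A c z = (\<Sum>\<alpha>\<in>A. exp (- s) * (t \<alpha> * cis (ph.u x \<alpha>)))"
      unfolding laurent_polar[OF zk]
    proof (intro sum.cong refl)
      fix \<alpha> assume \<alpha>: "\<alpha> \<in> A"
      have "t \<alpha> > 0" "cmod (c \<alpha>) > 0" using t(1) c0 \<alpha> by (auto simp: ph.Sol_def)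
      then have "exp (\<delta> \<alpha>) * cmod (c \<alpha>) = t \<alpha>" unfolding \<delta>_def exp_diff by simp
      then have "cmod (c \<alpha>) * exp (vreal \<alpha> \<bullet> y) = exp (- s) * t \<alpha>"
        unfolding y[OF \<alpha>] exp_diff by (simp add: exp_minus field_simps)
      then show "complex_of_real (cmod (c \<alpha>) * exp (vreal \<alpha> \<bullet> y)) * cis (ph.u x \<alpha>) = exp (- s) * (t \<alpha> * cis (ph.u x \<alpha>))"
        by simp
    qed
    also have "\<dots> = 0" unfolding sum_distrib_left[symmetric] using t(1) by (simp add: ph.Sol_def)
    finally have "z \<in> zero_locus A c" by (simp add: zero_locus_def zk)
    moreover have "(\<chi> k. arg_angle (z $ k)) = proj x"
      by (simp add: vec_eq_iff proj_def arg_angle_def abs_Arg[OF zk])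
    ultimately show "x \<in> proj -` coamoeba A c" unfolding coamoeba_def by force
  qed
  show "proj -` coamoeba A c \<subseteq> ph.Coam"
  proof
    fix x assume "x \<in> proj -` coamoeba A c"
    then obtain z where z: "z \<in> zero_locus A c" "proj x = (\<chi> k. arg_angle (z $ k))"
      unfolding coamoeba_def by auto
    define y where "y = (\<chi> k. ln (cmod (z $ k)))"
    have z0: "z $ k \<noteq> 0" for k using z(1) by (simp add: zero_locus_def)
    have zk: "z $ k = of_real (exp (y $ k)) * cis (x $ k)" for k
    proof -
      have "abs_angle (x $ k) = abs_angle (Arg (z $ k))"
        using z(2) by (simp add: proj_def vec_eq_iff arg_angle_def)
      then obtain j :: int where "Arg (z $ k) = x $ k + of_int j * (2 * pi)" unfolding abs_angle_eq_iff by blast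
      then have "cis (Arg (z $ k)) = cis (x $ k)" using cis_shift_int[of "x $ k" j] by (simp add: mult.commute)
      moreover have "z $ k = of_real (cmod (z $ k)) * cis (Arg (z $ k))"
        using rcis_cmod_Arg[of "z $ k"] by (simp add: rcis_def)
      ultimately show ?thesis using z0[of k] by (simp add: y_def)
    qed
    define t where "t \<alpha> = cmod (c \<alpha>) * exp (vreal \<alpha> \<bullet> y)" for \<alpha>
    have "t \<in> ph.Sol x"
      unfolding ph.Sol_def
    proof (intro CollectI conjI ballI)
      show "t \<alpha> > 0" if "\<alpha> \<in> A" for \<alpha> using c0[OF that] by (simp add: t_def)
      show "(\<Sum>\<alpha>\<in>A. t \<alpha> * cis (ph.u x \<alpha>)) = 0"
        using laurent_polar[OF zk] z(1) by (simp add: t_def zero_locus_def)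
    qed
    moreover have "ph.h t = (\<Sum>\<alpha>\<in>A. l \<alpha> * ln (cmod (c \<alpha>)))"
    proof -
      have "ph.h t = (\<Sum>\<alpha>\<in>A. l \<alpha> * ln (cmod (c \<alpha>)) + l \<alpha> * (vreal \<alpha> \<bullet> y))"
        unfolding ph.h_def
        by (intro sum.cong refl) (simp add: t_def ln_mult c0 distrib_left)
      then show ?thesis by (simp add: sum.distrib ph.sum_l_inner)
    qed
    ultimately show "x \<in> ph.Coam" by (auto simp: ph.Coam_def)
  qed
qed

section \<open>Cells modulo deck transformations\<close>

lemma u_translate: "ph.u (x + (2 * pi) *\<^sub>R vreal v) \<alpha> = ph.u x \<alpha> + 2 * pi * int_inner \<alpha> v"
  by (simp add: ph.u_def inner_add_right vreal_inner_vreal)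

lemma P_translate: "x + (2 * pi) *\<^sub>R vreal v \<in> ph.P m \<longleftrightarrow> x \<in> ph.P (\<lambda>\<alpha>. m \<alpha> + int_inner \<alpha> v)"
  by (simp add: ph.P_def u_translate distrib_left add_ac)

text \<open>The deck transformation relating \<open>x\<close> and \<open>y\<close> is absorbed into
  \<open>m'\<close>; two systems of lifts valid at one point differ by a constant.\<close>

lemma eqv_of_common_point:
  assumes "x \<in> ph.P m" "y \<in> ph.P m'" "proj x = proj y"
  shows "eqv m m'"
proof -
  obtain v where v: "y = x + (2 * pi) *\<^sub>R vreal v" using assms(3) unfolding proj_eq_iff by blast
  then have x': "x \<in> ph.P (\<lambda>\<alpha>. m' \<alpha> + int_inner \<alpha> v)" using assms(2) P_translate by simp
  obtain \<beta> where \<beta>: "\<beta> \<in> A" using ph.A_nonempty by blast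
  have "m' \<alpha> = m \<alpha> + int_inner \<alpha> (- v) + (m' \<beta> + int_inner \<beta> v - m \<beta>)" if "\<alpha> \<in> A" for \<alpha>
    using ph.P_lifts_unique[OF x' that \<beta>, of m] assms(1) that \<beta> by (simp add: ph.P_def int_inner_simps)
  then show ?thesis unfolding eqv_def by blast
qed

lemma proj_P_eqv:
  assumes "eqv m m'"
  shows "proj ` ph.P m = proj ` ph.P m'"
proof -
  have sub: "proj ` ph.P m' \<subseteq> proj ` ph.P m" if "eqv m m'" for m m'
  proof
    fix \<theta> assume "\<theta> \<in> proj ` ph.P m'"
    then obtain x where x: "x \<in> ph.P m'" "\<theta> = proj x" by blast
    obtain v d where "\<forall>\<alpha>\<in>A. m' \<alpha> = m \<alpha> + int_inner \<alpha> v + d" using \<open>eqv m m'\<close> unfolding eqv_def by blast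
    then have "ph.P m' = ph.P (\<lambda>\<alpha>. m \<alpha> + int_inner \<alpha> v + d)" by (intro ph.P_cong) simp
    also have "\<dots> = ph.P (\<lambda>\<alpha>. m \<alpha> + int_inner \<alpha> v)" by (rule ph.P_shift)
    finally have "x + (2 * pi) *\<^sub>R vreal v \<in> ph.P m" using x(1) P_translate by simp
    moreover have "proj x = proj (x + (2 * pi) *\<^sub>R vreal v)" unfolding proj_eq_iff by blast
    ultimately show "\<theta> \<in> proj ` ph.P m" unfolding x(2) by (intro image_eqI)
  qed
  show ?thesis using sub[OF assms] sub[OF eqv_sym[OF assms]] by (rule subset_antisym[rotated])
qed

definition nonempty_lifts :: "(int ^ 'n \<Rightarrow> int) set" where
  "nonempty_lifts = {m. ph.P m \<noteq> {}}"

definition volume_int :: int where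
  "volume_int = (\<Sum>k | k \<in> A \<and> l k > 0. \<bar>l k\<bar>)"

lemma N_eq: "ph.N = real_of_int volume_int"
proof -
  have "(\<Sum>\<alpha>\<in>A. \<bar>l \<alpha>\<bar>) = (\<Sum>\<alpha>\<in>A. 2 * (if l \<alpha> > 0 then \<bar>l \<alpha>\<bar> else 0) - l \<alpha>)"
    by (intro sum.cong refl) auto
  also have "\<dots> = 2 * (\<Sum>\<alpha>\<in>A. if l \<alpha> > 0 then \<bar>l \<alpha>\<bar> else 0)"
    by (simp add: sum_subtractf sum_l sum_distrib_left)
  also have "(\<Sum>\<alpha>\<in>A. if l \<alpha> > 0 then \<bar>l \<alpha>\<bar> else 0) = volume_int"
    unfolding volume_int_def using fin by (simp add: sum.If_cases Int_def)
  finally have "real_of_int (\<Sum>\<alpha>\<in>A. \<bar>l \<alpha>\<bar>) = real_of_int (2 * volume_int)" by simp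
  then show ?thesis by (simp add: ph.N_def)
qed

text \<open>\<open>Lam_bound\<close> and \<open>P_nonempty\<close> confine \<open>K m\<close> to an
  open interval of integer length \<open>volume_int\<close>. By genericity its ends are not
  integers, so it contains the same integers as a half-open window of that length with integer
  ends.\<close>

lemma nonempty_lifts_window: "\<exists>z. nonempty_lifts = {m. K m \<in> {z<..z + volume_int}}"
proof -
  define L where "L = (\<Sum>\<alpha>\<in>A. l \<alpha> * Arg (c \<alpha>))"
  \<comment> \<open>The lower end of the interval for \<open>K m\<close>, obtained from
    \<open>\<bar>Lam m\<bar> < pi * volume_int\<close> and
    \<open>Lam m = L + 2 * pi * K m\<close>.\<close>
  define r where "r = - L / (2 * pi) - volume_int / 2"
  have rZ: "r \<noteq> of_int k" for k :: int
  proof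
    assume "r = of_int k"
    then have "L = of_int (- 2 * k - volume_int) * pi" by (simp add: r_def field_simps)
    then have "sin L = 0" unfolding sin_zero_iff_int2 by blast
    then show False using sin_phase_nonzero by (simp add: L_def)
  qed
  have "m \<in> nonempty_lifts \<longleftrightarrow> K m \<in> {\<lfloor>r\<rfloor><..\<lfloor>r\<rfloor> + volume_int}" for m
  proof -
    have Lam: "ph.Lam m = L + 2 * pi * K m" by (simp add: ph.Lam_def L_def K_def)
    have "m \<in> nonempty_lifts \<longleftrightarrow> \<bar>ph.Lam m\<bar> < pi * volume_int"
      using ph.Lam_bound ph.P_nonempty unfolding nonempty_lifts_def N_eq by blast
    also have "\<dots> \<longleftrightarrow> - volume_int / 2 < ph.Lam m / (2 * pi) \<and> ph.Lam m / (2 * pi) < volume_int / 2"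
      by (auto simp: field_simps abs_less_iff)
    also have "ph.Lam m / (2 * pi) = K m - (r + volume_int / 2)"
      unfolding Lam by (simp add: r_def add_divide_distrib)
    also have "(- volume_int / 2 < K m - (r + volume_int / 2) \<and> K m - (r + volume_int / 2) < volume_int / 2) \<longleftrightarrow>
        r < K m \<and> of_int (K m - volume_int) < r"
      by (simp add: field_simps) linarith
    also have "\<dots> \<longleftrightarrow> \<lfloor>r\<rfloor> < K m \<and> K m - volume_int \<le> \<lfloor>r\<rfloor>"
    proof -
      have "r < K m \<longleftrightarrow> \<lfloor>r\<rfloor> < K m" by (rule floor_less_iff[symmetric])
      moreover have "of_int (K m - volume_int) < r \<longleftrightarrow> K m - volume_int \<le> \<lfloor>r\<rfloor>"
        using rZ[of "K m - volume_int"] unfolding le_floor_iff order_less_le by blast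
      ultimately show ?thesis by blast
    qed
    finally show ?thesis by auto
  qed
  then show ?thesis by blast
qed

lemma card_proj_P:
  "finite ((\<lambda>m. proj ` ph.P m) ` nonempty_lifts)"
  "real (card ((\<lambda>m. proj ` ph.P m) ` nonempty_lifts)) = fact CARD('n) * measure lebesgue (newton_polytope A)"
proof -
  obtain z where z: "nonempty_lifts = {m. K m \<in> {z<..z + volume_int}}" using nonempty_lifts_window by blast
  have "\<exists>h. bij_betw h (cls ` nonempty_lifts) ((\<lambda>m. proj ` ph.P m) ` nonempty_lifts)"
  proof (rule bij_betw_image_of_same_kernel)
    fix m m' assume m: "m \<in> nonempty_lifts" "m' \<in> nonempty_lifts"
    show "cls m = cls m' \<longleftrightarrow> proj ` ph.P m = proj ` ph.P m'"
      unfolding cls_eq_iff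
    proof
      assume eq: "proj ` ph.P m = proj ` ph.P m'"
      obtain x where x: "x \<in> ph.P m" using m(1) by (auto simp: nonempty_lifts_def)
      then have "proj x \<in> proj ` ph.P m'" using eq by blast
      then obtain y where "y \<in> ph.P m'" "proj x = proj y" by blast
      then show "eqv m m'" by (rule eqv_of_common_point[OF x])
    qed (rule proj_P_eqv)
  qed
  then obtain h where h: "bij_betw h (Cl {z<..z + volume_int}) ((\<lambda>m. proj ` ph.P m) ` nonempty_lifts)"
    unfolding Cl_def z by blast
  have "finite (Cl {z<..z + volume_int}) \<and> int (card (Cl {z<..z + volume_int})) = volume_int"
    unfolding volume_int_def by (rule card_Cl_sum) auto
  then show "finite ((\<lambda>m. proj ` ph.P m) ` nonempty_lifts)"
    "real (card ((\<lambda>m. proj ` ph.P m) ` nonempty_lifts)) = fact CARD('n) * measure lebesgue (newton_polytope A)"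
    using bij_betw_finite[OF h] bij_betw_same_card[OF h] unfolding volume volume_int_def[symmetric] by (simp, linarith)
qed

lemma components_lopsided:
  "components (- closure (lopsided_coamoeba A c)) = (\<lambda>m. proj ` ph.P m) ` nonempty_lifts"
proof (rule components_eq_partition)
  have "\<Union>((\<lambda>m. proj ` ph.P m) ` nonempty_lifts) = proj ` ph.Th"
    unfolding nonempty_lifts_def ph.Th_def by blast
  also have "ph.Th = proj -` (- closure (lopsided_coamoeba A c))"
    using vimage_closure_lopsided by auto
  also have "proj ` \<dots> = - closure (lopsided_coamoeba A c)"
    using surj_proj by (rule surj_image_vimage_eq)
  finally show "\<Union>((\<lambda>m. proj ` ph.P m) ` nonempty_lifts) = - closure (lopsided_coamoeba A c)" .
next
  fix C assume "C \<in> (\<lambda>m. proj ` ph.P m) ` nonempty_lifts"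
  then obtain m where m: "ph.P m \<noteq> {}" "C = proj ` ph.P m" by (auto simp: nonempty_lifts_def)
  then show "open C \<and> connected C \<and> C \<noteq> {}"
    by (auto intro!: open_proj_image ph.open_P connected_continuous_image continuous_proj convex_connected ph.convex_P)
next
  fix C D assume "C \<in> (\<lambda>m. proj ` ph.P m) ` nonempty_lifts" "D \<in> (\<lambda>m. proj ` ph.P m) ` nonempty_lifts"
    and CD: "C \<inter> D \<noteq> {}"
  then obtain m m' where m: "C = proj ` ph.P m" "D = proj ` ph.P m'" by blast
  obtain \<theta> where "\<theta> \<in> C" "\<theta> \<in> D" using CD by blast
  then obtain x y where "x \<in> ph.P m" "y \<in> ph.P m'" "\<theta> = proj x" "\<theta> = proj y" unfolding m by (elim imageE) (rule that)
  then have "eqv m m'" by (intro eqv_of_common_point[of x m y]) simp_all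
  then show "C = D" unfolding m by (rule proj_P_eqv)
qed

text \<open>Each cell is sent to the component of the larger complement that contains it. Every
  component is reached by \<open>Om_connects_to_Th\<close>, and cells with the same image are
  equivalent by \<open>separation\<close>.\<close>

lemma components_coamoeba:
  "\<exists>h. bij_betw h ((\<lambda>m. proj ` ph.P m) ` nonempty_lifts) (components (- closure (coamoeba A c)))"
proof -
  let ?S = "- closure (coamoeba A c)"
  have vS: "proj -` ?S = ph.Om"
    unfolding vimage_Compl closure_proj_vimage vimage_coamoeba ph.Om_def ..
  have opS: "open ?S" by (rule open_Compl[OF closed_closure])
  define E where "E x = proj ` connected_component_set ph.Om x" for x
  have comp: "components ?S = E ` ph.Om" unfolding components_proj[OF opS] vS E_def ..
  define pt where "pt m = (SOME x. x \<in> ph.P m)" for m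
  have pt: "pt m \<in> ph.P m" if "m \<in> nonempty_lifts" for m
    using that unfolding nonempty_lifts_def pt_def by (simp add: some_in_eq)
  have POm: "ph.P m \<subseteq> ph.Om" for m using ph.Th_subset_Om unfolding ph.Th_def by blast
  have cc: "y \<in> connected_component_set ph.Om x" if "x \<in> ph.P m" "y \<in> ph.P m" for x y m
    using connected_component_maximal[OF that(1) convex_connected[OF ph.convex_P] POm] that(2) by blast
  have cceq: "connected_component_set ph.Om x = connected_component_set ph.Om y"
    if "y \<in> connected_component_set ph.Om x" for x y
    using connected_component_eq[OF that] by simp
  define g where "g m = E (pt m)" for m
  have gE: "g ` nonempty_lifts = E ` ph.Om"
  proof
    show "g ` nonempty_lifts \<subseteq> E ` ph.Om" using pt POm by (auto simp: g_def)
    show "E ` ph.Om \<subseteq> g ` nonempty_lifts"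
    proof
      fix X assume "X \<in> E ` ph.Om"
      then obtain x where x: "x \<in> ph.Om" "X = E x" by blast
      obtain C where C: "connected C" "x \<in> C" "C \<subseteq> ph.Om" "C \<inter> ph.Th \<noteq> {}"
        by (rule ph.Om_connects_to_Th[OF x(1)]) (rule that)
      then obtain y m where y: "y \<in> C" "y \<in> ph.P m" by (auto simp: ph.Th_def)
      then have m: "m \<in> nonempty_lifts" by (auto simp: nonempty_lifts_def)
      have xy: "y \<in> connected_component_set ph.Om x" using connected_component_maximal[OF C(2,1,3)] y(1) by blast
      have ypt: "pt m \<in> connected_component_set ph.Om y" by (rule cc[OF y(2) pt[OF m]])
      have "E x = g m" unfolding g_def E_def cceq[OF xy] cceq[OF ypt] ..
      then show "X \<in> g ` nonempty_lifts" unfolding x(2) using m by blast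
    qed
  qed
  have "\<exists>h. bij_betw h ((\<lambda>m. proj ` ph.P m) ` nonempty_lifts) (g ` nonempty_lifts)"
  proof (rule bij_betw_image_of_same_kernel)
    fix m m' assume m: "m \<in> nonempty_lifts" "m' \<in> nonempty_lifts"
    have gc: "g m \<in> components ?S" "g m' \<in> components ?S" unfolding comp using gE m by blast+
    have self: "proj (pt k) \<in> g k" if "k \<in> nonempty_lifts" for k
      unfolding g_def E_def using cc[OF pt[OF that] pt[OF that]] by blast
    show "proj ` ph.P m = proj ` ph.P m' \<longleftrightarrow> g m = g m'"
    proof
      assume "proj ` ph.P m = proj ` ph.P m'"
      then have "proj (pt m') \<in> proj ` ph.P m" using pt[OF m(2)] by blast
      then obtain q where "q \<in> ph.P m" "proj (pt m') = proj q" by blast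
      then have "proj (pt m') \<in> g m" unfolding g_def E_def using cc[OF pt[OF m(1)]] by auto
      then have "g m \<inter> g m' \<noteq> {}" using self[OF m(2)] by blast
      then show "g m = g m'" using components_nonoverlap[OF gc] by blast
    next
      assume "g m = g m'"
      then have "proj (pt m') \<in> g m" using self[OF m(2)] by simp
      \<comment> \<open>The component of \<open>pt m\<close> upstairs need only contain a translate
        \<open>q\<close> of \<open>pt m'\<close>; absorbing the translation into the lifts makes
        \<open>separation\<close> applicable.\<close>
      then obtain q where q: "q \<in> connected_component_set ph.Om (pt m)" "proj (pt m') = proj q"
        unfolding g_def E_def by blast
      obtain v where v: "pt m' = q + (2 * pi) *\<^sub>R vreal v" using q(2)[symmetric] unfolding proj_eq_iff by blast
      have q': "q \<in> ph.P (\<lambda>\<alpha>. m' \<alpha> + int_inner \<alpha> v)" using pt[OF m(2)] unfolding v P_translate .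
      have "pt m \<in> connected_component_set ph.Om (pt m)" by (rule cc[OF pt[OF m(1)] pt[OF m(1)]])
      then have "\<exists>d. \<forall>\<alpha>\<in>A. m' \<alpha> + int_inner \<alpha> v = m \<alpha> + d"
        using connected_connected_component connected_component_subset q(1) pt[OF m(1)] q' by (intro ph.separation)
      then obtain d where d: "\<forall>\<alpha>\<in>A. m' \<alpha> + int_inner \<alpha> v = m \<alpha> + d" by blast
      have "m' \<alpha> = m \<alpha> + int_inner \<alpha> (- v) + d" if "\<alpha> \<in> A" for \<alpha>
        using bspec[OF d that] by (simp add: int_inner_simps)
      then have "eqv m m'" unfolding eqv_def by blast
      then show "proj ` ph.P m = proj ` ph.P m'" by (rule proj_P_eqv)
    qed
  qed
  then show ?thesis unfolding gE comp .
qed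

lemma has_components_lopsided:
  "has_components (- closure (lopsided_coamoeba A c)) (fact CARD('n) * measure lebesgue (newton_polytope A))"
  unfolding has_components_def components_lopsided using card_proj_P by simp

lemma has_components_coamoeba:
  "has_components (- closure (coamoeba A c)) (fact CARD('n) * measure lebesgue (newton_polytope A))"
  using card_proj_P components_coamoeba by (rule finite_components_card)

end

section \<open>Genericity\<close>

lemma continuous_map_Im_prod:
  fixes l :: "'a \<Rightarrow> int"
  assumes "finite A"
  shows "continuous_map (coefficient_space A) euclideanreal (\<lambda>c. Im (\<Prod>\<alpha>\<in>A. c \<alpha> powi l \<alpha>))"
proof -
  have "continuous_map (coefficient_space A) euclidean (\<lambda>c. c \<alpha> powi l \<alpha>)" if "\<alpha> \<in> A" for \<alpha>
  proof -
    have "continuous_map (coefficient_space A) (top_of_set (- {0})) (\<lambda>c. c \<alpha>)"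
      unfolding coefficient_space_def using that by (rule continuous_map_product_projection)
    moreover have "continuous_map (top_of_set (- {0 :: complex})) euclidean (\<lambda>z. z powi l \<alpha>)"
      unfolding continuous_map_iff_continuous by (intro continuous_intros) auto
    ultimately have "continuous_map (coefficient_space A) euclidean ((\<lambda>z. z powi l \<alpha>) \<circ> (\<lambda>c. c \<alpha>))"
      by (rule continuous_map_compose)
    then show ?thesis unfolding comp_def .
  qed
  then show ?thesis
    unfolding continuous_map_atin limitin_canonical_iff
    by (intro ballI conjI tendsto_Im tendsto_prod) simp_all
qed

lemma topspace_coefficient_space: "c \<in> topspace (coefficient_space A) \<longleftrightarrow> c \<in> extensional A \<and> (\<forall>\<alpha>\<in>A. c \<alpha> \<noteq> 0)"
  by (auto simp: coefficient_space_def PiE_def Pi_def)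

text \<open>Rotating the single coefficient \<open>c k\<close> by a small angle
  \<open>\<epsilon>\<close> rotates the nonzero product by \<open>l k * \<epsilon>\<close>, which
  takes it off the real axis.\<close>

lemma dense_Im_prod:
  fixes l :: "'a \<Rightarrow> int"
  assumes fin: "finite A" and k: "k \<in> A" "l k \<noteq> 0"
  shows "coefficient_space A closure_of {c \<in> topspace (coefficient_space A). Im (\<Prod>\<alpha>\<in>A. c \<alpha> powi l \<alpha>) \<noteq> 0}
    = topspace (coefficient_space A)"
proof (rule subset_antisym[OF closure_of_subset_topspace], rule subsetI)
  let ?X = "coefficient_space A"
  fix c assume c: "c \<in> topspace ?X"
  define \<pi> where "\<pi> = (\<Prod>\<alpha>\<in>A. c \<alpha> powi l \<alpha>)"
  have cn: "c \<alpha> \<noteq> 0" if "\<alpha> \<in> A" for \<alpha> using c that unfolding topspace_coefficient_space by blast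
  have \<pi>0: "\<pi> \<noteq> 0" unfolding \<pi>_def using fin cn by (simp add: prod_zero_iff)
  define g where "g \<epsilon> = (\<lambda>\<alpha>. if \<alpha> = k then c k * cis \<epsilon> else c \<alpha>)" for \<epsilon> :: real
  have gX: "g \<epsilon> \<in> topspace ?X" for \<epsilon>
    using c k unfolding topspace_coefficient_space by (auto simp: g_def extensional_def)
  have g0: "g 0 = c" by (auto simp: g_def)
  have cont: "continuous_map euclideanreal ?X g"
    unfolding coefficient_space_def continuous_map_componentwise
  proof (intro conjI ballI)
    show "g ` topspace euclideanreal \<subseteq> extensional A" using gX topspace_coefficient_space by blast
    fix \<alpha> assume \<alpha>: "\<alpha> \<in> A"
    have "continuous_on UNIV (\<lambda>x. g x \<alpha>)"
      by (cases "\<alpha> = k") (auto simp: g_def intro!: continuous_intros)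
    moreover have "g x \<alpha> \<noteq> 0" for x
      using gX[of x] \<alpha> unfolding topspace_coefficient_space by blast
    ultimately show "continuous_map euclideanreal (top_of_set (- {0})) (\<lambda>x. g x \<alpha>)"
      by (auto simp: continuous_map_in_subtopology)
  qed
  have prodg: "(\<Prod>\<alpha>\<in>A. g \<epsilon> \<alpha> powi l \<alpha>) = \<pi> * cis (l k * \<epsilon>)" for \<epsilon> :: real
  proof -
    have "(\<Prod>\<alpha>\<in>A. g \<epsilon> \<alpha> powi l \<alpha>) = (c k * cis \<epsilon>) powi l k * (\<Prod>\<alpha>\<in>A - {k}. c \<alpha> powi l \<alpha>)"
      using fin k by (subst prod.remove[of A k]) (auto simp: g_def intro!: prod.cong)
    also have "\<dots> = (c k powi l k * (\<Prod>\<alpha>\<in>A - {k}. c \<alpha> powi l \<alpha>)) * cis (l k * \<epsilon>)"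
      by (simp add: power_int_mult_distrib cis_power_int)
    also have "c k powi l k * (\<Prod>\<alpha>\<in>A - {k}. c \<alpha> powi l \<alpha>) = \<pi>"
      unfolding \<pi>_def using fin k by (subst prod.remove[of A k]) simp_all
    finally show ?thesis .
  qed
  show "c \<in> ?X closure_of {c \<in> topspace ?X. Im (\<Prod>\<alpha>\<in>A. c \<alpha> powi l \<alpha>) \<noteq> 0}"
    unfolding in_closure_of
  proof (intro conjI allI impI)
    show "c \<in> topspace ?X" by (rule c)
    fix T assume T: "c \<in> T \<and> openin ?X T"
    have "openin euclideanreal {x \<in> topspace euclideanreal. g x \<in> T}"
      using openin_continuous_map_preimage[OF cont] T by blast
    then have "open {x. g x \<in> T}" by simp
    moreover have "0 \<in> {x. g x \<in> T}" using T g0 by simp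
    ultimately obtain e where e: "e > 0" "ball 0 e \<subseteq> {x. g x \<in> T}" by (rule openE)
    have "\<exists>\<epsilon> :: real. \<bar>\<epsilon>\<bar> < e \<and> Im (\<pi> * cis (l k * \<epsilon>)) \<noteq> 0"
    proof (cases "Im \<pi> = 0")
      case False
      then show ?thesis using e(1) by (intro exI[of _ 0]) simp
    next
      case True
      \<comment> \<open>The second bound keeps \<open>\<bar>l k\<bar> * \<epsilon>\<close> below
        \<open>pi\<close>, so that its sine is not 0.\<close>
      define \<epsilon> where "\<epsilon> = min (e / 2) (1 / \<bar>real_of_int (l k)\<bar>)"
      have \<epsilon>: "\<epsilon> > 0" "\<epsilon> < e" "\<bar>real_of_int (l k)\<bar> * \<epsilon> \<le> 1"
        using e(1) k by (auto simp: \<epsilon>_def min_def field_simps)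
      have "\<bar>real_of_int (l k)\<bar> * \<epsilon> < pi" using \<epsilon>(3) pi_gt3 by linarith
      then have "sin (\<bar>real_of_int (l k)\<bar> * \<epsilon>) > 0" using \<epsilon>(1) k by (intro sin_gt_zero) auto
      then have "sin (l k * \<epsilon>) \<noteq> 0" by (cases "l k > 0") auto
      moreover have "Re \<pi> \<noteq> 0" using True \<pi>0 by (auto simp: complex_eq_iff)
      ultimately show ?thesis using True \<epsilon>(1,2) by (intro exI[of _ \<epsilon>]) simp
    qed
    then obtain \<epsilon> :: real where \<epsilon>: "\<bar>\<epsilon>\<bar> < e" "Im (\<pi> * cis (l k * \<epsilon>)) \<noteq> 0" by blast
    have "g \<epsilon> \<in> T" using \<epsilon>(1) e(2) by auto
    moreover have "g \<epsilon> \<in> {c \<in> topspace ?X. Im (\<Prod>\<alpha>\<in>A. c \<alpha> powi l \<alpha>) \<noteq> 0}" using gX \<epsilon>(2) prodg by simp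
    ultimately show "\<exists>y. y \<in> {c \<in> topspace ?X. Im (\<Prod>\<alpha>\<in>A. c \<alpha> powi l \<alpha>) \<noteq> 0} \<and> y \<in> T" by blast
  qed
qed

theorem theorem5p2:
  fixes A :: "(int ^ 'n::finite) set"
  assumes "circuit A"
  shows "for_generic_coefficients A (\<lambda>c.
           has_components (- closure (lopsided_coamoeba A c))
             (fact CARD('n) * measure lebesgue (newton_polytope A)) \<and>
           has_components (- closure (coamoeba A c))
             (fact CARD('n) * measure lebesgue (newton_polytope A)))"
proof -
  obtain l :: "int ^ 'n \<Rightarrow> int" where l: "\<And>\<alpha>. \<alpha> \<in> A \<Longrightarrow> l \<alpha> \<noteq> 0" "(\<Sum>\<alpha>\<in>A. l \<alpha>) = 0"
    "\<And>k. (\<Sum>\<alpha>\<in>A. l \<alpha> * \<alpha> $ k) = 0" "\<And>\<alpha>. \<alpha> \<in> A \<Longrightarrow> \<bar>real_of_int (l \<alpha>)\<bar> = simplex_vol A \<alpha>"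
    by (rule ex_circuit_relation[OF assms]) (rule that)
  obtain b :: "int ^ 'n \<Rightarrow> real ^ 'n" where b: "\<And>\<delta> :: int ^ 'n \<Rightarrow> real. (\<Sum>\<alpha>\<in>A. l \<alpha> * \<delta> \<alpha>) = 0 \<Longrightarrow>
      \<exists>s. \<forall>\<alpha>\<in>A. \<delta> \<alpha> = vreal \<alpha> \<bullet> (\<Sum>\<beta>\<in>A. \<delta> \<beta> *\<^sub>R b \<beta>) + s"
    using circuit_dual[OF assms l(1-3)] by blast
  have rel: "circuit_relation A l" using assms l by unfold_locales
  have fin: "finite A" and "A \<noteq> {}"
    using circuit_finite[OF assms] circuit_card[OF assms] by auto
  then obtain k where k: "k \<in> A" by blast
  \<comment> \<open>The coefficients whose product is not real, which is the genericity condition on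
    the arguments by \<open>sin_phase_nonzero\<close>.\<close>
  let ?U = "{c \<in> topspace (coefficient_space A). Im (\<Prod>\<alpha>\<in>A. c \<alpha> powi l \<alpha>) \<noteq> 0}"
  have "openin (coefficient_space A) {c \<in> topspace (coefficient_space A). Im (\<Prod>\<alpha>\<in>A. c \<alpha> powi l \<alpha>) \<in> - {0}}"
    by (rule openin_continuous_map_preimage[OF continuous_map_Im_prod[OF fin]]) auto
  then have "openin (coefficient_space A) ?U" by simp
  moreover have "coefficient_space A closure_of ?U = topspace (coefficient_space A)"
    by (rule dense_Im_prod[of A k l, OF fin k l(1)[OF k]])
  moreover have "has_components (- closure (lopsided_coamoeba A c))
        (fact CARD('n) * measure lebesgue (newton_polytope A)) \<and>
      has_components (- closure (coamoeba A c))
        (fact CARD('n) * measure lebesgue (newton_polytope A))" if "c \<in> ?U" for c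
  proof -
    interpret generic_coefficients A l b c
      using rel b that
      by (intro generic_coefficients.intro generic_coefficients_axioms.intro) (auto simp: topspace_coefficient_space)
    show ?thesis using has_components_lopsided has_components_coamoeba by blast
  qed
  ultimately show ?thesis unfolding for_generic_coefficients_def by blast
qed

end
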